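(* Let $M^m$ be an $m$-dimensional biharmonic pseudo-umbilical submanifold of the unit Euclidean sphere $\mathbb{S}^n$, with $m\neq 4$. Then its scalar curvature $s$ satisfies $$s\leq 2m(m-1).$$ The equality holds if and only if $M$ is open in $\mathbb{S}^m\big(\tfrac1{\sqrt2}\big)$, i.e. $M$ is an open subset of an $m$-dimensional sphere of radius $\tfrac1{\sqrt2}$ in $\mathbb{S}^n$.
   Context: For a smooth map $\phi:(M,g)\to(N,h)$ between Riemannian manifolds, the tension field is $\tau(\phi)=\operatorname{trace}\nabla d\phi$ and the bitension field is $\tau_2(\phi)=-\Delta\tau(\phi)-\operatorname{trace}R^N(d\phi,\tau(\phi))d\phi$, where $\Delta=-\operatorname{trace}\nabla^2$ is the rough Laplacian on sections of $\phi^{-1}TN$ and $R^N(X,Y)=[\nabla_X,\nabla_Y]-\nabla_{[X,Y]}$ is the curvature of $N$. The map $\phi$ is biharmonic if $\tau_2(\phi)=0$. A submanifold $M$ of $N$ (with the induced metric) is called biharmonic if its inclusion map is biharmonic. The mean curvature vector field of $M^m$ is $H=\frac1m\operatorname{trace}B$, with $B$ the second fundamental form. A submanifold $M$ of a Riemannian manifold $N$ is pseudo-umbilical if there is a function $\lambda\in C^\infty(M)$ such that $A_H=\lambda\operatorname{Id}$, where $A_H$ is the Weingarten (shape) operator associated to $H$. The scalar curvature is the trace of the Ricci tensor (so the unit sphere $\mathbb{S}^m$ has scalar curvature $m(m-1)$). An $m$-dimensional sphere $\mathbb{S}^m(r)\subset\mathbb{S}^n$ of radius $r$ is an intersection of $\mathbb{S}^n\subset\mathbb{R}^{n+1}$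 with an $(m+1)$-dimensional affine subspace that is a Euclidean sphere of radius $r$.
   Formalization: M is taken nonempty and connected, and the equality characterization is stated for m ≥ 2 only: it fails for two pieces of different spheres of radius 1/√2, and for m = 1, where a great circle arc has s = 0 = 2m(m−1). *)

theory Defs
  imports "HOL-Analysis.Analysis"
begin

text \<open>
  Riemannian manifolds occur here as smooth submanifolds of Euclidean spaces with the induced
  metric. An immersed submanifold is represented by its manifold topology \<open>M\<close>, a topology on the
  point set \<open>topspace M\<close> that may be finer than the subspace topology; an embedded submanifold
  is \<open>top_of_set S\<close>. Vector fields and sections of pull-back bundles are functions into the
  ambient space, and only their values on \<open>topspace M\<close> matter.
\<close>

subsection \<open>Smooth functions and submanifolds\<close>

text \<open>Meaningful for open \<open>U\<close>; directional derivatives suffice as the domain is finite-dimensional.\<close>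

primrec Ck_on :: "nat \<Rightarrow> 'a::euclidean_space set \<Rightarrow> ('a \<Rightarrow> 'b::euclidean_space) \<Rightarrow> bool" where
  "Ck_on 0 U f \<longleftrightarrow> continuous_on U f"
| "Ck_on (Suc k) U f \<longleftrightarrow>
     (\<forall>x\<in>U. f differentiable (at x)) \<and> (\<forall>v. Ck_on k U (\<lambda>x. frechet_derivative f (at x) v))"

definition smooth_on :: "'a::euclidean_space set \<Rightarrow> ('a \<Rightarrow> 'b::euclidean_space) \<Rightarrow> bool" where
  "smooth_on U f \<longleftrightarrow> (\<forall>k. Ck_on k U f)"

text \<open>
  Each point has an \<open>M\<close>-open neighbourhood \<open>W\<close> that carries the subspace topology and is cut out
  by a slice chart: a diffeomorphism \<open>F\<close> (with inverse \<open>G\<close>) between open sets of the ambient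
  space, mapping \<open>W\<close> to a linear subspace \<open>S\<close> of dimension \<open>m\<close>. The Hausdorff property is automatic.
\<close>

definition immersed_submanifold :: "nat \<Rightarrow> 'a::euclidean_space topology \<Rightarrow> bool" where
  "immersed_submanifold m M \<longleftrightarrow> second_countable M \<and>
     (\<forall>p\<in>topspace M. \<exists>W U (F :: 'a \<Rightarrow> 'a) G S.
        p \<in> W \<and> openin M W \<and> subtopology M W = top_of_set W \<and>
        open U \<and> open (F ` U) \<and> smooth_on U F \<and> smooth_on (F ` U) G \<and> (\<forall>x\<in>U. G (F x) = x) \<and>
        subspace S \<and> dim S = m \<and> W = {x \<in> U. F x \<in> S})"

definition smooth_fun :: "'a::euclidean_space topology \<Rightarrow> ('a \<Rightarrow> 'b::euclidean_space) \<Rightarrow> bool" where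
  "smooth_fun M f \<longleftrightarrow>
     (\<forall>p\<in>topspace M. \<exists>W U g. p \<in> W \<and> openin M W \<and> open U \<and> W \<subseteq> U \<and> smooth_on U g \<and>
        (\<forall>x\<in>W. f x = g x))"

definition smooth_map ::
    "'a::euclidean_space topology \<Rightarrow> 'b::euclidean_space topology \<Rightarrow> ('a \<Rightarrow> 'b) \<Rightarrow> bool" where
  "smooth_map M N \<phi> \<longleftrightarrow> continuous_map M N \<phi> \<and> smooth_fun M \<phi>"

definition tangent_space :: "'a::euclidean_space topology \<Rightarrow> 'a \<Rightarrow> 'a set" where
  "tangent_space M p =
     {v. \<exists>c \<epsilon>. 0 < \<epsilon> \<and> smooth_on {-\<epsilon><..<\<epsilon>} c \<and> continuous_map (top_of_set {-\<epsilon><..<\<epsilon>}) M c \<and>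
            c (0::real) = p \<and> (c has_vector_derivative v) (at 0)}"

text \<open>
  \<open>atin M p\<close> is the filter of punctured \<open>M\<close>-neighbourhoods of \<open>p\<close>, which is \<open>at p within S\<close> for
  \<open>M = top_of_set S\<close>. A derivative along this filter is determined by \<open>f\<close> only on tangent
  vectors at \<open>p\<close>; below it is applied to nothing else.
\<close>

definition differential ::
    "'a::euclidean_space topology \<Rightarrow> ('a \<Rightarrow> 'b::euclidean_space) \<Rightarrow> 'a \<Rightarrow> 'a \<Rightarrow> 'b" where
  "differential M f p = frechet_derivative f (atin M p)"

definition orth_proj :: "'a::euclidean_space set \<Rightarrow> 'a \<Rightarrow> 'a" where
  "orth_proj S v = (THE w. w \<in> S \<and> (\<forall>u\<in>S. orthogonal (v - w) u))"

definition orthonormal_basis :: "'a::euclidean_space set \<Rightarrow> 'a set \<Rightarrow> bool" where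
  "orthonormal_basis S B \<longleftrightarrow>
     B \<subseteq> S \<and> pairwise orthogonal B \<and> (\<forall>e\<in>B. norm e = 1) \<and> span B = S"

text \<open>The metric trace of a bilinear form on the tangent space, computed in an orthonormal basis.\<close>

definition tangent_trace ::
    "'a::euclidean_space topology \<Rightarrow> 'a \<Rightarrow> ('a \<Rightarrow> 'a \<Rightarrow> 'b::euclidean_space) \<Rightarrow> 'b" where
  "tangent_trace M p b = (\<Sum>e\<in>(SOME B. orthonormal_basis (tangent_space M p) B). b e e)"

subsection \<open>Connections and curvature\<close>

text \<open>
  The Levi-Civita connection of the induced metric on \<open>N\<close> is the tangential part of the ambient
  derivative; its pull-back along \<open>\<phi>\<close> differentiates sections \<open>V\<close> of \<open>\<phi>\<^sup>-\<^sup>1TN\<close> in the direction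
  of vector fields \<open>X\<close> on \<open>M\<close>.
\<close>

definition pullback_connection ::
    "'a::euclidean_space topology \<Rightarrow> 'b::euclidean_space topology \<Rightarrow> ('a \<Rightarrow> 'b) \<Rightarrow>
     ('a \<Rightarrow> 'a) \<Rightarrow> ('a \<Rightarrow> 'b) \<Rightarrow> 'a \<Rightarrow> 'b" where
  "pullback_connection M N \<phi> X V p =
     orth_proj (tangent_space N (\<phi> p)) (differential M V p (X p))"

definition levi_civita ::
    "'a::euclidean_space topology \<Rightarrow> ('a \<Rightarrow> 'a) \<Rightarrow> ('a \<Rightarrow> 'a) \<Rightarrow> 'a \<Rightarrow> 'a" where
  "levi_civita M = pullback_connection M M (\<lambda>x. x)"

definition lie_bracket ::
    "'a::euclidean_space topology \<Rightarrow> ('a \<Rightarrow> 'a) \<Rightarrow> ('a \<Rightarrow> 'a) \<Rightarrow> 'a \<Rightarrow> 'a" where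
  "lie_bracket M X Y p = differential M Y p (X p) - differential M X p (Y p)"

text \<open>
  Tensors at \<open>p\<close> are evaluated on vectors \<open>v \<in> T\<^sub>pM\<close> by extending \<open>v\<close> to the smooth tangent
  field \<open>q \<mapsto> orth_proj (T\<^sub>qM) v\<close>; the result does not depend on the extension.
\<close>

definition tangent_extension :: "'a::euclidean_space topology \<Rightarrow> 'a \<Rightarrow> 'a \<Rightarrow> 'a" where
  "tangent_extension M v q = orth_proj (tangent_space M q) v"

definition curvature_field ::
    "'a::euclidean_space topology \<Rightarrow> ('a \<Rightarrow> 'a) \<Rightarrow> ('a \<Rightarrow> 'a) \<Rightarrow> ('a \<Rightarrow> 'a) \<Rightarrow> 'a \<Rightarrow> 'a" where
  "curvature_field M X Y Z p =
     levi_civita M X (levi_civita M Y Z) p - levi_civita M Y (levi_civita M X Z) p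
     - levi_civita M (lie_bracket M X Y) Z p"

definition curvature_tensor ::
    "'a::euclidean_space topology \<Rightarrow> 'a \<Rightarrow> 'a \<Rightarrow> 'a \<Rightarrow> 'a \<Rightarrow> 'a" where
  "curvature_tensor M p x y z =
     curvature_field M (tangent_extension M x) (tangent_extension M y) (tangent_extension M z) p"

text \<open>\<open>Ric(y,z)\<close> is the trace of \<open>x \<mapsto> R(x,y)z\<close>.\<close>

definition ricci_tensor :: "'a::euclidean_space topology \<Rightarrow> 'a \<Rightarrow> 'a \<Rightarrow> 'a \<Rightarrow> real" where
  "ricci_tensor M p y z = tangent_trace M p (\<lambda>e e'. curvature_tensor M p e y z \<bullet> e')"

definition scalar_curvature :: "'a::euclidean_space topology \<Rightarrow> 'a \<Rightarrow> real" where
  "scalar_curvature M p = tangent_trace M p (ricci_tensor M p)"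

subsection \<open>Biharmonic maps\<close>

text \<open>\<open>(\<nabla>d\<phi>)(x,y) = \<nabla>\<^sup>\<phi>\<^sub>X(d\<phi> Y) - d\<phi>(\<nabla>\<^sub>XY)\<close>\<close>

definition hessian_map ::
    "'a::euclidean_space topology \<Rightarrow> 'b::euclidean_space topology \<Rightarrow> ('a \<Rightarrow> 'b) \<Rightarrow>
     'a \<Rightarrow> 'a \<Rightarrow> 'a \<Rightarrow> 'b" where
  "hessian_map M N \<phi> p x y =
     (let X = tangent_extension M x; Y = tangent_extension M y in
        pullback_connection M N \<phi> X (\<lambda>q. differential M \<phi> q (Y q)) p
        - differential M \<phi> p (levi_civita M X Y p))"

definition tension_field ::
    "'a::euclidean_space topology \<Rightarrow> 'b::euclidean_space topology \<Rightarrow> ('a \<Rightarrow> 'b) \<Rightarrow> 'a \<Rightarrow> 'b" where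
  "tension_field M N \<phi> p = tangent_trace M p (hessian_map M N \<phi> p)"

text \<open>\<open>\<nabla>\<^sup>2V(x,y) = \<nabla>\<^sub>X\<nabla>\<^sub>YV - \<nabla>\<^bsub>\<nabla>\<^sub>XY\<^esub>V\<close>\<close>

definition second_covariant_derivative ::
    "'a::euclidean_space topology \<Rightarrow> 'b::euclidean_space topology \<Rightarrow> ('a \<Rightarrow> 'b) \<Rightarrow>
     ('a \<Rightarrow> 'b) \<Rightarrow> 'a \<Rightarrow> 'a \<Rightarrow> 'a \<Rightarrow> 'b" where
  "second_covariant_derivative M N \<phi> V p x y =
     (let X = tangent_extension M x; Y = tangent_extension M y in
        pullback_connection M N \<phi> X (pullback_connection M N \<phi> Y V) p
        - pullback_connection M N \<phi> (levi_civita M X Y) V p)"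

definition rough_laplacian ::
    "'a::euclidean_space topology \<Rightarrow> 'b::euclidean_space topology \<Rightarrow> ('a \<Rightarrow> 'b) \<Rightarrow>
     ('a \<Rightarrow> 'b) \<Rightarrow> 'a \<Rightarrow> 'b" where
  "rough_laplacian M N \<phi> V p = - tangent_trace M p (second_covariant_derivative M N \<phi> V p)"

definition bitension_field ::
    "'a::euclidean_space topology \<Rightarrow> 'b::euclidean_space topology \<Rightarrow> ('a \<Rightarrow> 'b) \<Rightarrow> 'a \<Rightarrow> 'b" where
  "bitension_field M N \<phi> p =
     - rough_laplacian M N \<phi> (tension_field M N \<phi>) p
     - tangent_trace M p (\<lambda>x y. curvature_tensor N (\<phi> p)
         (differential M \<phi> p x) (tension_field M N \<phi> p) (differential M \<phi> p y))"

definition biharmonic_map ::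
    "'a::euclidean_space topology \<Rightarrow> 'b::euclidean_space topology \<Rightarrow> ('a \<Rightarrow> 'b) \<Rightarrow> bool" where
  "biharmonic_map M N \<phi> \<longleftrightarrow>
     smooth_map M N \<phi> \<and> (\<forall>p\<in>topspace M. bitension_field M N \<phi> p = 0)"

definition biharmonic_submanifold ::
    "'a::euclidean_space topology \<Rightarrow> 'a topology \<Rightarrow> bool" where
  "biharmonic_submanifold M N \<longleftrightarrow> biharmonic_map M N (\<lambda>x. x)"

subsection \<open>Submanifolds of a Riemannian manifold\<close>

definition second_fundamental_form ::
    "'a::euclidean_space topology \<Rightarrow> 'a topology \<Rightarrow> 'a \<Rightarrow> 'a \<Rightarrow> 'a \<Rightarrow> 'a" where
  "second_fundamental_form M N p x y =
     (let X = tangent_extension M x; Y = tangent_extension M y in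
        pullback_connection M N (\<lambda>x. x) X Y p - levi_civita M X Y p)"

definition mean_curvature_vector ::
    "nat \<Rightarrow> 'a::euclidean_space topology \<Rightarrow> 'a topology \<Rightarrow> 'a \<Rightarrow> 'a" where
  "mean_curvature_vector m M N p =
     (1 / real m) *\<^sub>R tangent_trace M p (second_fundamental_form M N p)"

text \<open>Weingarten formula: \<open>A\<^sub>\<xi>(x)\<close> is minus the part of \<open>\<nabla>\<^sup>N\<^sub>x \<xi>\<close> tangent to \<open>M\<close>.\<close>

definition shape_operator ::
    "'a::euclidean_space topology \<Rightarrow> 'a topology \<Rightarrow> ('a \<Rightarrow> 'a) \<Rightarrow> 'a \<Rightarrow> 'a \<Rightarrow> 'a" where
  "shape_operator M N \<xi> p x =
     - orth_proj (tangent_space M p)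
         (pullback_connection M N (\<lambda>x. x) (tangent_extension M x) \<xi> p)"

definition pseudo_umbilical ::
    "nat \<Rightarrow> 'a::euclidean_space topology \<Rightarrow> 'a topology \<Rightarrow> bool" where
  "pseudo_umbilical m M N \<longleftrightarrow>
     (\<exists>f :: 'a \<Rightarrow> real. smooth_fun M f \<and>
        (\<forall>p\<in>topspace M. \<forall>x\<in>tangent_space M p.
           shape_operator M N (mean_curvature_vector m M N) p x = f p *\<^sub>R x))"

text \<open>An \<open>m\<close>-dimensional sphere of radius \<open>r\<close> in the unit sphere.\<close>

definition subsphere :: "nat \<Rightarrow> real \<Rightarrow> 'a::euclidean_space set \<Rightarrow> bool" where
  "subsphere m r S \<longleftrightarrow>
     (\<exists>A c. affine A \<and> aff_dim A = int m + 1 \<and> c \<in> A \<and>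
        S = sphere 0 1 \<inter> A \<and> S = sphere c r \<inter> A)"

end

theory Submission
  imports Defs
begin

text \<open>
  Write \<open>P\<close> for the orthogonal projection onto the tangent spaces of \<open>M\<close>, extended to an open subset
  of the Euclidean space by a local retraction onto \<open>M\<close>. Its derivative \<open>(D\<^sub>x P) y\<close> is the second
  fundamental form of \<open>M\<close> in the Euclidean space when \<open>x, y\<close> are tangent, and the mean curvature
  vector \<open>H\<close> of \<open>M\<close> in the sphere is \<open>p\<close> plus \<open>1/m\<close> times its trace. The component normal to \<open>p\<close> of
  the componentwise Laplacian \<open>\<Delta>H\<close> is \<open>- m H\<close> for biharmonic \<open>M\<close>.

  The tangential part of this equation, pseudo-umbilicity and the Codazzi equation give
  \<open>(m - 4) grad |H|\<^sup>2 = 0\<close>. So \<open>|H|\<^sup>2\<close> is locally constant, and pairing the equation with \<open>H\<close> yields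
  \<open>|\<nabla>\<^sup>\<bottom> H|\<^sup>2 = m |H|\<^sup>2 (1 - |H|\<^sup>2)\<close>, hence \<open>|H| \<le> 1\<close>. By the Gauss equation
  \<open>m (m - 1) (1 + |H|\<^sup>2) - s\<close> is the squared length of the trace-free second fundamental form, which is
  the inequality. In the case of equality \<open>M\<close> is umbilical and \<open>H\<close> is parallel of length 1; then the
  centre \<open>(p + H) / 2\<close> and the space spanned by \<open>T\<^sub>p M\<close> and \<open>H - p\<close> do not depend on \<open>p\<close>.
\<close>

subsection \<open>Calculus of smooth functions\<close>

text \<open>The definitions differentiate fields that live only on the manifold, along a filter that
  fixes derivatives only in tangent directions. Hence every field is replaced by a smooth function
  on an open set, and an identity valid on the manifold is differentiated in tangent directions
  alone. Moving frames are avoided: the test fields are projections \<open>P q v\<close> of constant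
  vectors \<open>v\<close>. Flatness of the ambient space, in the form of symmetric second
  derivatives, yields the symmetry of the second fundamental form and the Gauss and Codazzi
  equations alike. The number 4 comes from evaluating the trace of
  \<open>D H p e \<bullet> DP p e z\<close> over \<open>e\<close> in two ways: the tangential
  equation gives minus the derivative of |H|^2 along \<open>z\<close>, the Codazzi equation gives
  \<open>1 - m/2\<close> times it. The factor 2 in the bound is the maximum of 1 + |H|^2, and the
  radius is half the distance between the orthonormal vectors \<open>p\<close> and
  \<open>H p\<close> in the case of equality.\<close>

abbreviation D :: "('a::euclidean_space \<Rightarrow> 'b::euclidean_space) \<Rightarrow> 'a \<Rightarrow> 'a \<Rightarrow> 'b" where
  "D f x v \<equiv> frechet_derivative f (at x) v"

lemma D_eq: "(f has_derivative f') (at x) \<Longrightarrow> D f x v = f' v"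
  by (simp add: frechet_derivative_at[symmetric])

lemma has_derivative_D: "f differentiable (at x) \<Longrightarrow> (f has_derivative D f x) (at x)"
  by (simp add: frechet_derivative_works)

lemma linear_D: "f differentiable (at x) \<Longrightarrow> linear (D f x)"
  by (rule has_derivative_linear[OF has_derivative_D])

lemma D_cong_open:
  assumes "open U" "x \<in> U" "\<And>y. y \<in> U \<Longrightarrow> f y = g y" "f differentiable (at x)"
  shows "D g x v = D f x v" "g differentiable (at x)"
proof -
  have "(g has_derivative D f x) (at x)"
    using has_derivative_transform_within_open[OF has_derivative_D[OF assms(4)] assms(1,2,3)] by simp
  then show "D g x v = D f x v" "g differentiable (at x)"
    by (auto simp: D_eq differentiable_def)
qed

lemma Ck_on_cong:
  assumes "open U" "Ck_on k U f" "\<And>x. x \<in> U \<Longrightarrow> f x = g x"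
  shows "Ck_on k U g"
  using assms(2,3)
proof (induction k arbitrary: f g)
  case 0 then show ?case by (simp cong: continuous_on_cong)
next
  case (Suc k)
  have d: "g differentiable (at x)" "D g x v = D f x v" if "x \<in> U" for x v
    using D_cong_open[OF assms(1) that Suc.prems(2)] Suc.prems(1) that by auto
  have "Ck_on k U (\<lambda>x. D g x v)" for v
    using Suc.IH[of "\<lambda>x. D f x v" "\<lambda>x. D g x v"] Suc.prems(1) d(2) by auto
  then show ?case using d(1) by simp
qed

text \<open>\<open>Ck_on\<close> refers to the chosen \<open>frechet_derivative\<close>; this rule
  lets the inductions below work with an explicit formula for the derivative.\<close>

lemma Ck_on_Suc:
  assumes "open U" "\<And>x. x \<in> U \<Longrightarrow> (f has_derivative f' x) (at x)"
    and "\<And>v. Ck_on k U (\<lambda>x. f' x v)"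
  shows "Ck_on (Suc k) U f"
  unfolding Ck_on.simps
proof (intro conjI ballI allI)
  fix v show "Ck_on k U (\<lambda>x. D f x v)"
    by (rule Ck_on_cong[OF assms(1,3)]) (simp add: D_eq[OF assms(2)])
qed (use assms(2) differentiable_def in blast)

lemma Ck_on_SucD: "Ck_on (Suc k) U f \<Longrightarrow> Ck_on k U f"
proof (induction k arbitrary: f)
  case 0
  then have "\<forall>x\<in>U. f differentiable at x" by simp
  then show ?case
    by (simp add: continuous_at_imp_continuous_on differentiable_imp_continuous_within)
next
  case (Suc k) then show ?case by auto
qed

lemma Ck_on_subset: "Ck_on k U f \<Longrightarrow> V \<subseteq> U \<Longrightarrow> Ck_on k V f"
proof (induction k arbitrary: f)
  case 0 then show ?case by (simp add: continuous_on_subset)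
next
  case (Suc k) then show ?case by (simp add: subset_eq)
qed

lemma Ck_on_const: "Ck_on k U (\<lambda>x. c)"
  by (induction k arbitrary: c) simp_all

lemma Ck_on_linear:
  assumes "bounded_linear f" "open U"
  shows "Ck_on k U f"
proof (cases k)
  case 0 then show ?thesis using assms linear_continuous_on by auto
next
  case (Suc l)
  then show ?thesis
    using Ck_on_Suc[OF assms(2), of f "\<lambda>x. f" l] bounded_linear_imp_has_derivative[OF assms(1)]
    by (simp add: Ck_on_const)
qed

lemma Ck_on_add:
  assumes "open U" shows "Ck_on k U f \<Longrightarrow> Ck_on k U g \<Longrightarrow> Ck_on k U (\<lambda>x. f x + g x)"
proof (induction k arbitrary: f g)
  case 0 then show ?case by (simp add: continuous_on_add)
next
  case (Suc k)
  show ?case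
    by (rule Ck_on_Suc[where f' = "\<lambda>x v. D f x v + D g x v"])
      (use Suc assms in \<open>auto intro!: has_derivative_add has_derivative_D\<close>)
qed

lemma Ck_on_bilinear:
  fixes f :: "'d::euclidean_space \<Rightarrow> 'a::euclidean_space" and g :: "'d \<Rightarrow> 'b::euclidean_space"
    and pr :: "'a \<Rightarrow> 'b \<Rightarrow> 'c::euclidean_space"
  assumes "bounded_bilinear pr" "open U"
  shows "Ck_on k U f \<Longrightarrow> Ck_on k U g \<Longrightarrow> Ck_on k U (\<lambda>x. pr (f x) (g x))"
proof (induction k arbitrary: f g)
  case 0 then show ?case by (simp add: bounded_bilinear.continuous_on[OF assms(1)])
next
  case (Suc k)
  show ?case
  proof (rule Ck_on_Suc[where f' = "\<lambda>x v. pr (f x) (D g x v) + pr (D f x v) (g x)"])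
    show "((\<lambda>x. pr (f x) (g x)) has_derivative (\<lambda>v. pr (f x) (D g x v) + pr (D f x v) (g x))) (at x)"
      if "x \<in> U" for x
      by (intro bounded_bilinear.FDERIV[OF assms(1)] has_derivative_D) (use Suc.prems that in auto)
    have "Ck_on k U (\<lambda>x. D f x v)" "Ck_on k U (\<lambda>x. D g x v)" for v
      using Suc.prems by simp_all
    then show "Ck_on k U (\<lambda>x. pr (f x) (D g x v) + pr (D f x v) (g x))" for v
      by (intro Ck_on_add[OF assms(2)] Suc.IH Ck_on_SucD[OF Suc.prems(1)] Ck_on_SucD[OF Suc.prems(2)])
  qed (rule assms(2))
qed

lemmas Ck_on_scaleR = Ck_on_bilinear[OF bounded_bilinear_scaleR]
lemmas Ck_on_inner = Ck_on_bilinear[OF bounded_bilinear_inner]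

lemma Ck_on_sum:
  assumes "open U" "\<And>i. i \<in> I \<Longrightarrow> Ck_on k U (f i)"
  shows "Ck_on k U (\<lambda>x. \<Sum>i\<in>I. f i x)"
  using assms(2) by (induction I rule: infinite_finite_induct) (auto intro: Ck_on_const Ck_on_add assms(1))

lemma linear_Basis_expansion:
  fixes f :: "'a::euclidean_space \<Rightarrow> 'b::real_vector"
  assumes "linear f" shows "f x = (\<Sum>i\<in>Basis. (x \<bullet> i) *\<^sub>R f i)"
proof -
  have "f x = f (\<Sum>i\<in>Basis. (x \<bullet> i) *\<^sub>R i)" by (simp add: euclidean_representation)
  also have "\<dots> = (\<Sum>i\<in>Basis. (x \<bullet> i) *\<^sub>R f i)"
    by (simp add: linear_sum[OF assms] linear_cmul[OF assms])
  finally show ?thesis .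
qed

lemma Ck_on_comp:
  fixes f :: "'a::euclidean_space \<Rightarrow> 'b::euclidean_space" and g :: "'b \<Rightarrow> 'c::euclidean_space"
  assumes "open U"  "f ` U \<subseteq> V"
  shows "Ck_on k U f \<Longrightarrow> Ck_on k V g \<Longrightarrow> Ck_on k U (\<lambda>x. g (f x))"
proof (induction k arbitrary: g)
  case 0 then show ?case using continuous_on_compose2[of V g U f] assms(2) by simp
next
  case (Suc k)
  have f: "f differentiable (at x)" and g: "g differentiable (at (f x))" if "x \<in> U" for x
    using Suc.prems assms(2) that by auto
  \<comment> \<open>The induction hypothesis covers derivatives of \<open>g\<close> in constant
    directions only, so the moving direction \<open>D f x v\<close> is expanded in the standard
    basis.\<close>
  have *: "(\<Sum>i\<in>Basis. (D f x v \<bullet> i) *\<^sub>R D g (f x) i) = D g (f x) (D f x v)" if "x \<in> U" for x v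
    by (rule linear_Basis_expansion[OF linear_D[OF g[OF that]], symmetric])
  show ?case
  proof (rule Ck_on_Suc[where f' = "\<lambda>x v. D g (f x) (D f x v)"])
    show "((\<lambda>x. g (f x)) has_derivative (\<lambda>v. D g (f x) (D f x v))) (at x)" if "x \<in> U" for x
      using diff_chain_at[OF has_derivative_D[OF f[OF that]] has_derivative_D[OF g[OF that]]]
      unfolding o_def .
    show "Ck_on k U (\<lambda>x. D g (f x) (D f x v))" for v
    proof -
      have df: "Ck_on k U (\<lambda>x. D f x v)" using Suc.prems by simp
      have "Ck_on k U (\<lambda>x. D g (f x) i)" for i
        using Suc.IH[of "\<lambda>y. D g y i"] Ck_on_SucD[OF Suc.prems(1)] Suc.prems(2) by simp
      then have "Ck_on k U (\<lambda>x. (D f x v \<bullet> i) *\<^sub>R D g (f x) i)" for i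
        by (rule Ck_on_scaleR[OF assms(1) Ck_on_inner[OF assms(1) df Ck_on_const]])
      then have "Ck_on k U (\<lambda>x. \<Sum>i\<in>Basis. (D f x v \<bullet> i) *\<^sub>R D g (f x) i)"
        by (rule Ck_on_sum[OF assms(1)])
      then show ?thesis
        by (rule Ck_on_cong[OF assms(1)]) (rule *)
    qed
  qed (use assms in auto)
qed

lemma smooth_onD: "smooth_on U f \<Longrightarrow> x \<in> U \<Longrightarrow> f differentiable (at x)"
  unfolding smooth_on_def using Ck_on.simps(2)[of 0 U f] by simp

lemma smooth_on_has_derivative: "smooth_on U f \<Longrightarrow> x \<in> U \<Longrightarrow> (f has_derivative D f x) (at x)"
  by (rule has_derivative_D[OF smooth_onD])

lemma smooth_on_imp_continuous: "smooth_on U f \<Longrightarrow> continuous_on U f"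
  unfolding smooth_on_def using Ck_on.simps(1)[of U f] by simp

lemma smooth_on_cong: "open U \<Longrightarrow> smooth_on U f \<Longrightarrow> (\<And>x. x \<in> U \<Longrightarrow> f x = g x) \<Longrightarrow> smooth_on U g"
  unfolding smooth_on_def by (metis Ck_on_cong)

lemma smooth_on_subset: "smooth_on U f \<Longrightarrow> V \<subseteq> U \<Longrightarrow> smooth_on V f"
  unfolding smooth_on_def using Ck_on_subset[of _ U f V] by simp

lemma smooth_on_const: "smooth_on U (\<lambda>x. c)"
  by (simp add: smooth_on_def Ck_on_const)

lemma smooth_on_linear: "bounded_linear f \<Longrightarrow> open U \<Longrightarrow> smooth_on U f"
  by (simp add: smooth_on_def Ck_on_linear)

lemma smooth_on_ident: "open U \<Longrightarrow> smooth_on U (\<lambda>x. x)"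
  by (rule smooth_on_linear[OF bounded_linear_ident])

lemma smooth_on_add: "open U \<Longrightarrow> smooth_on U f \<Longrightarrow> smooth_on U g \<Longrightarrow> smooth_on U (\<lambda>x. f x + g x)"
  by (simp add: smooth_on_def Ck_on_add)

lemma smooth_on_scaleR: "open U \<Longrightarrow> smooth_on U f \<Longrightarrow> smooth_on U g \<Longrightarrow> smooth_on U (\<lambda>x. f x *\<^sub>R g x)"
  by (simp add: smooth_on_def Ck_on_scaleR)

lemma smooth_on_inner: "open U \<Longrightarrow> smooth_on U f \<Longrightarrow> smooth_on U g \<Longrightarrow> smooth_on U (\<lambda>x. f x \<bullet> g x)"
  by (simp add: smooth_on_def Ck_on_inner)

lemma smooth_on_sum: "open U \<Longrightarrow> (\<And>i. i \<in> I \<Longrightarrow> smooth_on U (f i)) \<Longrightarrow> smooth_on U (\<lambda>x. \<Sum>i\<in>I. f i x)"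
  by (simp add: smooth_on_def Ck_on_sum)

lemma smooth_on_minus: "open U \<Longrightarrow> smooth_on U f \<Longrightarrow> smooth_on U (\<lambda>x. - f x)"
  using smooth_on_scaleR[OF _ smooth_on_const, of U f "-1"] by simp

lemma smooth_on_diff: "open U \<Longrightarrow> smooth_on U f \<Longrightarrow> smooth_on U g \<Longrightarrow> smooth_on U (\<lambda>x. f x - g x)"
  using smooth_on_add[OF _ _ smooth_on_minus, of U f g] by simp

lemma smooth_on_comp:
  "open U \<Longrightarrow> f ` U \<subseteq> V \<Longrightarrow> smooth_on U f \<Longrightarrow> smooth_on V g \<Longrightarrow> smooth_on U (\<lambda>x. g (f x))"
  unfolding smooth_on_def using Ck_on_comp[of U f V _ g] by simp

text \<open>Operator-valued maps are handled as families of linear maps that are smooth on each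
  constant vector; a basis expansion extends this to smooth arguments.\<close>

lemma smooth_on_linear_family:
  assumes "open U" "\<And>x. x \<in> U \<Longrightarrow> linear (L x)" "\<And>v. smooth_on U (\<lambda>x. L x v)" "smooth_on U X"
  shows "smooth_on U (\<lambda>x. L x (X x))"
proof (rule smooth_on_cong[OF assms(1)])
  show "smooth_on U (\<lambda>x. \<Sum>i\<in>Basis. (X x \<bullet> i) *\<^sub>R L x i)"
    by (intro smooth_on_sum smooth_on_scaleR smooth_on_inner smooth_on_const assms)
qed (simp add: linear_Basis_expansion[OF assms(2), symmetric])

lemma smooth_on_D_const: "smooth_on U f \<Longrightarrow> smooth_on U (\<lambda>x. D f x v)"
  unfolding smooth_on_def
proof
  fix k assume "\<forall>k. Ck_on k U f"
  then have "Ck_on (Suc k) U f" by simp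
  then show "Ck_on k U (\<lambda>x. D f x v)" by simp
qed

lemma smooth_on_D:
  assumes "open U" "smooth_on U f" "smooth_on U X"
  shows "smooth_on U (\<lambda>x. D f x (X x))"
  by (rule smooth_on_linear_family[OF assms(1) _ _ assms(3)])
    (simp_all add: assms(2) linear_D smooth_onD[OF assms(2)] smooth_on_D_const)

lemmas smooth_on_intros = smooth_on_const smooth_on_ident smooth_on_add smooth_on_diff smooth_on_minus
  smooth_on_scaleR smooth_on_inner smooth_on_sum smooth_on_D

text \<open>A factor that vanishes at the point makes mere continuity of the other factor sufficient.\<close>

lemma has_derivative_scaleR_vanishing:
  fixes a :: "'a::euclidean_space \<Rightarrow> real" and c :: "'a \<Rightarrow> 'b::euclidean_space"
  assumes a: "(a has_derivative a') (at x)" and a0: "a x = 0" and c: "isCont c x"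
  shows "((\<lambda>y. a y *\<^sub>R c y) has_derivative (\<lambda>h. a' h *\<^sub>R c x)) (at x)"
proof -
  have bl: "bounded_linear a'" using a has_derivative_bounded_linear by blast
  obtain K where K: "norm (a' h) \<le> norm h * K" for h using bounded_linear.bounded[OF bl] by blast
  have lim: "((\<lambda>h. norm (a (x + h) - a' h) / norm h) \<longlongrightarrow> 0) (at 0)"
    using a a0 by (simp add: has_derivative_at)
  have cl: "((\<lambda>h. c (x + h)) \<longlongrightarrow> c x) (at 0)"
    using c isCont_iff by blast
  show ?thesis
    unfolding has_derivative_at
  proof (intro conjI)
    show "bounded_linear (\<lambda>h. a' h *\<^sub>R c x)"
      using bl by (simp add: bounded_linear_scaleR_const)
    have "((\<lambda>h. norm (a (x + h) - a' h) / norm h * norm (c (x + h)) + K * norm (c (x + h) - c x)) \<longlongrightarrow>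
        0 * norm (c x) + K * norm (c x - c x)) (at 0)"
      by (intro tendsto_intros lim cl)
    then have l0: "((\<lambda>h. norm (a (x + h) - a' h) / norm h * norm (c (x + h)) + K * norm (c (x + h) - c x)) \<longlongrightarrow> 0) (at 0)"
      by simp
    show "((\<lambda>h. norm (a (x + h) *\<^sub>R c (x + h) - a x *\<^sub>R c x - a' h *\<^sub>R c x) / norm h) \<longlongrightarrow> 0) (at 0)"
    proof (rule Lim_null_comparison[OF _ l0], rule eventually_at_filter[THEN iffD2], rule always_eventually, intro allI impI)
      fix h :: 'a assume h: "h \<noteq> 0"
      have "norm (a (x + h) *\<^sub>R c (x + h) - a' h *\<^sub>R c x)
          = norm ((a (x + h) - a' h) *\<^sub>R c (x + h) + a' h *\<^sub>R (c (x + h) - c x))"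
        by (simp add: algebra_simps)
      also have "\<dots> \<le> norm (a (x + h) - a' h) * norm (c (x + h)) + norm (a' h) * norm (c (x + h) - c x)"
        by (rule order_trans[OF norm_triangle_ineq]) simp
      also have "\<dots> \<le> norm (a (x + h) - a' h) * norm (c (x + h)) + norm h * K * norm (c (x + h) - c x)"
        using K[of h] by (simp add: mult_right_mono)
      finally have "norm (a (x + h) *\<^sub>R c (x + h) - a' h *\<^sub>R c x) / norm h \<le>
         (norm (a (x + h) - a' h) * norm (c (x + h)) + norm h * K * norm (c (x + h) - c x)) / norm h"
        by (simp add: divide_right_mono)
      also have "\<dots> = norm (a (x + h) - a' h) / norm h * norm (c (x + h)) + K * norm (c (x + h) - c x)"
        using h by (simp add: field_simps)
      finally show "norm (norm (a (x + h) *\<^sub>R c (x + h) - a x *\<^sub>R c x - a' h *\<^sub>R c x) / norm h) \<le>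
         norm (a (x + h) - a' h) / norm h * norm (c (x + h)) + K * norm (c (x + h) - c x)"
        using a0 by simp
    qed
  qed
qed

text \<open>The lower bound makes every \<open>B x\<close> a contraction, and the resolvent identity
  \<open>B y - B x = - B y (A y - A x) B x\<close> then gives continuity. The same identity gives
  the derivative, which involves only \<open>B\<close> and the derivative of \<open>A\<close>, so
  regularity is gained one order at a time.\<close>

lemma smooth_on_right_inverse:
  fixes A B :: "'a::euclidean_space \<Rightarrow> 'b::euclidean_space \<Rightarrow> 'b"
  assumes U: "open U"
    and A: "\<And>x. x \<in> U \<Longrightarrow> linear (A x)" "\<And>v. smooth_on U (\<lambda>x. A x v)"
    and low: "\<And>x v. x \<in> U \<Longrightarrow> norm v \<le> norm (A x v)"
    and B: "\<And>x. x \<in> U \<Longrightarrow> linear (B x)" "\<And>x v. x \<in> U \<Longrightarrow> A x (B x v) = v"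
  shows "smooth_on U (\<lambda>x. B x v)"
proof -
  have nB: "norm (B x v) \<le> norm v" if "x \<in> U" for x v
    using low[OF that, of "B x v"] B(2)[OF that] by simp
  have diff: "B y v - B x v = - B y (A y (B x v) - A x (B x v))" if "x \<in> U" "y \<in> U" for x y v
  proof -
    have "A y (B y v - B x v) = A y (- B y (A y (B x v) - A x (B x v)))"
      using B(2) that by (simp add: linear_diff[OF A(1)] linear_neg[OF A(1)])
    then have "A y ((B y v - B x v) - (- B y (A y (B x v) - A x (B x v)))) = 0"
      by (simp only: linear_diff[OF A(1)[OF that(2)]] diff_self)
    then have "norm ((B y v - B x v) - (- B y (A y (B x v) - A x (B x v)))) \<le> 0"
      using low[OF that(2), of "(B y v - B x v) - (- B y (A y (B x v) - A x (B x v)))"] by (simp only: norm_zero)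
    then show ?thesis by (simp only: norm_le_zero_iff right_minus_eq)
  qed
  have cont: "isCont (\<lambda>x. B x v) x" if x: "x \<in> U" for x v
  proof -
    have "isCont (\<lambda>y. A y (B x v)) x"
      using smooth_on_imp_continuous[OF A(2)] U x continuous_on_eq_continuous_at by blast
    then have "((\<lambda>y. norm (A y (B x v) - A x (B x v))) \<longlongrightarrow> 0) (at x)"
      using LIM_zero isCont_def tendsto_norm_zero by blast
    then have "((\<lambda>y. B y v - B x v) \<longlongrightarrow> 0) (at x)"
    proof (rule Lim_null_comparison[rotated])
      show "\<forall>\<^sub>F y in at x. norm (B y v - B x v) \<le> norm (A y (B x v) - A x (B x v))"
        using eventually_at_in_open'[OF U x] diff[OF x] nB by (auto elim!: eventually_mono)
    qed
    then show ?thesis using isCont_def LIM_zero_iff by blast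
  qed
  have deriv: "((\<lambda>y. B y v) has_derivative (\<lambda>h. - B x (D (\<lambda>y. A y (B x v)) x h))) (at x)" if x: "x \<in> U" for x v
  proof -
    \<comment> \<open>\<open>\<phi>\<close> vanishes at \<open>x\<close>; therefore
      \<open>B y (\<phi> y)\<close> is differentiable there although \<open>B\<close> is so far only
      known to be continuous.\<close>
    define \<phi> where "\<phi> y = A y (B x v) - A x (B x v)" for y
    have p: "(\<phi> has_derivative D (\<lambda>y. A y (B x v)) x) (at x)"
      unfolding \<phi>_def using has_derivative_diff[OF smooth_on_has_derivative[OF A(2) x] has_derivative_const] by simp
    have pi: "((\<lambda>y. \<phi> y \<bullet> i) has_derivative (\<lambda>h. D (\<lambda>y. A y (B x v)) x h \<bullet> i)) (at x)" for i
      by (intro has_derivative_inner_left p)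
    have "((\<lambda>y. B x v - (\<Sum>i\<in>Basis. (\<phi> y \<bullet> i) *\<^sub>R B y i)) has_derivative
       (\<lambda>h. 0 - (\<Sum>i\<in>Basis. (D (\<lambda>y. A y (B x v)) x h \<bullet> i) *\<^sub>R B x i))) (at x)"
      by (intro has_derivative_diff has_derivative_const has_derivative_sum has_derivative_scaleR_vanishing pi cont x)
        (simp add: \<phi>_def)
    moreover have "(\<Sum>i\<in>Basis. (D (\<lambda>y. A y (B x v)) x h \<bullet> i) *\<^sub>R B x i) = B x (D (\<lambda>y. A y (B x v)) x h)" for h
      by (rule linear_Basis_expansion[OF B(1)[OF x], symmetric])
    ultimately have "((\<lambda>y. B x v - (\<Sum>i\<in>Basis. (\<phi> y \<bullet> i) *\<^sub>R B y i)) has_derivative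
       (\<lambda>h. - B x (D (\<lambda>y. A y (B x v)) x h))) (at x)" by simp
    then show ?thesis
    proof (rule has_derivative_transform_within_open[OF _ U x])
      fix y assume y: "y \<in> U"
      have "(\<Sum>i\<in>Basis. (\<phi> y \<bullet> i) *\<^sub>R B y i) = B y (\<phi> y)"
        by (rule linear_Basis_expansion[OF B(1)[OF y], symmetric])
      then show "B x v - (\<Sum>i\<in>Basis. (\<phi> y \<bullet> i) *\<^sub>R B y i) = B y v"
        using diff[OF x y, of v] by (simp add: \<phi>_def[symmetric] algebra_simps)
    qed
  qed
  have "Ck_on k U (\<lambda>x. B x v)" for k v
  proof (induction k arbitrary: v)
    case 0 then show ?case using cont by (simp add: continuous_at_imp_continuous_on)
  next
    case (Suc k)
    have lin_expand: "Ck_on k U (\<lambda>x. L x (X x))"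
      if "\<And>x. x \<in> U \<Longrightarrow> linear (L x)" "\<And>v. Ck_on k U (\<lambda>x. L x v)" "Ck_on k U X" for L :: "'a \<Rightarrow> 'b \<Rightarrow> 'b" and X
    proof (rule Ck_on_cong[OF U])
      show "Ck_on k U (\<lambda>x. \<Sum>i\<in>Basis. (X x \<bullet> i) *\<^sub>R L x i)"
        by (intro Ck_on_sum Ck_on_scaleR Ck_on_inner U Ck_on_const that)
    qed (simp add: linear_Basis_expansion[OF that(1), symmetric])
    have linA: "D (\<lambda>y. A y w) x h = (\<Sum>i\<in>Basis. (w \<bullet> i) *\<^sub>R D (\<lambda>y. A y i) x h)" if "x \<in> U" for x w h
    proof (rule D_eq)
      have "((\<lambda>y. (\<Sum>i\<in>Basis. (w \<bullet> i) *\<^sub>R A y i)) has_derivative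
         (\<lambda>h. \<Sum>i\<in>Basis. (w \<bullet> i) *\<^sub>R D (\<lambda>y. A y i) x h)) (at x)"
        by (intro has_derivative_sum has_derivative_scaleR_right smooth_on_has_derivative[OF A(2)] that)
      then show "((\<lambda>y. A y w) has_derivative (\<lambda>h. \<Sum>i\<in>Basis. (w \<bullet> i) *\<^sub>R D (\<lambda>y. A y i) x h)) (at x)"
        by (rule has_derivative_transform_within_open[OF _ U that]) (simp add: linear_Basis_expansion[OF A(1), symmetric])
    qed
    show ?case
    proof (rule Ck_on_Suc[OF U deriv])
      fix h
      have "Ck_on k U (\<lambda>x. D (\<lambda>y. A y i) x h)" for i
        using smooth_on_D_const[OF A(2)] unfolding smooth_on_def by blast
      then have "Ck_on k U (\<lambda>x. (B x v \<bullet> i) *\<^sub>R D (\<lambda>y. A y i) x h)" for i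
        by (rule Ck_on_scaleR[OF U Ck_on_inner[OF U Suc.IH Ck_on_const]])
      then have "Ck_on k U (\<lambda>x. \<Sum>i\<in>Basis. (B x v \<bullet> i) *\<^sub>R D (\<lambda>y. A y i) x h)"
        by (rule Ck_on_sum[OF U])
      then have "Ck_on k U (\<lambda>x. B x (\<Sum>i\<in>Basis. (B x v \<bullet> i) *\<^sub>R D (\<lambda>y. A y i) x h))"
        using lin_expand[of B] B(1) Suc.IH by blast
      then have "Ck_on k U (\<lambda>x. (-1) *\<^sub>R B x (\<Sum>i\<in>Basis. (B x v \<bullet> i) *\<^sub>R D (\<lambda>y. A y i) x h))"
        by (rule Ck_on_scaleR[OF U Ck_on_const])
      then show "Ck_on k U (\<lambda>x. - B x (D (\<lambda>y. A y (B x v)) x h))"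
        by (rule Ck_on_cong[OF U]) (simp add: linA[symmetric])
    qed
  qed
  then show ?thesis unfolding smooth_on_def by blast
qed

section \<open>Symmetry of second derivatives\<close>

lemma second_difference_mean_value:
  fixes f :: "'a::euclidean_space \<Rightarrow> real"
  assumes "0 < h" and sq: "\<And>s t. 0 \<le> s \<Longrightarrow> s \<le> h \<Longrightarrow> 0 \<le> t \<Longrightarrow> t \<le> h \<Longrightarrow> p + s *\<^sub>R u + t *\<^sub>R v \<in> U"
    and sm: "smooth_on U f"
  obtains s t where "0 < s" "s < h" "0 < t" "t < h"
    "f (p + h *\<^sub>R u + h *\<^sub>R v) - f (p + h *\<^sub>R u) - f (p + h *\<^sub>R v) + f p
       = h * h * D (\<lambda>q. D f q u) (p + s *\<^sub>R u + t *\<^sub>R v) v"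
proof -
  \<comment> \<open>The increment of \<open>\<phi>\<close> over \<open>[0, h]\<close> is the second
    difference. The mean value theorem is applied to \<open>\<phi>\<close> and then, in the
    direction \<open>v\<close>, to the derivative of \<open>f\<close> along
    \<open>u\<close>.\<close>
  define \<phi> where "\<phi> s = f (p + s *\<^sub>R u + h *\<^sub>R v) - f (p + s *\<^sub>R u)" for s
  have line: "((\<lambda>s. g (a + s *\<^sub>R w)) has_derivative (\<lambda>d. d * D g (a + s *\<^sub>R w) w)) (at s)"
    if "smooth_on U g" "a + s *\<^sub>R w \<in> U" for g :: "'a \<Rightarrow> real" and a s w
  proof -
    have "((\<lambda>s. a + s *\<^sub>R w) has_derivative (\<lambda>d. d *\<^sub>R w)) (at s)"
      by (auto intro!: derivative_eq_intros)
    then have "((\<lambda>s. g (a + s *\<^sub>R w)) has_derivative (\<lambda>d. D g (a + s *\<^sub>R w) (d *\<^sub>R w))) (at s)"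
      using has_derivative_compose[where f = "\<lambda>s. a + s *\<^sub>R w" and f' = "\<lambda>d. d *\<^sub>R w" and g = g and s = UNIV,
          OF _ smooth_on_has_derivative[OF that]]
      by blast
    then show ?thesis using linear_cmul[OF linear_D[OF smooth_onD[OF that]]] by simp
  qed
  have "\<exists>s. 0 < s \<and> s < h \<and> \<phi> h - \<phi> 0 = (\<lambda>d. d * (D f (p + s *\<^sub>R u + h *\<^sub>R v) u - D f (p + s *\<^sub>R u) u)) (h - 0)"
  proof (rule mvt_simple[OF assms(1), simplified, where f = \<phi> and f' = "\<lambda>s d. d * (D f (p + s *\<^sub>R u + h *\<^sub>R v) u - D f (p + s *\<^sub>R u) u)", simplified, THEN bexE])
    fix s assume s: "0 \<le> s" "s \<le> h"
    have "(\<phi> has_derivative (\<lambda>d. d * D f ((p + h *\<^sub>R v) + s *\<^sub>R u) u - d * D f (p + s *\<^sub>R u) u)) (at s)"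
    proof -
      have 1: "p + h *\<^sub>R v + s *\<^sub>R u \<in> U" using sq[of s h] s by (simp add: algebra_simps)
      have 2: "p + s *\<^sub>R u \<in> U" using sq[of s 0] s by simp
      show ?thesis
        using has_derivative_diff[OF line[OF sm 1] line[OF sm 2]] unfolding \<phi>_def by (simp add: algebra_simps)
    qed
    then show "(\<phi> has_derivative (\<lambda>d. d * (D f (p + s *\<^sub>R u + h *\<^sub>R v) u - D f (p + s *\<^sub>R u) u))) (at s within {0..h})"
      by (simp add: algebra_simps has_derivative_at_withinI)
  qed (auto simp: algebra_simps)
  then obtain s where s: "0 < s" "s < h"
    and e1: "\<phi> h - \<phi> 0 = h * (D f (p + s *\<^sub>R u + h *\<^sub>R v) u - D f (p + s *\<^sub>R u) u)" by auto
  have "\<exists>t. 0 < t \<and> t < h \<and> D f (p + s *\<^sub>R u + h *\<^sub>R v) u - D f (p + s *\<^sub>R u + 0 *\<^sub>R v) u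
      = (\<lambda>d. d * D (\<lambda>q. D f q u) (p + s *\<^sub>R u + t *\<^sub>R v) v) (h - 0)"
  proof (rule mvt_simple[OF assms(1), where f = "\<lambda>t. D f (p + s *\<^sub>R u + t *\<^sub>R v) u" and f' = "\<lambda>t d. d * D (\<lambda>q. D f q u) (p + s *\<^sub>R u + t *\<^sub>R v) v", THEN bexE])
    fix t assume t: "0 \<le> t" "t \<le> h"
    show "((\<lambda>t. D f (p + s *\<^sub>R u + t *\<^sub>R v) u) has_derivative (\<lambda>d. d * D (\<lambda>q. D f q u) (p + s *\<^sub>R u + t *\<^sub>R v) v)) (at t within {0..h})"
      using line[OF smooth_on_D_const[OF sm], of "p + s *\<^sub>R u" t v] sq[of s t] s t
      by (simp add: has_derivative_at_withinI)
  qed auto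
  then obtain t where t: "0 < t" "t < h" "D f (p + s *\<^sub>R u + h *\<^sub>R v) u - D f (p + s *\<^sub>R u) u
      = h * D (\<lambda>q. D f q u) (p + s *\<^sub>R u + t *\<^sub>R v) v" by auto
  show thesis
    by (rule that[OF s t(1,2)]) (use e1 t(3) in \<open>simp add: \<phi>_def\<close>)
qed

text \<open>The second difference is symmetric in \<open>u\<close> and \<open>v\<close>, so both
  mixed derivatives take the same value at points arbitrarily close to \<open>p\<close>; continuity
  does the rest.\<close>

lemma D_D_commute_real:
  fixes f :: "'a::euclidean_space \<Rightarrow> real"
  assumes U: "open U" "p \<in> U" and sm: "smooth_on U f"
  shows "D (\<lambda>q. D f q u) p v = D (\<lambda>q. D f q v) p u"
proof (rule ccontr)
  assume ne: "\<not> ?thesis"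
  define A where "A q = D (\<lambda>q. D f q u) q v" for q
  define B where "B q = D (\<lambda>q. D f q v) q u" for q
  define e where "e = \<bar>A p - B p\<bar> / 2"
  have e: "e > 0" using ne by (simp add: e_def A_def B_def)
  have sA: "smooth_on U A" and sB: "smooth_on U B"
    unfolding A_def B_def using sm smooth_on_D_const by blast+
  have "isCont A p" "isCont B p" using smooth_on_imp_continuous[OF sA] smooth_on_imp_continuous[OF sB] U
    by (auto simp: continuous_on_eq_continuous_at)
  then obtain d1 d2 where d: "d1 > 0" "d2 > 0" "\<And>q. dist q p < d1 \<Longrightarrow> dist (A q) (A p) < e"
      "\<And>q. dist q p < d2 \<Longrightarrow> dist (B q) (B p) < e"
    using e unfolding continuous_at_eps_delta by metis
  obtain d3 where d3: "d3 > 0" "ball p d3 \<subseteq> U" using U open_contains_ball by blast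
  define dd where "dd = min d1 (min d2 d3)"
  \<comment> \<open>Small enough for the parallelogram with sides \<open>h *\<^sub>R u\<close> and
    \<open>h *\<^sub>R v\<close> to stay within distance \<open>dd\<close> of \<open>p\<close>; the
    summand 1 keeps the denominator positive when \<open>u\<close> and \<open>v\<close>
    vanish.\<close>
  define h where "h = dd / (2 * (norm u + norm v + 1))"
  have np: "norm u + norm v + 1 > 0" by (smt (verit) norm_ge_zero)
  have dd: "dd > 0" using d d3 by (simp add: dd_def)
  have h: "h > 0" using dd np by (simp add: h_def)
  have near: "dist (p + s *\<^sub>R u + t *\<^sub>R v) p < dd" if "0 \<le> s" "s \<le> h" "0 \<le> t" "t \<le> h" for s t
  proof -
    have "dist (p + s *\<^sub>R u + t *\<^sub>R v) p = norm (s *\<^sub>R u + t *\<^sub>R v)" by (simp add: dist_norm)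
    also have "\<dots> \<le> s * norm u + t * norm v" using norm_triangle_ineq[of "s *\<^sub>R u" "t *\<^sub>R v"] that by simp
    also have "\<dots> \<le> h * norm u + h * norm v" using that by (simp add: add_mono mult_right_mono)
    also have "\<dots> \<le> h * (norm u + norm v + 1)" using h by (simp add: algebra_simps)
    also have "\<dots> = dd / 2" using np by (simp only: h_def) (simp add: divide_simps)
    finally show ?thesis using dd by simp
  qed
  have inU: "p + s *\<^sub>R u + t *\<^sub>R v \<in> U" "p + s *\<^sub>R v + t *\<^sub>R u \<in> U" if "0 \<le> s" "s \<le> h" "0 \<le> t" "t \<le> h" for s t
    using near[OF that] near[OF that(3,4,1,2)] d3 unfolding dd_def
    by (auto simp: subset_iff dist_commute algebra_simps)
  obtain s t where st: "0 < s" "s < h" "0 < t" "t < h"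
    "f (p + h *\<^sub>R u + h *\<^sub>R v) - f (p + h *\<^sub>R u) - f (p + h *\<^sub>R v) + f p
       = h * h * A (p + s *\<^sub>R u + t *\<^sub>R v)"
    using second_difference_mean_value[OF h inU(1) sm] unfolding A_def by blast
  obtain s' t' where st': "0 < s'" "s' < h" "0 < t'" "t' < h"
    "f (p + h *\<^sub>R v + h *\<^sub>R u) - f (p + h *\<^sub>R v) - f (p + h *\<^sub>R u) + f p
       = h * h * B (p + s' *\<^sub>R v + t' *\<^sub>R u)"
    using second_difference_mean_value[OF h inU(2) sm] unfolding B_def by blast
  have "h * h * A (p + s *\<^sub>R u + t *\<^sub>R v) = h * h * B (p + s' *\<^sub>R v + t' *\<^sub>R u)"
    using st(5) st'(5) by (simp add: algebra_simps)
  then have eq: "A (p + s *\<^sub>R u + t *\<^sub>R v) = B (p + s' *\<^sub>R v + t' *\<^sub>R u)" using h by simp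
  have "dist (A (p + s *\<^sub>R u + t *\<^sub>R v)) (A p) < e" using d(3) near[of s t] st unfolding dd_def by simp
  moreover have "dist (B (p + s' *\<^sub>R v + t' *\<^sub>R u)) (B p) < e"
    using d(4) near[of t' s'] st' unfolding dd_def by (simp add: algebra_simps)
  moreover have "\<bar>A p - B p\<bar> \<le> \<bar>B (p + s' *\<^sub>R v + t' *\<^sub>R u) - B p\<bar> + \<bar>A (p + s *\<^sub>R u + t *\<^sub>R v) - A p\<bar>"
    using eq abs_triangle_ineq4[of "B (p + s' *\<^sub>R v + t' *\<^sub>R u) - B p" "A (p + s *\<^sub>R u + t *\<^sub>R v) - A p"] by simp
  ultimately show False unfolding e_def dist_real_def by simp
qed

lemma D_inner_const:
  "f differentiable (at x) \<Longrightarrow> D (\<lambda>y. f y \<bullet> w) x v = D f x v \<bullet> w"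
  by (rule D_eq) (intro has_derivative_inner_left has_derivative_D)

lemma D_D_commute:
  fixes f :: "'a::euclidean_space \<Rightarrow> 'b::euclidean_space"
  assumes U: "open U" "p \<in> U" and sm: "smooth_on U f"
  shows "D (\<lambda>q. D f q u) p v = D (\<lambda>q. D f q v) p u"
proof (rule euclidean_eqI)
  fix b :: 'b assume "b \<in> Basis"
  have "D (\<lambda>q. D f q u) p v \<bullet> b = D (\<lambda>q. D (\<lambda>y. f y \<bullet> b) q u) p v" for u v
  proof -
    have "D (\<lambda>q. D f q u) p v \<bullet> b = D (\<lambda>q. D f q u \<bullet> b) p v"
      using D_inner_const smooth_onD[OF smooth_on_D_const[OF sm] U(2)] by metis
    also have "\<dots> = D (\<lambda>q. D (\<lambda>y. f y \<bullet> b) q u) p v"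
    proof (rule D_cong_open(1)[OF U])
      show "D (\<lambda>y. f y \<bullet> b) y u = D f y u \<bullet> b" if "y \<in> U" for y
        using D_inner_const smooth_onD[OF sm that] by metis
      show "(\<lambda>q. D (\<lambda>y. f y \<bullet> b) q u) differentiable at p"
        using smooth_onD[OF smooth_on_D_const[OF smooth_on_inner[OF U(1) sm smooth_on_const]] U(2)] .
    qed
    finally show ?thesis .
  qed
  then show "D (\<lambda>q. D f q u) p v \<bullet> b = D (\<lambda>q. D f q v) p u \<bullet> b"
    using D_D_commute_real[OF U smooth_on_inner[OF U(1) sm smooth_on_const]] by metis
qed

subsection \<open>Orthogonal projections and orthonormal bases\<close>

lemma orth_proj_eqI:
  assumes "subspace S" "w \<in> S" "\<And>u. u \<in> S \<Longrightarrow> (v - w) \<bullet> u = 0"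
  shows "orth_proj S v = w"
  unfolding orth_proj_def orthogonal_def
proof (rule the_equality)
  fix w' assume w': "w' \<in> S \<and> (\<forall>u\<in>S. (v - w') \<bullet> u = 0)"
  have "w - w' \<in> S" using assms w' subspace_diff by blast
  then have "(v - w) \<bullet> (w - w') = 0" "(v - w') \<bullet> (w - w') = 0" using assms(3) w' by auto
  then have "(w - w') \<bullet> (w - w') = 0" by (simp add: inner_diff_left)
  then show "w' = w" by simp
qed (use assms in auto)

context
  fixes S :: "'a::euclidean_space set"
  assumes S: "subspace S"
begin

lemma orth_proj_props: "orth_proj S v \<in> S \<and> (\<forall>u\<in>S. (v - orth_proj S v) \<bullet> u = 0)"
proof -
  obtain y z where yz: "y \<in> span S" "\<And>w. w \<in> span S \<Longrightarrow> orthogonal z w" "v = y + z"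
    using orthogonal_subspace_decomp_exists[of S v] by blast
  have sp: "span S = S" using S by simp
  then have "orth_proj S v = y"
    using yz unfolding sp by (intro orth_proj_eqI[OF S]) (auto simp: orthogonal_def)
  then show ?thesis using yz unfolding sp by (auto simp: orthogonal_def)
qed

lemma orth_proj_in: "orth_proj S v \<in> S"
  using orth_proj_props by blast

lemma orth_proj_inner: "u \<in> S \<Longrightarrow> orth_proj S v \<bullet> u = v \<bullet> u"
  using orth_proj_props[of v] by (auto simp: inner_diff_left)

lemma orth_proj_ident: "v \<in> S \<Longrightarrow> orth_proj S v = v"
  by (rule orth_proj_eqI[OF S]) auto

lemma linear_orth_proj: "linear (orth_proj S)"
proof (rule linearI)
  show "orth_proj S (u + v) = orth_proj S u + orth_proj S v" for u v
    by (rule orth_proj_eqI[OF S])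
      (simp_all add: orth_proj_in subspace_add S inner_diff_left inner_add_left orth_proj_inner)
  show "orth_proj S (c *\<^sub>R v) = c *\<^sub>R orth_proj S v" for c v
    by (rule orth_proj_eqI[OF S])
      (simp_all add: orth_proj_in subspace_mul S inner_diff_left orth_proj_inner)
qed

lemma orth_proj_sym: "orth_proj S u \<bullet> v = u \<bullet> orth_proj S v"
  using orth_proj_inner[OF orth_proj_in[of u], of v] orth_proj_inner[OF orth_proj_in[of v], of u]
  by (simp add: inner_commute)

lemma orth_proj_eq_0_iff: "orth_proj S v = 0 \<longleftrightarrow> (\<forall>u\<in>S. v \<bullet> u = 0)"
proof
  show "orth_proj S v = 0 \<Longrightarrow> \<forall>u\<in>S. v \<bullet> u = 0" using orth_proj_inner by (metis inner_zero_left)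
  show "\<forall>u\<in>S. v \<bullet> u = 0 \<Longrightarrow> orth_proj S v = 0"
    by (rule orth_proj_eqI[OF S]) (auto simp: S subspace_0)
qed

lemma ex_orthonormal_basis: "\<exists>B. orthonormal_basis S B"
  using orthonormal_basis_subspace[OF S] unfolding orthonormal_basis_def by metis

end

lemma orthonormal_basis_inner:
  assumes "orthonormal_basis S B" "e \<in> B" "e' \<in> B"
  shows "e \<bullet> e' = (if e = e' then 1 else 0)"
  using assms unfolding orthonormal_basis_def pairwise_def orthogonal_def
  by (auto simp: norm_eq_1)

lemma orthonormal_basis_independent: "orthonormal_basis S B \<Longrightarrow> independent B"
  unfolding orthonormal_basis_def
  by (intro pairwise_orthogonal_independent) auto

lemma orthonormal_basis_finite: "orthonormal_basis S B \<Longrightarrow> finite B"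
  using orthonormal_basis_independent independent_imp_finite by blast

lemma orthonormal_basis_card: "orthonormal_basis S B \<Longrightarrow> card B = dim S"
  using orthonormal_basis_independent unfolding orthonormal_basis_def
  by (metis dim_span_eq_card_independent)

lemma orthonormal_basis_expand:
  assumes B: "orthonormal_basis S B" and "v \<in> S"
  shows "v = (\<Sum>e\<in>B. (v \<bullet> e) *\<^sub>R e)"
proof -
  have "v \<in> span B" using assms unfolding orthonormal_basis_def by simp
  then obtain c where c: "v = (\<Sum>e\<in>B. c e *\<^sub>R e)"
    using orthonormal_basis_finite[OF B] span_finite by fastforce
  have "v \<bullet> e = c e" if "e \<in> B" for e
  proof -
    have "v \<bullet> e = (\<Sum>e'\<in>B. if e' = e then c e' else 0)"
      unfolding c inner_sum_left by (intro sum.cong) (auto simp: orthonormal_basis_inner[OF B _ that])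
    then show ?thesis using orthonormal_basis_finite[OF B] that by simp
  qed
  then show ?thesis using c by simp
qed

lemma orthonormal_basis_Basis: "orthonormal_basis UNIV (Basis :: 'a::euclidean_space set)"
  unfolding orthonormal_basis_def
  by (auto simp: pairwise_def orthogonal_def inner_Basis)

text \<open>Expand every member of \<open>B\<close> in \<open>C\<close>: summed over
  \<open>e\<close>, the coefficients \<open>(e \<bullet> f) * (e \<bullet> f')\<close> form the Gram
  matrix of \<open>C\<close>, which is the identity.\<close>

lemma orthonormal_basis_trace:
  fixes b :: "'a::euclidean_space \<Rightarrow> 'a \<Rightarrow> 'b::real_vector"
  assumes B: "orthonormal_basis S B" and C: "orthonormal_basis S C"
    and l: "\<And>y. linear (\<lambda>x. b x y)" "\<And>x. linear (b x)"
  shows "(\<Sum>e\<in>B. b e e) = (\<Sum>f\<in>C. b f f)"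
proof -
  have sub: "B \<subseteq> S" "C \<subseteq> S" using B C unfolding orthonormal_basis_def by auto
  have ex: "b e e' = (\<Sum>f\<in>C. \<Sum>f'\<in>C. ((e \<bullet> f) * (e' \<bullet> f')) *\<^sub>R b f f')" if "e \<in> S" "e' \<in> S" for e e'
  proof -
    have "b e e' = b (\<Sum>f\<in>C. (e \<bullet> f) *\<^sub>R f) (\<Sum>f\<in>C. (e' \<bullet> f) *\<^sub>R f)"
      using orthonormal_basis_expand[OF C that(1)] orthonormal_basis_expand[OF C that(2)] by simp
    also have "\<dots> = (\<Sum>f\<in>C. (e \<bullet> f) *\<^sub>R b f (\<Sum>f'\<in>C. (e' \<bullet> f') *\<^sub>R f'))"
      by (simp add: linear_sum[OF l(1)] linear_cmul[OF l(1)])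
    also have "\<dots> = (\<Sum>f\<in>C. (e \<bullet> f) *\<^sub>R (\<Sum>f'\<in>C. (e' \<bullet> f') *\<^sub>R b f f'))"
      by (simp add: linear_sum[OF l(2)] linear_cmul[OF l(2)])
    finally show ?thesis by (simp add: scaleR_sum_right)
  qed
  have d: "(\<Sum>e\<in>B. (e \<bullet> f) * (e \<bullet> f')) = (if f = f' then 1 else 0)" if "f \<in> C" "f' \<in> C" for f f'
  proof -
    have "f \<bullet> f' = (\<Sum>e\<in>B. (f \<bullet> e) *\<^sub>R e) \<bullet> f'"
      using orthonormal_basis_expand[OF B, of f] that sub by auto
    also have "\<dots> = (\<Sum>e\<in>B. (e \<bullet> f) * (e \<bullet> f'))"
      by (simp add: inner_sum_left) (simp add: inner_commute)
    finally show ?thesis using orthonormal_basis_inner[OF C that] by simp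
  qed
  have "(\<Sum>e\<in>B. b e e) = (\<Sum>e\<in>B. \<Sum>f\<in>C. \<Sum>f'\<in>C. ((e \<bullet> f) * (e \<bullet> f')) *\<^sub>R b f f')"
    using sub by (intro sum.cong refl ex) auto
  also have "\<dots> = (\<Sum>f\<in>C. \<Sum>e\<in>B. \<Sum>f'\<in>C. ((e \<bullet> f) * (e \<bullet> f')) *\<^sub>R b f f')"
    by (rule sum.swap)
  also have "\<dots> = (\<Sum>f\<in>C. \<Sum>f'\<in>C. \<Sum>e\<in>B. ((e \<bullet> f) * (e \<bullet> f')) *\<^sub>R b f f')"
    by (intro sum.cong refl sum.swap)
  also have "\<dots> = (\<Sum>f\<in>C. \<Sum>f'\<in>C. (if f = f' then 1 else 0) *\<^sub>R b f f')"
    by (intro sum.cong refl) (simp only: scaleR_left.sum[symmetric] d)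
  also have "\<dots> = (\<Sum>f\<in>C. b f f)"
  proof (rule sum.cong[OF refl])
    fix f assume f: "f \<in> C"
    have "(\<Sum>f'\<in>C. (if f = f' then 1 else 0) *\<^sub>R b f f') = (\<Sum>f'\<in>C. if f = f' then b f f' else 0)"
      by (intro sum.cong refl) auto
    then show "(\<Sum>f'\<in>C. (if f = f' then 1 else 0) *\<^sub>R b f f') = b f f"
      using f orthonormal_basis_finite[OF C] by simp
  qed
  finally show ?thesis .
qed

lemma orthonormal_basis_Un:
  fixes S :: "'a::euclidean_space set"
  assumes S: "subspace S" and B: "orthonormal_basis S B"
    and C: "orthonormal_basis {v. \<forall>u\<in>S. v \<bullet> u = 0} C"
  shows "orthonormal_basis UNIV (B \<union> C)" "B \<inter> C = {}"
proof -
  have BC: "B \<subseteq> S" "\<And>c u. c \<in> C \<Longrightarrow> u \<in> S \<Longrightarrow> c \<bullet> u = 0" "span B = S" "span C = {v. \<forall>u\<in>S. v \<bullet> u = 0}"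
    using B C unfolding orthonormal_basis_def by auto
  have "v \<in> span (B \<union> C)" for v
  proof -
    have "orth_proj S v \<in> span (B \<union> C)"
      using orth_proj_in[OF S, of v] BC(3) span_mono[of B "B \<union> C"] by auto
    moreover have "v - orth_proj S v \<in> span (B \<union> C)"
      using orth_proj_props[OF S, of v] BC(4) span_mono[of C "B \<union> C"] by auto
    ultimately show ?thesis using span_add by fastforce
  qed
  then show "orthonormal_basis UNIV (B \<union> C)"
  proof -
    have bc: "e \<bullet> f = 0" "f \<bullet> e = 0" if "e \<in> B" "f \<in> C" for e f
      using BC(2)[OF that(2)] that(1) BC(1) inner_commute[of e f] by auto
    have "pairwise orthogonal (B \<union> C)"
      unfolding pairwise_def orthogonal_def
    proof (intro ballI impI)
      fix x y assume xy: "x \<in> B \<union> C" "y \<in> B \<union> C" "x \<noteq> y"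
      show "x \<bullet> y = 0"
        using xy bc orthonormal_basis_inner[OF B, of x y] orthonormal_basis_inner[OF C, of x y] by auto
    qed
    then show ?thesis
      using B C \<open>\<And>v. v \<in> span (B \<union> C)\<close> unfolding orthonormal_basis_def by blast
  qed
  show "B \<inter> C = {}"
  proof (rule ccontr)
    assume "B \<inter> C \<noteq> {}"
    then obtain e where "e \<in> B" "e \<in> C" by auto
    then have "e \<bullet> e = 0" "norm e = 1" using BC(2)[of e e] BC(1) B unfolding orthonormal_basis_def by blast+
    then show False by simp
  qed
qed

text \<open>In an ambient orthonormal basis adapted to \<open>S\<close> the projection kills the
  normal members and fixes the others. The left side refers to no basis of \<open>S\<close>, so it
  can be differentiated when \<open>S\<close> varies.\<close>

lemma orthonormal_basis_trace_proj:
  fixes b :: "'a::euclidean_space \<Rightarrow> 'a \<Rightarrow> 'b::real_vector"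
  assumes S: "subspace S" and B: "orthonormal_basis S B"
    and l: "\<And>y. linear (\<lambda>x. b x y)" "\<And>x. linear (b x)"
  shows "(\<Sum>i\<in>Basis. b (orth_proj S i) i) = (\<Sum>e\<in>B. b e e)"
proof -
  have sN: "subspace {v. \<forall>u\<in>S. v \<bullet> u = 0}"
    unfolding subspace_def by (auto simp: inner_add_left)
  obtain C where C: "orthonormal_basis {v. \<forall>u\<in>S. v \<bullet> u = 0} C"
    using ex_orthonormal_basis[OF sN] by blast
  note U = orthonormal_basis_Un[OF S B C]
  note lin = linear_compose[OF linear_orth_proj[OF S] l(1), unfolded o_def]
  have "(\<Sum>i\<in>Basis. b (orth_proj S i) i) = (\<Sum>e\<in>B \<union> C. b (orth_proj S e) e)"
    by (rule orthonormal_basis_trace[OF orthonormal_basis_Basis U(1)]) (use lin l(2) in auto)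
  also have "\<dots> = (\<Sum>e\<in>B. b (orth_proj S e) e) + (\<Sum>e\<in>C. b (orth_proj S e) e)"
    by (rule sum.union_disjoint) (use orthonormal_basis_finite B C U in auto)
  also have "(\<Sum>e\<in>B. b (orth_proj S e) e) = (\<Sum>e\<in>B. b e e)"
    using B by (intro sum.cong refl) (simp add: orthonormal_basis_def subset_iff orth_proj_ident[OF S])
  also have "(\<Sum>e\<in>C. b (orth_proj S e) e) = 0"
  proof (rule sum.neutral, rule ballI)
    fix e assume "e \<in> C"
    then have "orth_proj S e = 0" using C unfolding orth_proj_eq_0_iff[OF S] orthonormal_basis_def by auto
    then show "b (orth_proj S e) e = 0" using linear_0[OF l(1)] by simp
  qed
  finally show ?thesis by simp
qed

subsection \<open>Derivatives along an embedded neighbourhood\<close>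

text \<open>The topology of an immersed submanifold may be finer than the subspace topology, so
  \<open>atin M p\<close> need not be \<open>at p within topspace M\<close>. On an open piece where
  the two topologies agree, the usual calculus within a set applies.\<close>

lemma atin_eq_at_within:
  assumes W: "openin M W" "subtopology M W = top_of_set W" and p: "p \<in> W"
  shows "atin M p = at p within W"
proof (rule filter_eqI)
  fix Q
  have pM: "p \<in> topspace M" using W p openin_subset by blast
  have op: "openin M T" if "open S" "T = W \<inter> S" for T S
    using openin_open_subtopology[OF W(1), of "W \<inter> S"] that unfolding W(2) by (auto simp: openin_open)
  have op': "\<exists>S. open S \<and> T \<inter> W = W \<inter> S" if "openin M T" for T
    using openin_subtopology_Int[OF that, of W] unfolding W(2) by (auto simp: openin_open)
  show "eventually Q (atin M p) = eventually Q (at p within W)"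
  proof
    assume "eventually Q (atin M p)"
    then obtain T where T: "openin M T" "p \<in> T" "\<forall>x\<in>T - {p}. Q x"
      using pM unfolding eventually_atin by auto
    obtain S where S: "open S" "T \<inter> W = W \<inter> S" using op'[OF T(1)] by blast
    show "eventually Q (at p within W)"
      unfolding eventually_at_topological
      by (rule exI[of _ S]) (use S T p in auto)
  next
    assume "eventually Q (at p within W)"
    then obtain S where S: "open S" "p \<in> S" "\<forall>x\<in>S. x \<noteq> p \<longrightarrow> x \<in> W \<longrightarrow> Q x"
      unfolding eventually_at_topological by auto
    show "eventually Q (atin M p)"
      unfolding eventually_atin
      by (rule disjI2, rule exI[of _ "W \<inter> S"]) (use S p op in auto)
  qed
qed

locale embedded_nbhd =
  fixes M :: "'a::euclidean_space topology" and W :: "'a set"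
  assumes openin_W: "openin M W" and subtop_W: "subtopology M W = top_of_set W"
begin

lemma W_subset: "W \<subseteq> topspace M"
  using openin_W openin_subset by blast

lemma tangent_curve:
  assumes "q \<in> W" "v \<in> tangent_space M q"
  obtains c \<delta> where "0 < \<delta>" "c 0 = q" "(c has_vector_derivative v) (at (0::real))"
    "\<And>t. \<bar>t\<bar> < \<delta> \<Longrightarrow> c t \<in> W"
proof -
  obtain c \<epsilon> where c: "0 < \<epsilon>" "continuous_map (top_of_set {-\<epsilon><..<\<epsilon>}) M c" "c (0::real) = q"
    "(c has_vector_derivative v) (at 0)"
    using assms unfolding tangent_space_def by auto
  have "openin (top_of_set {-\<epsilon><..<\<epsilon>}) {t \<in> topspace (top_of_set {-\<epsilon><..<\<epsilon>}). c t \<in> W}"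
    using openin_continuous_map_preimage[OF c(2) openin_W] .
  then have "open {t \<in> {-\<epsilon><..<\<epsilon>}. c t \<in> W}"
    by (simp add: openin_open_eq)
  moreover have "0 \<in> {t \<in> {-\<epsilon><..<\<epsilon>}. c t \<in> W}" using c assms by auto
  ultimately obtain \<delta> where "\<delta> > 0" "ball 0 \<delta> \<subseteq> {t \<in> {-\<epsilon><..<\<epsilon>}. c t \<in> W}"
    using open_contains_ball by meson
  then have "\<And>t. \<bar>t\<bar> < \<delta> \<Longrightarrow> c t \<in> W" by (auto simp: ball_def subset_iff)
  then show thesis using that \<open>\<delta> > 0\<close> c by blast
qed

text \<open>A derivative within the thin set \<open>W\<close> is not unique as a linear map, but
  composing with a curve in \<open>W\<close> of velocity \<open>v\<close> determines its value at
  \<open>v\<close>.\<close>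

lemma derivative_within_unique:
  assumes q: "q \<in> W" "v \<in> tangent_space M q"
    and f: "(f has_derivative f') (at q within W)" and g: "(f has_derivative g') (at q within W)"
  shows "f' v = g' v"
proof -
  obtain c \<delta> where c: "0 < \<delta>" "c 0 = q" "(c has_vector_derivative v) (at (0::real))"
    "\<And>t. \<bar>t\<bar> < \<delta> \<Longrightarrow> c t \<in> W" using tangent_curve[OF q] by blast
  have d: "((\<lambda>t. f (c t)) has_vector_derivative h v) (at 0)"
    if h: "(f has_derivative h) (at q within W)" for h
  proof -
    have "(f has_derivative h) (at (c 0) within c ` {-\<delta><..<\<delta>})"
      unfolding c(2) by (rule has_derivative_subset[OF h]) (use c(4) in auto)
    moreover have "(c has_derivative (\<lambda>t. t *\<^sub>R v)) (at 0 within {-\<delta><..<\<delta>})"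
      using c(3) has_derivative_at_withinI unfolding has_vector_derivative_def by blast
    ultimately have "((\<lambda>t. f (c t)) has_derivative (\<lambda>t. h (t *\<^sub>R v))) (at 0 within {-\<delta><..<\<delta>})"
      using has_derivative_in_compose[of c "\<lambda>t. t *\<^sub>R v" 0 "{-\<delta><..<\<delta>}" f h] by blast
    then show ?thesis
      using c(1) at_within_open[of 0 "{-\<delta><..<\<delta>}"] linear_cmul[OF has_derivative_linear[OF h]]
      unfolding has_vector_derivative_def by simp
  qed
  show ?thesis using vector_derivative_unique_at[OF d[OF f] d[OF g]] .
qed

text \<open>The bridge from the definitions to calculus on open sets: any ambient function that
  agrees with \<open>f\<close> on \<open>W\<close> may be differentiated instead.\<close>

lemma differential_eq:
  assumes q: "q \<in> W" "v \<in> tangent_space M q"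
    and g: "g differentiable (at q)" and fg: "\<And>x. x \<in> W \<Longrightarrow> f x = g x"
  shows "differential M f q v = D g q v"
proof -
  have at: "atin M q = at q within W"
    using atin_eq_at_within[OF openin_W subtop_W q(1)] .
  have "(g has_derivative D g q) (at q within W)"
    using has_derivative_D[OF g] has_derivative_at_withinI by blast
  then have "(f has_derivative D g q) (at q within W)"
    by (rule has_derivative_transform[OF q(1), rotated]) (use fg in auto)
  \<comment> \<open>The choice operator in \<open>frechet_derivative\<close> returns a genuine
    derivative as soon as one exists, though possibly another one than \<open>D g q\<close>.\<close>
  moreover from this have "(f has_derivative differential M f q) (at q within W)"
    unfolding differential_def at frechet_derivative_def[of f]
    by (rule someI[where P = "\<lambda>f'. (f has_derivative f') (at q within W)"])
  ultimately show ?thesis using derivative_within_unique[OF q] by blast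
qed

text \<open>Used throughout to differentiate, in tangent directions, identities that hold on
  \<open>W\<close> only.\<close>

lemma D_eq_on_W:
  assumes "q \<in> W" "v \<in> tangent_space M q" "f differentiable (at q)" "g differentiable (at q)"
    and "\<And>x. x \<in> W \<Longrightarrow> f x = g x"
  shows "D f q v = D g q v"
  using differential_eq[OF assms(1,2,4,5)] differential_eq[OF assms(1,2,3), of f] by simp

end

text \<open>The Kerzman--Stein formula: a projection \<open>E\<close> and its adjoint \<open>E\<^sup>T\<close> determine the orthogonal projection
  onto the range of \<open>E\<close> as \<open>E (1 + E - E\<^sup>T)\<^sup>-\<^sup>1\<close>, which is smooth as \<open>|(1 + E - E\<^sup>T) v| \<ge> |v|\<close>.\<close>

lemma orth_proj_smooth_range:
  fixes E :: "'a::euclidean_space \<Rightarrow> 'b::euclidean_space \<Rightarrow> 'b"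
  assumes U: "open U"
    and lin: "\<And>x. x \<in> U \<Longrightarrow> linear (E x)" and sm: "\<And>v. smooth_on U (\<lambda>x. E x v)"
    and idem: "\<And>x v. x \<in> U \<Longrightarrow> E x (E x v) = E x v"
  shows "smooth_on U (\<lambda>x. orth_proj (range (E x)) v)"
proof -
  define Et where "Et x v = (\<Sum>i\<in>Basis. (E x i \<bullet> v) *\<^sub>R i)" for x v
  define A where "A x v = v + E x v - Et x v" for x v
  have adj: "Et x v \<bullet> w = v \<bullet> E x w" if "x \<in> U" for x v w
  proof -
    have "v \<bullet> E x w = v \<bullet> (\<Sum>i\<in>Basis. (w \<bullet> i) *\<^sub>R E x i)"
      using linear_Basis_expansion[OF lin[OF that], of w] by simp
    then show ?thesis
      unfolding Et_def inner_sum_left inner_sum_right by (simp add: inner_commute mult.commute)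
  qed
  have linEt: "linear (Et x)" for x
    unfolding Et_def by (rule linearI)
      (simp_all add: inner_add_right scaleR_add_left sum.distrib scaleR_sum_right)
  have linA: "linear (A x)" if "x \<in> U" for x
    unfolding A_def using lin[OF that] linEt[of x]
    by (intro linear_compose_sub linear_compose_add) (auto simp: linear_id[unfolded id_def])
  have low: "norm v \<le> norm (A x v)" if "x \<in> U" for x v
  proof -
    \<comment> \<open>\<open>E x - Et x\<close> is skew, so it does not contribute to this inner
      product; the lower bound follows by Cauchy-Schwarz.\<close>
    have "v \<bullet> A x v = v \<bullet> v"
      unfolding A_def using adj[OF that, of v v] by (simp add: inner_add_right inner_diff_right inner_commute)
    then have "norm v * norm v \<le> norm v * norm (A x v)"
      using Cauchy_Schwarz_ineq2[of v "A x v"] by (simp add: power2_norm_eq_inner[symmetric] power2_eq_square)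
    then show ?thesis
      by (cases "v = 0") auto
  qed
  have "\<exists>B. linear B \<and> (\<forall>v. A x (B v) = v)" if "x \<in> U" for x
  proof -
    have "inj (A x)"
      unfolding linear_injective_0[OF linA[OF that]]
    proof (intro allI impI)
      fix v assume "A x v = 0" then show "v = 0" using low[OF that, of v] by simp
    qed
    then have "surj (A x)" using linear_injective_imp_surjective[OF linA[OF that]] by simp
    from linear_surjective_right_inverse[OF linA[OF that] this]
    obtain B where "linear B" "A x \<circ> B = id" by blast
    then show ?thesis by (metis comp_apply id_apply)
  qed
  then obtain B where B: "\<And>x. x \<in> U \<Longrightarrow> linear (B x)" "\<And>x v. x \<in> U \<Longrightarrow> A x (B x v) = v"
    by metis
  have smA: "smooth_on U (\<lambda>x. A x v)" for v
    unfolding A_def Et_def using sm U by (intro smooth_on_intros) auto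
  have smB: "smooth_on U (\<lambda>x. B x v)" for v
    by (rule smooth_on_right_inverse[OF U linA smA low B])
  have "smooth_on U (\<lambda>x. E x (B x v))"
    by (rule smooth_on_linear_family[OF U lin sm smB])
  then show ?thesis
  proof (rule smooth_on_cong[OF U])
    fix x assume x: "x \<in> U"
    have "orth_proj (range (E x)) v = E x (B x v)"
    proof (rule orth_proj_eqI)
      show "subspace (range (E x))" using linear_subspace_image[OF lin[OF x] subspace_UNIV] .
      fix u assume "u \<in> range (E x)"
      then obtain w where w: "u = E x w" by auto
      \<comment> \<open>The remainder is \<open>1 - Et x\<close> applied to \<open>B x v\<close>; it
        is orthogonal to the range of \<open>E x\<close> because \<open>E x\<close> is
        idempotent.\<close>
      have "v - E x (B x v) = B x v - Et x (B x v)"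
        using B(2)[OF x, of v] unfolding A_def by (metis add.commute add_diff_cancel_right' diff_add_eq)
      then show "(v - E x (B x v)) \<bullet> u = 0"
        using adj[OF x] idem[OF x] w by (simp add: inner_diff_left)
    qed simp
    then show "E x (B x v) = orth_proj (range (E x)) v" by simp
  qed
qed

subsection \<open>Smooth local retractions\<close>

locale local_retraction = embedded_nbhd M W
  for M :: "'a::euclidean_space topology" and W :: "'a set" +
  fixes \<Omega> :: "'a set" and r :: "'a \<Rightarrow> 'a" and m :: nat
  assumes open_\<Omega>: "open \<Omega>" and smooth_r: "smooth_on \<Omega> r" and r_in: "x \<in> \<Omega> \<Longrightarrow> r x \<in> W"
    and W_\<Omega>: "x \<in> W \<Longrightarrow> x \<in> \<Omega>" and r_W: "x \<in> W \<Longrightarrow> r x = x"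
    and dim_r: "x \<in> W \<Longrightarrow> dim (range (D r x)) = m"
begin

text \<open>Differentiate \<open>r (r x) = r x\<close>. On \<open>W\<close> this says that
  \<open>D r x\<close> is idempotent; off \<open>W\<close> it shows that \<open>D r x v\<close> is
  tangent at \<open>r x\<close>.\<close>

lemma D_r_comp:
  assumes "x \<in> \<Omega>" shows "D r (r x) (D r x v) = D r x v"
proof -
  have "((r \<circ> r) has_derivative (D r (r x) \<circ> D r x)) (at x)"
    by (rule diff_chain_at[OF smooth_on_has_derivative[OF smooth_r assms]])
      (rule smooth_on_has_derivative[OF smooth_r W_\<Omega>[OF r_in[OF assms]]])
  then have "(r has_derivative (D r (r x) \<circ> D r x)) (at x)"
    by (rule has_derivative_transform_within_open[OF _ open_\<Omega> assms]) (simp add: r_W r_in)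
  then show ?thesis using D_eq[of r "D r (r x) \<circ> D r x" x v] by simp
qed

lemma D_r_tangent:
  assumes "x \<in> W" "v \<in> tangent_space M x" shows "D r x v = v"
proof -
  have "D r x v = D (\<lambda>y. y) x v"
    by (rule D_eq_on_W[OF assms smooth_onD[OF smooth_r W_\<Omega>[OF assms(1)]]]) (auto simp: r_W)
  then show ?thesis by (simp add: D_eq[OF has_derivative_ident])
qed

text \<open>A tangent vector is fixed by \<open>D r x\<close>, since \<open>r\<close> is the
  identity on \<open>W\<close>; conversely \<open>D r x v\<close> is the velocity of the retracted
  line \<open>r (x + t *\<^sub>R v)\<close>.\<close>

lemma tangent_space_eq:
  assumes "x \<in> W" shows "tangent_space M x = range (D r x)"
proof
  show "tangent_space M x \<subseteq> range (D r x)" using D_r_tangent[OF assms] by (metis rangeI subsetI)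
  show "range (D r x) \<subseteq> tangent_space M x"
  proof
    fix w assume "w \<in> range (D r x)"
    then obtain v where w: "w = D r x v" by auto
    have x: "x \<in> \<Omega>" using W_\<Omega> assms by blast
    define L where "L t = x + t *\<^sub>R v" for t :: real
    have L: "(L has_derivative (\<lambda>t. t *\<^sub>R v)) (at t)" for t
      unfolding L_def by (auto intro!: derivative_eq_intros)
    have contL: "continuous_on UNIV L" unfolding L_def by (intro continuous_intros)
    have "open (L -` \<Omega>)" using open_vimage[OF open_\<Omega> contL] .
    moreover have "0 \<in> L -` \<Omega>" using x by (simp add: L_def)
    ultimately obtain e where e: "e > 0" "ball 0 e \<subseteq> L -` \<Omega>" using open_contains_ball by meson
    have I: "{-e<..<e} = ball (0::real) e" by (auto simp: dist_real_def)
    have L\<Omega>: "L ` {-e<..<e} \<subseteq> \<Omega>" using e I by auto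
    have smL: "smooth_on {-e<..<e} L" unfolding L_def
      by (intro smooth_on_add smooth_on_const smooth_on_scaleR smooth_on_ident) auto
    have sm: "smooth_on {-e<..<e} (\<lambda>t. r (L t))"
      by (rule smooth_on_comp[OF _ L\<Omega> smL smooth_r]) simp
    have "continuous_map (top_of_set {-e<..<e}) (top_of_set W) (\<lambda>t. r (L t))"
      using smooth_on_imp_continuous[OF sm] L\<Omega> r_in by (auto simp: continuous_map_in_subtopology)
    then have cm: "continuous_map (top_of_set {-e<..<e}) M (\<lambda>t. r (L t))"
      unfolding subtop_W[symmetric] by (simp add: continuous_map_in_subtopology)
    have "((\<lambda>t. r (L t)) has_derivative (\<lambda>t. D r (L 0) (t *\<^sub>R v))) (at 0)"
      using diff_chain_at[OF L[of 0] smooth_on_has_derivative[OF smooth_r]] x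
      by (simp add: o_def L_def)
    then have "((\<lambda>t. r (L t)) has_vector_derivative w) (at 0)"
      unfolding has_vector_derivative_def w using linear_cmul[OF linear_D[OF smooth_onD[OF smooth_r x]]]
      by (simp add: L_def)
    then show "w \<in> tangent_space M x"
      unfolding tangent_space_def using e(1) sm cm r_W[OF assms]
      by (intro CollectI exI[of _ "\<lambda>t. r (L t)"] exI[of _ e]) (simp add: L_def)
  qed
qed

lemma subspace_tangent: "x \<in> W \<Longrightarrow> subspace (tangent_space M x)"
  using tangent_space_eq linear_subspace_image[OF linear_D[OF smooth_onD[OF smooth_r W_\<Omega>]] subspace_UNIV] by simp

lemma dim_tangent: "x \<in> W \<Longrightarrow> dim (tangent_space M x) = m"
  by (simp add: tangent_space_eq dim_r)

definition P :: "'a \<Rightarrow> 'a \<Rightarrow> 'a" where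
  "P q v = orth_proj (tangent_space M (r q)) v"

lemma smooth_P: "smooth_on \<Omega> (\<lambda>q. P q v)"
proof (rule smooth_on_cong[OF open_\<Omega>])
  show "smooth_on \<Omega> (\<lambda>q. orth_proj (range (D r (r q))) v)"
  proof (rule orth_proj_smooth_range[OF open_\<Omega>])
    show "linear (D r (r x))" if "x \<in> \<Omega>" for x
      by (rule linear_D[OF smooth_onD[OF smooth_r W_\<Omega>[OF r_in[OF that]]]])
    show "smooth_on \<Omega> (\<lambda>x. D r (r x) v)" for v
      by (rule smooth_on_comp[OF open_\<Omega> _ smooth_r smooth_on_D_const[OF smooth_r]]) (use r_in W_\<Omega> in auto)
    show "D r (r x) (D r (r x) v) = D r (r x) v" if "x \<in> \<Omega>" for x v
      using D_r_comp[OF W_\<Omega>[OF r_in[OF that]]] r_W[OF r_in[OF that]] by simp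
  qed
qed (simp add: P_def tangent_space_eq r_in)

lemma P_W: "q \<in> W \<Longrightarrow> P q v = orth_proj (tangent_space M q) v"
  by (simp add: P_def r_W)

lemma linear_P: "q \<in> \<Omega> \<Longrightarrow> linear (P q)"
  unfolding P_def using linear_orth_proj[OF subspace_tangent[OF r_in]] by simp

lemma P_idem: "q \<in> \<Omega> \<Longrightarrow> P q (P q v) = P q v"
  unfolding P_def using orth_proj_ident[OF subspace_tangent[OF r_in]] orth_proj_in[OF subspace_tangent[OF r_in]] by simp

lemma P_sym: "q \<in> \<Omega> \<Longrightarrow> P q u \<bullet> v = u \<bullet> P q v"
  unfolding P_def using orth_proj_sym[OF subspace_tangent[OF r_in]] by simp

lemma P_in: "q \<in> W \<Longrightarrow> P q v \<in> tangent_space M q"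
  by (simp add: P_W orth_proj_in subspace_tangent)

lemma P_tangent: "q \<in> W \<Longrightarrow> v \<in> tangent_space M q \<Longrightarrow> P q v = v"
  by (simp add: P_W orth_proj_ident subspace_tangent)

lemma P_inner: "q \<in> W \<Longrightarrow> u \<in> tangent_space M q \<Longrightarrow> P q v \<bullet> u = v \<bullet> u"
  by (simp add: P_W orth_proj_inner subspace_tangent)

lemma P_eq_0_iff: "q \<in> W \<Longrightarrow> P q v = 0 \<longleftrightarrow> (\<forall>u\<in>tangent_space M q. v \<bullet> u = 0)"
  by (simp add: P_W orth_proj_eq_0_iff subspace_tangent)

lemma smooth_P_app: "smooth_on \<Omega> X \<Longrightarrow> smooth_on \<Omega> (\<lambda>q. P q (X q))"
  by (rule smooth_on_linear_family[OF open_\<Omega> linear_P smooth_P])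

end

text \<open>In a slice chart the retraction is the orthogonal projection onto the slice
  \<open>S\<close>, conjugated by the chart; \<open>\<Omega>\<close> collects the points whose
  projected image remains in the domain of \<open>G\<close>.\<close>

lemma immersed_submanifold_local_retraction:
  assumes "immersed_submanifold m M" "p \<in> topspace M"
  obtains W \<Omega> r where "local_retraction M W \<Omega> r m" "p \<in> W"
proof -
  obtain W U and F :: "'a \<Rightarrow> 'a" and G S where
    pW: "p \<in> W" and W: "openin M W" "subtopology M W = top_of_set W" and U: "open U" and FU: "open (F ` U)"
    and F: "smooth_on U F" and G: "smooth_on (F ` U) G" and "\<forall>x\<in>U. G (F x) = x"
    and S: "subspace S" "dim S = m" and Weq: "W = {x \<in> U. F x \<in> S}"
    using bspec[OF conjunct2[OF assms(1)[unfolded immersed_submanifold_def]] assms(2)]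
    by (elim exE conjE) (rule that; assumption)
  then have GF: "G (F x) = x" if "x \<in> U" for x using that by blast
  define \<pi> where "\<pi> = orth_proj S"
  have bl: "bounded_linear \<pi>" unfolding \<pi>_def using linear_orth_proj[OF S(1)] linear_conv_bounded_linear by blast
  define \<Omega> where "\<Omega> = {x \<in> U. \<pi> (F x) \<in> F ` U}"
  define r where "r x = G (\<pi> (F x))" for x
  have sm\<pi>F: "smooth_on U (\<lambda>x. \<pi> (F x))"
    by (rule smooth_on_comp[OF U _ F smooth_on_linear[OF bl open_UNIV]]) simp
  have "open (U \<inter> (\<lambda>x. \<pi> (F x)) -` (F ` U))"
    by (rule continuous_open_preimage[OF smooth_on_imp_continuous[OF sm\<pi>F] U FU])
  moreover have "U \<inter> (\<lambda>x. \<pi> (F x)) -` (F ` U) = \<Omega>" unfolding \<Omega>_def by blast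
  ultimately have op: "open \<Omega>" by simp
  have W\<Omega>: "x \<in> \<Omega> \<and> r x = x" if "x \<in> W" for x
    using that orth_proj_ident[OF S(1)] GF unfolding Weq \<Omega>_def r_def \<pi>_def by auto
  have smr: "smooth_on \<Omega> r"
    unfolding r_def by (rule smooth_on_comp[OF op _ smooth_on_subset[OF sm\<pi>F] G]) (auto simp: \<Omega>_def)
  \<comment> \<open>At \<open>x\<close> the derivatives of \<open>F\<close> and \<open>G\<close> are
    inverse isomorphisms, so the range of \<open>D r x\<close> is an isomorphic image of
    \<open>S\<close>.\<close>
  have "dim (range (D r x)) = m" if x: "x \<in> W" for x
  proof -
    have xU: "x \<in> U" and xS: "F x \<in> S" using x Weq by auto
    have dF: "(F has_derivative D F x) (at x)" and dG: "(G has_derivative D G (F x)) (at (F x))"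
      using smooth_on_has_derivative[OF F xU] smooth_on_has_derivative[OF G] xU by auto
    note linF = has_derivative_linear[OF dF] and linG = has_derivative_linear[OF dG]
    have "((G \<circ> F) has_derivative (D G (F x) \<circ> D F x)) (at x)" by (rule diff_chain_at[OF dF dG])
    then have "((\<lambda>x. x) has_derivative (D G (F x) \<circ> D F x)) (at x)"
      by (rule has_derivative_transform_within_open[OF _ U xU]) (simp add: GF)
    then have inv: "D G (F x) (D F x v) = v" for v
      using D_eq[of "\<lambda>x. x" "D G (F x) \<circ> D F x" x v] D_eq[OF has_derivative_ident, of x v] by simp
    have "inj (D F x)" using inv by (metis injI)
    then have surjF: "surj (D F x)" using linear_injective_imp_surjective[OF linF] by blast
    have "surj (D G (F x))" using inv by (metis surjI)
    then have injG: "inj (D G (F x))" using linear_surjective_imp_injective[OF linG] by blast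
    have "((\<pi> \<circ> F) has_derivative (\<pi> \<circ> D F x)) (at x)"
      by (rule diff_chain_at[OF dF bounded_linear_imp_has_derivative[OF bl]])
    moreover have "(\<pi> \<circ> F) x = F x" using xS orth_proj_ident[OF S(1)] by (simp add: \<pi>_def)
    ultimately have "((G \<circ> (\<pi> \<circ> F)) has_derivative (D G (F x) \<circ> (\<pi> \<circ> D F x))) (at x)"
      using dG diff_chain_at[of "\<pi> \<circ> F" "\<pi> \<circ> D F x" x G "D G (F x)"] by simp
    moreover have "G \<circ> (\<pi> \<circ> F) = r" by (simp add: r_def fun_eq_iff)
    ultimately have "(r has_derivative (D G (F x) \<circ> (\<pi> \<circ> D F x))) (at x)" by simp
    then have "D r x = D G (F x) \<circ> (\<pi> \<circ> D F x)"
      by (simp add: D_eq fun_eq_iff)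
    then have "range (D r x) = D G (F x) ` (range (\<pi> \<circ> D F x))" by (simp add: image_comp)
    also have "range (\<pi> \<circ> D F x) = range \<pi>" using surjF by (metis image_comp)
    also have "range \<pi> = S"
    proof
      show "range \<pi> \<subseteq> S" unfolding \<pi>_def using orth_proj_in[OF S(1)] by blast
      show "S \<subseteq> range \<pi>" unfolding \<pi>_def using orth_proj_ident[OF S(1)] by (metis rangeI subsetI)
    qed
    finally show ?thesis using dim_image_eq[OF linG, of S] injG S by (simp add: inj_on_def inj_def)
  qed
  then have "local_retraction M W \<Omega> r m"
    using W op smr W\<Omega>
  proof (unfold_locales)
    fix x assume "x \<in> \<Omega>"
    then obtain u where u: "u \<in> U" "\<pi> (F x) = F u" unfolding \<Omega>_def by auto
    then have "F u \<in> S" using orth_proj_in[OF S(1)] unfolding \<pi>_def by metis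
    then show "r x \<in> W" unfolding Weq r_def using u GF by simp
  qed auto
  then show thesis using that pW by blast
qed

subsection \<open>The second fundamental form\<close>

lemma D_const: "D (\<lambda>y. c) x v = 0"
  by (rule D_eq) simp

lemma D_ident: "D (\<lambda>y. y) x v = v"
  by (rule D_eq) simp

lemma D_add: "f differentiable (at x) \<Longrightarrow> g differentiable (at x) \<Longrightarrow> D (\<lambda>y. f y + g y) x v = D f x v + D g x v"
  by (rule D_eq) (intro has_derivative_add has_derivative_D)

lemma D_diff: "f differentiable (at x) \<Longrightarrow> g differentiable (at x) \<Longrightarrow> D (\<lambda>y. f y - g y) x v = D f x v - D g x v"
  by (rule D_eq) (intro has_derivative_diff has_derivative_D)

lemma D_scaleR: "f differentiable (at x) \<Longrightarrow> g differentiable (at x) \<Longrightarrow>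
   D (\<lambda>y. f y *\<^sub>R g y) x v = f x *\<^sub>R D g x v + D f x v *\<^sub>R g x"
  by (rule D_eq) (intro has_derivative_scaleR has_derivative_D)

lemma D_scaleR_const: "g differentiable (at x) \<Longrightarrow> D (\<lambda>y. c *\<^sub>R g y) x v = c *\<^sub>R D g x v"
  by (rule D_eq) (intro has_derivative_scaleR_right has_derivative_D)

lemma D_inner: "f differentiable (at x) \<Longrightarrow> g differentiable (at x) \<Longrightarrow>
   D (\<lambda>y. f y \<bullet> g y) x v = D f x v \<bullet> g x + f x \<bullet> D g x v"
  by (subst add.commute, rule D_eq) (intro has_derivative_inner has_derivative_D)

lemma D_sum: "(\<And>i. i \<in> I \<Longrightarrow> f i differentiable (at x)) \<Longrightarrow> D (\<lambda>y. \<Sum>i\<in>I. f i y) x v = (\<Sum>i\<in>I. D (f i) x v)"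
  by (rule D_eq) (intro has_derivative_sum has_derivative_D)

lemma D_linear_family:
  assumes U: "open U" "x \<in> U"
    and L: "\<And>x. x \<in> U \<Longrightarrow> linear (L x)" "\<And>v. smooth_on U (\<lambda>x. L x v)" and X: "smooth_on U X"
  shows "D (\<lambda>y. L y (X y)) x h = D (\<lambda>y. L y (X x)) x h + L x (D X x h)"
proof -
  note dL = smooth_onD[OF L(2) U(2)] and dX = smooth_onD[OF X U(2)]
  have dXi: "(\<lambda>y. X y \<bullet> i) differentiable (at x)" for i
    using dX by (intro differentiable_inner) auto
  have dt: "(\<lambda>y. c y *\<^sub>R L y i) differentiable (at x)" if "c differentiable (at x)" for c i
    using that dL by (intro differentiable_scaleR)
  have e: "D (\<lambda>y. L y (Y y)) x h = D (\<lambda>y. \<Sum>i\<in>Basis. (Y y \<bullet> i) *\<^sub>R L y i) x h"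
    if "\<And>i. (\<lambda>y. Y y \<bullet> i) differentiable (at x)" for Y
  proof (rule D_cong_open(1)[OF U])
    show "(\<Sum>i\<in>Basis. (Y y \<bullet> i) *\<^sub>R L y i) = L y (Y y)" if "y \<in> U" for y
      by (rule linear_Basis_expansion[OF L(1)[OF that], symmetric])
    show "(\<lambda>y. \<Sum>i\<in>Basis. (Y y \<bullet> i) *\<^sub>R L y i) differentiable at x"
      by (intro differentiable_sum finite_Basis ballI dt that)
  qed
  have "D (\<lambda>y. L y (X y)) x h = (\<Sum>i\<in>Basis. (X x \<bullet> i) *\<^sub>R D (\<lambda>y. L y i) x h + (D X x h \<bullet> i) *\<^sub>R L x i)"
    by (simp add: e[OF dXi] D_sum dt dXi D_scaleR dL D_inner_const dX)
  also have "\<dots> = D (\<lambda>y. L y (X x)) x h + (\<Sum>i\<in>Basis. (D X x h \<bullet> i) *\<^sub>R L x i)"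
    by (simp add: e D_sum dt D_scaleR_const dL sum.distrib)
  also have "(\<Sum>i\<in>Basis. (D X x h \<bullet> i) *\<^sub>R L x i) = L x (D X x h)"
    by (rule linear_Basis_expansion[OF L(1)[OF U(2)], symmetric])
  finally show ?thesis .
qed

text \<open>The flat ambient connection has neither curvature nor torsion. Applied to
  \<open>r\<close> this yields the symmetry of the second fundamental form, applied to
  \<open>P\<close> the Gauss and Codazzi equations.\<close>

lemma D_commutator:
  assumes U: "open U" "p \<in> U" and sm: "smooth_on U f" "smooth_on U X" "smooth_on U Y"
  shows "D (\<lambda>q. D f q (Y q)) p (X p) - D (\<lambda>q. D f q (X q)) p (Y p) = D f p (D Y p (X p) - D X p (Y p))"
proof -
  have "D (\<lambda>q. D f q (Z q)) p v = D (\<lambda>q. D f q (Z p)) p v + D f p (D Z p v)" if "smooth_on U Z" for Z v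
    by (rule D_linear_family[OF U linear_D[OF smooth_onD[OF sm(1)]] smooth_on_D_const[OF sm(1)] that])
  then show ?thesis
    using D_D_commute[OF U sm(1), of "X p" "Y p"] linear_diff[OF linear_D[OF smooth_onD[OF sm(1) U(2)]]] sm
    by simp
qed

definition tangent_frame :: "'a::euclidean_space topology \<Rightarrow> 'a \<Rightarrow> 'a set" where
  "tangent_frame M p = (SOME B. orthonormal_basis (tangent_space M p) B)"

lemma tangent_trace_eq: "tangent_trace M p b = (\<Sum>e\<in>tangent_frame M p. b e e)"
  by (simp add: tangent_trace_def tangent_frame_def)

lemma levi_civita_apply:
  "levi_civita M X Y p = orth_proj (tangent_space M p) (differential M Y p (X p))"
  by (simp add: levi_civita_def pullback_connection_def)

context local_retraction
begin

text \<open>On tangent vectors, \<open>DP q\<close> is the second fundamental form of \<open>M\<close> in the ambient Euclidean space; for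
  a normal vector \<open>\<xi>\<close>, \<open>DP q x \<xi>\<close> is the shape operator \<open>A\<^sub>\<xi> x\<close>.\<close>

definition DP :: "'a \<Rightarrow> 'a \<Rightarrow> 'a \<Rightarrow> 'a" where
  "DP q x w = D (\<lambda>q. P q w) q x"

lemma tangent_frame: "q \<in> W \<Longrightarrow> orthonormal_basis (tangent_space M q) (tangent_frame M q)"
  unfolding tangent_frame_def using someI_ex[OF ex_orthonormal_basis[OF subspace_tangent]] .

lemma tangent_frame_in: "q \<in> W \<Longrightarrow> e \<in> tangent_frame M q \<Longrightarrow> e \<in> tangent_space M q"
  using tangent_frame unfolding orthonormal_basis_def by blast

lemma card_tangent_frame: "q \<in> W \<Longrightarrow> card (tangent_frame M q) = m"
  using orthonormal_basis_card[OF tangent_frame] dim_tangent by simp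

lemma tangent_frame_norm: "q \<in> W \<Longrightarrow> e \<in> tangent_frame M q \<Longrightarrow> e \<bullet> e = 1"
  using orthonormal_basis_inner[OF tangent_frame] by simp

lemma tangent_frame_expand:
  assumes "q \<in> W" "v \<in> tangent_space M q" "linear f"
  shows "f v = (\<Sum>e\<in>tangent_frame M q. (v \<bullet> e) *\<^sub>R f e)"
proof -
  have "f v = f (\<Sum>e\<in>tangent_frame M q. (v \<bullet> e) *\<^sub>R e)"
    using orthonormal_basis_expand[OF tangent_frame assms(2)] assms(1) by simp
  then show ?thesis by (simp add: linear_sum[OF assms(3)] linear_cmul[OF assms(3)])
qed

lemma smooth_differentiable: "smooth_on \<Omega> f \<Longrightarrow> q \<in> W \<Longrightarrow> f differentiable (at q)"
  using smooth_onD W_\<Omega> by blast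

lemma linear_DP_dir: "q \<in> \<Omega> \<Longrightarrow> linear (\<lambda>x. DP q x w)"
  unfolding DP_def by (rule linear_D[OF smooth_onD[OF smooth_P]])

lemma linear_DP: assumes q: "q \<in> \<Omega>" shows "linear (DP q x)"
proof (rule linearI)
  note d = smooth_onD[OF smooth_P q]
  show "DP q x (u + v) = DP q x u + DP q x v" for u v
  proof -
    have "DP q x (u + v) = D (\<lambda>q. P q u + P q v) q x" unfolding DP_def
      by (rule D_cong_open(1)[OF open_\<Omega> q]) (simp_all add: linear_add[OF linear_P] d)
    then show ?thesis by (simp add: D_add d DP_def)
  qed
  show "DP q x (c *\<^sub>R v) = c *\<^sub>R DP q x v" for c v
  proof -
    have "DP q x (c *\<^sub>R v) = D (\<lambda>q. c *\<^sub>R P q v) q x" unfolding DP_def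
      by (rule D_cong_open(1)[OF open_\<Omega> q]) (simp_all add: linear_cmul[OF linear_P] d)
    then show ?thesis by (simp add: D_scaleR_const d DP_def)
  qed
qed

lemma smooth_DP:
  assumes "smooth_on \<Omega> X" "smooth_on \<Omega> Y"
  shows "smooth_on \<Omega> (\<lambda>q. DP q (X q) (Y q))"
proof (rule smooth_on_linear_family[OF open_\<Omega> linear_DP _ assms(2)])
  show "smooth_on \<Omega> (\<lambda>q. DP q (X q) w)" for w
    unfolding DP_def by (rule smooth_on_D[OF open_\<Omega> smooth_P assms(1)])
qed

lemma D_P_app:
  assumes "q \<in> \<Omega>" "smooth_on \<Omega> X"
  shows "D (\<lambda>q. P q (X q)) q v = DP q v (X q) + P q (D X q v)"
  unfolding DP_def by (rule D_linear_family[OF open_\<Omega> assms(1) linear_P smooth_P assms(2)])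

text \<open>The derivative of the self-adjointness of \<open>P\<close>. It contains the adjointness
  of the shape operator and the second fundamental form.\<close>

lemma DP_sym: assumes q: "q \<in> \<Omega>" shows "DP q x u \<bullet> v = u \<bullet> DP q x v"
proof -
  note d = smooth_onD[OF smooth_P q]
  have "DP q x u \<bullet> v = D (\<lambda>q. P q u \<bullet> v) q x" by (simp add: DP_def D_inner_const d)
  also have "\<dots> = D (\<lambda>q. P q v \<bullet> u) q x"
  proof (rule D_cong_open(1)[OF open_\<Omega> q])
    show "P y v \<bullet> u = P y u \<bullet> v" if "y \<in> \<Omega>" for y
      using P_sym[OF that, of u v] by (simp add: inner_commute)
  qed (intro differentiable_inner d differentiable_const)
  also have "\<dots> = u \<bullet> DP q x v" unfolding DP_def D_inner_const[OF d] by (rule inner_commute)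
  finally show ?thesis .
qed

text \<open>The derivative of \<open>P q (P q u) = P q u\<close>. At points of \<open>W\<close> it
  makes \<open>DP q x\<close> exchange tangent and normal vectors, as the next lemmas
  record.\<close>

lemma DP_idem: assumes q: "q \<in> \<Omega>" shows "DP q x (P q u) + P q (DP q x u) = DP q x u"
proof -
  have "D (\<lambda>q. P q (P q u)) q x = D (\<lambda>q. P q u) q x"
    by (rule D_cong_open(1)[OF open_\<Omega> q]) (simp_all add: P_idem smooth_onD[OF smooth_P q])
  then show ?thesis using D_P_app[OF q smooth_P, of u x] by (simp add: DP_def)
qed

lemma P_DP_tangent: "q \<in> W \<Longrightarrow> y \<in> tangent_space M q \<Longrightarrow> P q (DP q x y) = 0"
  using DP_idem[OF W_\<Omega>, of q x y] P_tangent by simp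

lemma P_DP_normal: "q \<in> W \<Longrightarrow> P q y = 0 \<Longrightarrow> P q (DP q x y) = DP q x y"
  using DP_idem[OF W_\<Omega>, of q x y] linear_0[OF linear_DP[OF W_\<Omega>]] by simp

lemma DP_tangent_inner:
  "q \<in> W \<Longrightarrow> y \<in> tangent_space M q \<Longrightarrow> z \<in> tangent_space M q \<Longrightarrow> DP q x y \<bullet> z = 0"
  using P_DP_tangent P_inner by (metis inner_zero_left)

lemma DP_normal_inner:
  assumes "q \<in> W" "P q y = 0" "P q \<xi> = 0" shows "\<xi> \<bullet> DP q x y = 0"
  using P_sym[OF W_\<Omega>[OF assms(1)], of \<xi> "DP q x y"] assms P_DP_normal by simp

text \<open>The difference \<open>w\<close> is the bracket of the fields \<open>P q x\<close> and
  \<open>P q y\<close>. It is tangent, by the commutator formula for \<open>r\<close>, and normal,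
  because both terms are; so it vanishes.\<close>

lemma DP_commute:
  assumes q: "q \<in> W" "x \<in> tangent_space M q" "y \<in> tangent_space M q"
  shows "DP q x y = DP q y x"
proof -
  define w where "w = DP q x y - DP q y x"
  have c: "D (\<lambda>q. D r q (P q v)) q u = DP q u v" if "u \<in> tangent_space M q" for u v
    unfolding DP_def
    by (rule D_eq_on_W[OF q(1) that smooth_differentiable[OF _ q(1)] smooth_differentiable[OF _ q(1)]])
      (auto intro!: smooth_on_D open_\<Omega> smooth_r smooth_P D_r_tangent P_in)
  have "DP q x y - DP q y x = D r q (DP q x y - DP q y x)"
    using D_commutator[OF open_\<Omega> W_\<Omega>[OF q(1)] smooth_r smooth_P[of x] smooth_P[of y]]
    by (simp add: P_tangent q c) (simp add: DP_def)
  then have "w \<in> tangent_space M q" unfolding tangent_space_eq[OF q(1)] w_def[symmetric] by (metis rangeI)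
  then have "P q w = w" using P_tangent q by simp
  moreover have "P q w = 0" unfolding w_def using q by (simp add: linear_diff[OF linear_P[OF W_\<Omega>]] P_DP_tangent)
  ultimately show ?thesis by (simp add: w_def)
qed

text \<open>The trace of the second fundamental form, written without a moving frame so that it is smooth.\<close>

definition K :: "'a \<Rightarrow> 'a" where
  "K q = (\<Sum>i\<in>Basis. DP q (P q i) i)"

lemma smooth_K: "smooth_on \<Omega> K"
  unfolding K_def[abs_def] by (intro smooth_on_sum open_\<Omega> smooth_DP smooth_P smooth_on_const)

lemma K_trace: assumes "q \<in> W" shows "K q = (\<Sum>e\<in>tangent_frame M q. DP q e e)"
  unfolding K_def P_W[OF assms]
  by (rule orthonormal_basis_trace_proj[OF subspace_tangent[OF assms] tangent_frame[OF assms]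
        linear_DP_dir[OF W_\<Omega>[OF assms]] linear_DP[OF W_\<Omega>[OF assms]]])

lemma tangent_extension_eq: "q \<in> W \<Longrightarrow> tangent_extension M v q = P q v"
  by (simp add: tangent_extension_def P_W)

lemma levi_civita_extension:
  assumes "q \<in> W"
  shows "levi_civita M (tangent_extension M y) (tangent_extension M z) q = P q (DP q (P q y) z)"
  unfolding levi_civita_def pullback_connection_def tangent_extension_eq[OF assms] P_W[OF assms, symmetric] DP_def
  by (subst differential_eq[OF assms P_in[OF assms] smooth_differentiable[OF smooth_P assms]])
    (auto simp: tangent_extension_eq)

lemma zero_tangent: "q \<in> W \<Longrightarrow> 0 \<in> tangent_space M q"
  using subspace_tangent subspace_0 by blast

text \<open>The Gauss equation in Euclidean space: on tangent vectors the curvature is the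
  commutator of \<open>DP\<close>. The second derivatives of \<open>P\<close> cancel by flatness,
  and the bracket of the extended fields vanishes at \<open>p\<close>.\<close>

lemma curvature_tensor_eq:
  assumes p: "p \<in> W" and xyz: "x \<in> tangent_space M p" "y \<in> tangent_space M p" "z \<in> tangent_space M p"
  shows "curvature_tensor M p x y z = DP p x (DP p y z) - DP p y (DP p x z)"
proof -
  note p\<Omega> = W_\<Omega>[OF p]
  have one: "levi_civita M (tangent_extension M u) (levi_civita M (tangent_extension M v) (tangent_extension M z)) p
      = DP p u (DP p v z) + P p (D (\<lambda>q. D (\<lambda>q. P q z) q (P q v)) p u)"
    if u: "u \<in> tangent_space M p" and v: "v \<in> tangent_space M p" for u v
  proof -
    have sm: "smooth_on \<Omega> (\<lambda>q. DP q (P q v) z)" by (intro smooth_DP smooth_P smooth_on_const)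
    have "differential M (levi_civita M (tangent_extension M v) (tangent_extension M z)) p u
       = D (\<lambda>q. P q (DP q (P q v) z)) p u"
      by (rule differential_eq[OF p u smooth_differentiable[OF smooth_P_app[OF sm] p]])
        (rule levi_civita_extension)
    also have "\<dots> = DP p u (DP p v z) + P p (D (\<lambda>q. DP q (P q v) z) p u)"
      using D_P_app[OF p\<Omega> sm] P_tangent[OF p v] by simp
    finally have "levi_civita M (tangent_extension M u) (levi_civita M (tangent_extension M v) (tangent_extension M z)) p
      = P p (DP p u (DP p v z) + P p (D (\<lambda>q. DP q (P q v) z) p u))"
      by (simp only: levi_civita_apply[of M "tangent_extension M u"] tangent_extension_eq[OF p] P_tangent[OF p u]
          P_W[OF p, symmetric])
    also have "\<dots> = DP p u (DP p v z) + P p (D (\<lambda>q. DP q (P q v) z) p u)"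
      by (simp add: linear_add[OF linear_P[OF p\<Omega>]] P_idem p\<Omega> P_DP_normal p P_DP_tangent xyz)
    finally show ?thesis by (simp add: DP_def)
  qed
  have lb: "lie_bracket M (tangent_extension M x) (tangent_extension M y) p = 0"
  proof -
    have "differential M (tangent_extension M v) p u = DP p u v" if "u \<in> tangent_space M p" for u v
      unfolding DP_def by (rule differential_eq[OF p that smooth_differentiable[OF smooth_P p]])
        (rule tangent_extension_eq)
    then show ?thesis
      unfolding lie_bracket_def tangent_extension_eq[OF p] using xyz P_tangent[OF p] DP_commute[OF p] by simp
  qed
  \<comment> \<open>The covariant derivative depends on the direction field only through its value
    at \<open>p\<close>, which is 0.\<close>
  have three: "levi_civita M (lie_bracket M (tangent_extension M x) (tangent_extension M y)) (tangent_extension M z) p = 0"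
  proof -
    have "differential M (tangent_extension M z) p 0 = DP p 0 z"
      unfolding DP_def by (rule differential_eq[OF p zero_tangent[OF p] smooth_differentiable[OF smooth_P p]])
        (rule tangent_extension_eq)
    then show ?thesis unfolding levi_civita_def pullback_connection_def lb P_W[OF p, symmetric]
      by (simp add: linear_0[OF linear_DP_dir[OF p\<Omega>]] linear_0[OF linear_P[OF p\<Omega>]])
  qed
  have "D (\<lambda>q. D (\<lambda>q. P q z) q (P q y)) p x - D (\<lambda>q. D (\<lambda>q. P q z) q (P q x)) p y = 0"
    using D_commutator[OF open_\<Omega> p\<Omega> smooth_P[of z] smooth_P[of x] smooth_P[of y]] DP_commute[OF p xyz(1,2)]
      linear_0[OF linear_DP_dir[OF p\<Omega>, of z]]
    by (simp add: P_tangent p xyz DP_def)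
  then show ?thesis
    unfolding curvature_tensor_def curvature_field_def three one[OF xyz(1,2)] one[OF xyz(2,1)] by simp
qed

text \<open>The Gauss equation traced twice: squared length of the trace minus squared length of the
  second fundamental form.\<close>

lemma scalar_curvature_eq:
  assumes p: "p \<in> W"
  shows "scalar_curvature M p = K p \<bullet> K p - (\<Sum>e\<in>tangent_frame M p. \<Sum>f\<in>tangent_frame M p. DP p e f \<bullet> DP p e f)"
proof -
  let ?B = "tangent_frame M p"
  note p\<Omega> = W_\<Omega>[OF p]
  have "scalar_curvature M p = (\<Sum>f\<in>?B. \<Sum>e\<in>?B. curvature_tensor M p e f f \<bullet> e)"
    unfolding scalar_curvature_def ricci_tensor_def tangent_trace_eq ..
  also have "\<dots> = (\<Sum>f\<in>?B. \<Sum>e\<in>?B. DP p f f \<bullet> DP p e e - DP p e f \<bullet> DP p e f)"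
  proof (intro sum.cong refl)
    fix e f assume "f \<in> ?B" "e \<in> ?B"
    then have T: "f \<in> tangent_space M p" "e \<in> tangent_space M p" using tangent_frame_in[OF p] by auto
    then show "curvature_tensor M p e f f \<bullet> e = DP p f f \<bullet> DP p e e - DP p e f \<bullet> DP p e f"
      using DP_commute[OF p T] by (simp add: curvature_tensor_eq[OF p] inner_diff_left DP_sym[OF p\<Omega>])
  qed
  also have "\<dots> = (\<Sum>f\<in>?B. DP p f f) \<bullet> (\<Sum>e\<in>?B. DP p e e) - (\<Sum>f\<in>?B. \<Sum>e\<in>?B. DP p e f \<bullet> DP p e f)"
    by (simp add: sum_subtractf inner_sum_left inner_sum_right, rule sum.swap)
  also have "(\<Sum>f\<in>?B. \<Sum>e\<in>?B. DP p e f \<bullet> DP p e f) = (\<Sum>e\<in>?B. \<Sum>f\<in>?B. DP p e f \<bullet> DP p e f)"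
    by (rule sum.swap)
  finally show ?thesis by (simp add: K_trace[OF p])
qed

end

subsection \<open>The unit sphere\<close>

abbreviation unit_sphere :: "'a::euclidean_space topology" where
  "unit_sphere \<equiv> top_of_set (sphere 0 1)"

interpretation sphere: embedded_nbhd unit_sphere "sphere 0 1"
  by unfold_locales (simp_all add: subtopology_subtopology)

lemma subspace_orthogonal_vectors: "subspace {v. v \<bullet> q = 0}"
  by (simp add: subspace_def inner_add_left)

text \<open>Differentiation keeps this family of curves, replacing \<open>(a, b)\<close> by a
  multiple of \<open>(b, - a)\<close>, so the induction runs over all \<open>a\<close> and
  \<open>b\<close> at once.\<close>

lemma smooth_on_circle:
  "smooth_on UNIV (\<lambda>t::real. cos t *\<^sub>R a + sin t *\<^sub>R (b :: 'a::euclidean_space))"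
proof -
  have "Ck_on k UNIV (\<lambda>t::real. cos t *\<^sub>R a + sin t *\<^sub>R b)" for k and a b :: 'a
  proof (induction k arbitrary: a b)
    case 0 show ?case by (auto intro!: continuous_intros)
  next
    case (Suc k)
    show ?case
    proof (rule Ck_on_Suc[OF open_UNIV, where f' = "\<lambda>t s. cos t *\<^sub>R (s *\<^sub>R b) + sin t *\<^sub>R ((- s) *\<^sub>R a)"])
      show "((\<lambda>t. cos t *\<^sub>R a + sin t *\<^sub>R b) has_derivative (\<lambda>s. cos t *\<^sub>R (s *\<^sub>R b) + sin t *\<^sub>R ((- s) *\<^sub>R a))) (at t)" for t
        by (auto intro!: derivative_eq_intros simp: algebra_simps)
    qed (rule Suc.IH)
  qed
  then show ?thesis by (simp add: smooth_on_def)
qed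

lemma tangent_space_unit_sphere:
  assumes q: "q \<in> sphere 0 1"
  shows "tangent_space unit_sphere q = {v. v \<bullet> q = 0}"
proof (intro set_eqI iffI)
  fix v assume v: "v \<in> tangent_space unit_sphere q"
  have d: "(\<lambda>x. x \<bullet> x) differentiable (at q)" by (intro differentiable_inner differentiable_ident)
  have "D (\<lambda>x. x \<bullet> x) q v = D (\<lambda>x. 1) q v"
    by (rule sphere.D_eq_on_W[OF q v d differentiable_const]) (simp add: norm_eq_1)
  then show "v \<in> {v. v \<bullet> q = 0}"
    by (simp add: D_const D_inner differentiable_ident D_ident inner_commute)
next
  fix v assume "v \<in> {v. v \<bullet> q = 0}"
  then have v: "v \<bullet> q = 0" by simp
  have qq: "q \<bullet> q = 1" using q by (simp add: norm_eq_1)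
  show "v \<in> tangent_space unit_sphere q"
  proof (cases "v = 0")
    case True
    have "continuous_map (top_of_set {-1<..<1}) unit_sphere (\<lambda>t::real. q)"
      using q by simp
    then show ?thesis unfolding tangent_space_def True
      by (intro CollectI exI[of _ "\<lambda>t. q"] exI[of _ 1]) (auto intro: smooth_on_const derivative_intros)
  next
    case False
    define n where "n = norm v"
    have n: "n > 0" "v \<bullet> v = n * n" using False by (auto simp: n_def dot_square_norm power2_eq_square)
    \<comment> \<open>The great circle through \<open>q\<close> in the unit direction of
      \<open>v\<close>, run at speed \<open>n\<close>.\<close>
    define c where "c t = cos (n * t) *\<^sub>R q + sin (n * t) *\<^sub>R ((1/n) *\<^sub>R v)" for t
    have "smooth_on UNIV c" unfolding c_def
      by (rule smooth_on_comp[OF open_UNIV _ smooth_on_linear[OF bounded_linear_mult_right open_UNIV] smooth_on_circle, of n]) simp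
    then have sm: "smooth_on {-1<..<1} c" using smooth_on_subset by blast
    have "c t \<bullet> c t = 1" for t
    proof -
      have "c t \<bullet> c t = (cos (n * t))\<^sup>2 + (sin (n * t))\<^sup>2"
        using n by (simp add: c_def inner_add_left inner_add_right qq v inner_commute[of q v] power2_eq_square)
      then show ?thesis by simp
    qed
    then have "continuous_map (top_of_set {-1<..<1}) unit_sphere c"
      using smooth_on_imp_continuous[OF sm] by (auto simp: continuous_map_in_subtopology norm_eq_1)
    moreover have "c 0 = q" by (simp add: c_def)
    moreover have "(c has_vector_derivative v) (at 0)"
      unfolding has_vector_derivative_def c_def using n by (auto intro!: derivative_eq_intros)
    ultimately show ?thesis unfolding tangent_space_def using sm
      by (intro CollectI exI[of _ c] exI[of _ 1]) auto
  qed
qed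

lemma orth_proj_unit_sphere:
  assumes q: "q \<in> sphere 0 1"
  shows "orth_proj (tangent_space unit_sphere q) v = v - (v \<bullet> q) *\<^sub>R q"
  unfolding tangent_space_unit_sphere[OF q]
proof (rule orth_proj_eqI[OF subspace_orthogonal_vectors])
  show "v - (v \<bullet> q) *\<^sub>R q \<in> {v. v \<bullet> q = 0}" using q by (simp add: inner_diff_left norm_eq_1)
  show "(v - (v - (v \<bullet> q) *\<^sub>R q)) \<bullet> u = 0" if "u \<in> {v. v \<bullet> q = 0}" for u
    using that by (simp add: inner_commute[of q u])
qed

lemma differentiable_sphere_proj: "(\<lambda>q. v - (v \<bullet> q) *\<^sub>R q) differentiable (at q)"
  by (intro differentiable_diff differentiable_scaleR differentiable_inner differentiable_const differentiable_ident)

lemma D_sphere_proj: "D (\<lambda>q. v - (v \<bullet> q) *\<^sub>R q) q x = - ((v \<bullet> q) *\<^sub>R x) - (v \<bullet> x) *\<^sub>R q"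
  by (rule D_eq) (auto intro!: derivative_eq_intros simp: algebra_simps)

text \<open>The extended fields are explicit on the sphere, so a direct calculation suffices. At
  \<open>p\<close> only the derivative of the coefficient \<open>z \<bullet> q\<close>
  survives.\<close>

lemma curvature_tensor_unit_sphere:
  assumes p: "p \<in> sphere 0 1" and xyz: "x \<bullet> p = 0" "y \<bullet> p = 0" "z \<bullet> p = 0"
  shows "curvature_tensor unit_sphere p x y z = (z \<bullet> y) *\<^sub>R x - (z \<bullet> x) *\<^sub>R y"
proof -
  let ?N = "unit_sphere :: 'a topology"
  let ?E = "tangent_extension ?N"
  have ext: "?E v q = v - (v \<bullet> q) *\<^sub>R q" if "q \<in> sphere 0 1" for q v
    by (simp only: tangent_extension_def orth_proj_unit_sphere[OF that])
  have tan: "?E v q \<in> tangent_space ?N q" if "q \<in> sphere 0 1" for q v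
    using that by (simp add: ext tangent_space_unit_sphere inner_diff_left norm_eq_1)
  have pp: "p \<bullet> p = 1" using p by (simp add: norm_eq_1)
  have tp: "v \<in> tangent_space ?N p \<longleftrightarrow> v \<bullet> p = 0" for v by (simp add: tangent_space_unit_sphere[OF p])
  have dE: "differential ?N (?E v) q u = - ((v \<bullet> q) *\<^sub>R u) - (v \<bullet> u) *\<^sub>R q"
    if "q \<in> sphere 0 1" "u \<in> tangent_space ?N q" for q u v
    using sphere.differential_eq[OF that differentiable_sphere_proj ext] by (simp add: D_sphere_proj)
  have lc: "levi_civita ?N (?E v) (?E w) q = - ((w \<bullet> q) *\<^sub>R (v - (v \<bullet> q) *\<^sub>R q))" if q: "q \<in> sphere 0 1" for v w q
  proof -
    have "q \<bullet> q = 1" using q by (simp add: norm_eq_1)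
    then show ?thesis
      unfolding levi_civita_apply dE[OF q tan[OF q]] unfolding orth_proj_unit_sphere[OF q] ext[OF q]
      by (simp add: inner_diff_left inner_diff_right algebra_simps)
  qed
  have lc2: "levi_civita ?N (?E u) (levi_civita ?N (?E v) (?E z)) p = - ((z \<bullet> u) *\<^sub>R v)"
    if u: "u \<bullet> p = 0" and v: "v \<bullet> p = 0" for u v
  proof -
    have Eu: "?E u p = u" using u by (simp add: ext[OF p])
    have "(\<lambda>q. - ((z \<bullet> q) *\<^sub>R (v - (v \<bullet> q) *\<^sub>R q))) differentiable (at p)"
      by (intro differentiable_minus differentiable_scaleR differentiable_sphere_proj differentiable_inner differentiable_const differentiable_ident)
    then have "differential ?N (levi_civita ?N (?E v) (?E z)) p u = D (\<lambda>q. - ((z \<bullet> q) *\<^sub>R (v - (v \<bullet> q) *\<^sub>R q))) p u"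
      by (rule sphere.differential_eq[OF p tp[THEN iffD2, OF u] _ lc])
    also have "\<dots> = - ((z \<bullet> u) *\<^sub>R v)"
    proof (rule D_eq)
      have "((\<lambda>q. - ((z \<bullet> q) *\<^sub>R (v - (v \<bullet> q) *\<^sub>R q))) has_derivative
         (\<lambda>h. - ((z \<bullet> p) *\<^sub>R (- ((v \<bullet> p) *\<^sub>R h) - (v \<bullet> h) *\<^sub>R p) + (z \<bullet> h) *\<^sub>R (v - (v \<bullet> p) *\<^sub>R p)))) (at p)"
        by (auto intro!: derivative_eq_intros simp: algebra_simps)
      then show "((\<lambda>q. - ((z \<bullet> q) *\<^sub>R (v - (v \<bullet> q) *\<^sub>R q))) has_derivative (\<lambda>u. - ((z \<bullet> u) *\<^sub>R v))) (at p)"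
        by (simp add: v xyz)
    qed
    finally show ?thesis
      by (simp add: levi_civita_apply[of ?N "?E u"] Eu orth_proj_unit_sphere[OF p] v)
  qed
  have lb: "lie_bracket ?N (?E x) (?E y) p = 0"
    unfolding lie_bracket_def dE[OF p tan[OF p]]
    by (simp add: ext[OF p] xyz inner_commute[of x y])
  have three: "levi_civita ?N (lie_bracket ?N (?E x) (?E y)) (?E z) p = 0"
  proof -
    have "0 \<in> tangent_space ?N p" by (simp add: tp)
    from dE[OF p this, of z] show ?thesis
      unfolding levi_civita_apply lb orth_proj_unit_sphere[OF p] by simp
  qed
  show ?thesis
    unfolding curvature_tensor_def curvature_field_def three lc2[OF xyz(1,2)] lc2[OF xyz(2,1)] by simp
qed

subsection \<open>Submanifolds of the unit sphere\<close>

locale spherical_retraction = local_retraction +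
  assumes W_sphere: "q \<in> W \<Longrightarrow> q \<in> sphere 0 1" and m_pos: "0 < m"
begin

lemma q_q: "q \<in> W \<Longrightarrow> q \<bullet> q = 1"
  using W_sphere by (simp add: norm_eq_1)

lemma tangent_sphere:
  assumes "q \<in> W" "v \<in> tangent_space M q" shows "v \<bullet> q = 0"
proof -
  have d: "(\<lambda>x. x \<bullet> x) differentiable (at q)" by (intro differentiable_inner differentiable_ident)
  have "D (\<lambda>x. x \<bullet> x) q v = D (\<lambda>x. 1) q v"
    by (rule D_eq_on_W[OF assms d differentiable_const]) (rule q_q)
  then show ?thesis by (simp add: D_const D_inner differentiable_ident D_ident inner_commute)
qed

lemma P_self: "q \<in> W \<Longrightarrow> P q q = 0"
  unfolding P_eq_0_iff using tangent_sphere by (metis inner_commute)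

text \<open>The position vector is a normal field with shape operator minus the identity:
  differentiate \<open>P q q = 0\<close>.\<close>

lemma DP_self:
  assumes "q \<in> W" "x \<in> tangent_space M q" shows "DP q x q = - x"
proof -
  have "D (\<lambda>q. P q q) q x = D (\<lambda>q. 0) q x"
    by (rule D_eq_on_W[OF assms smooth_differentiable[OF smooth_P_app[OF smooth_on_ident[OF open_\<Omega>]] assms(1)]])
      (auto simp: P_self)
  then have "DP q x q + P q (D (\<lambda>q. q) q x) = 0"
    by (simp add: D_P_app[OF W_\<Omega>[OF assms(1)] smooth_on_ident[OF open_\<Omega>]] D_const)
  then show ?thesis using P_tangent[OF assms] by (simp add: D_ident eq_neg_iff_add_eq_0)
qed

lemma DP_inner_self: "q \<in> W \<Longrightarrow> x \<in> tangent_space M q \<Longrightarrow> DP q x y \<bullet> q = - (y \<bullet> x)"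
  by (simp add: DP_sym W_\<Omega> DP_self)

text \<open>The ambient second fundamental form has radial part
  \<open>- (x \<bullet> y) *\<^sub>R q\<close>, whose normalised trace is \<open>- q\<close>; adding
  \<open>q\<close> leaves the part tangent to the sphere.\<close>

definition H :: "'a \<Rightarrow> 'a" where
  "H q = (1 / real m) *\<^sub>R K q + q"

lemma smooth_H: "smooth_on \<Omega> H"
  unfolding H_def[abs_def] by (intro smooth_on_add smooth_on_scaleR smooth_on_const smooth_on_ident smooth_K open_\<Omega>)

lemma K_eq: "K q = real m *\<^sub>R (H q - q)"
  using m_pos by (simp add: H_def)

lemma H_inner_self: assumes q: "q \<in> W" shows "H q \<bullet> q = 0"
proof -
  have "K q \<bullet> q = (\<Sum>e\<in>tangent_frame M q. - 1)"
    unfolding K_trace[OF q] inner_sum_left using q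
    by (intro sum.cong refl) (simp add: DP_inner_self tangent_frame_in tangent_frame_norm)
  then have "K q \<bullet> q = - real m" by (simp add: card_tangent_frame[OF q])
  then show ?thesis using m_pos by (simp add: H_def inner_add_left q_q[OF q])
qed

lemma P_H: assumes q: "q \<in> W" shows "P q (H q) = 0"
proof -
  have "P q (K q) = (\<Sum>e\<in>tangent_frame M q. P q (DP q e e))"
    unfolding K_trace[OF q] by (rule linear_sum[OF linear_P[OF W_\<Omega>[OF q]]])
  also have "\<dots> = 0" using q by (intro sum.neutral ballI P_DP_tangent tangent_frame_in)
  finally show ?thesis unfolding H_def
    by (simp add: linear_add[OF linear_P[OF W_\<Omega>[OF q]]] linear_cmul[OF linear_P[OF W_\<Omega>[OF q]]] P_self q)
qed

lemma H_tangent: "q \<in> W \<Longrightarrow> v \<in> tangent_space M q \<Longrightarrow> H q \<bullet> v = 0"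
  using P_H P_inner by (metis inner_zero_left)

lemma D_H_inner_self:
  assumes "q \<in> W" "v \<in> tangent_space M q" shows "D H q v \<bullet> q = 0"
proof -
  have "D (\<lambda>q. H q \<bullet> q) q v = D (\<lambda>q. 0) q v"
    by (rule D_eq_on_W[OF assms smooth_differentiable[OF smooth_on_inner[OF open_\<Omega> smooth_H smooth_on_ident[OF open_\<Omega>]] assms(1)]])
      (auto simp: H_inner_self)
  then show ?thesis
    by (simp add: D_inner smooth_differentiable[OF smooth_H assms(1)] differentiable_ident D_ident D_const H_tangent assms)
qed

lemma pullback_connection_unit_sphere:
  assumes "q \<in> W"
  shows "pullback_connection M unit_sphere (\<lambda>x. x) X V q
    = differential M V q (X q) - (differential M V q (X q) \<bullet> q) *\<^sub>R q"
  unfolding pullback_connection_def orth_proj_unit_sphere[OF W_sphere[OF assms]] ..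

lemma differential_extension:
  "q \<in> W \<Longrightarrow> v \<in> tangent_space M q \<Longrightarrow> differential M (tangent_extension M y) q v = DP q v y"
  unfolding DP_def by (rule differential_eq) (auto simp: tangent_extension_eq smooth_differentiable[OF smooth_P])

text \<open>The extended fields are parallel at the base point, which removes the correction terms
  of the Hessian and of the second covariant derivative.\<close>

lemma levi_civita_extension_tangent:
  "q \<in> W \<Longrightarrow> y \<in> tangent_space M q \<Longrightarrow> z \<in> tangent_space M q \<Longrightarrow>
    levi_civita M (tangent_extension M y) (tangent_extension M z) q = 0"
  by (simp add: levi_civita_extension P_tangent P_DP_tangent)

lemma second_fundamental_form_eq:
  assumes q: "q \<in> W" and xy: "x \<in> tangent_space M q" "y \<in> tangent_space M q"
  shows "second_fundamental_form M unit_sphere q x y = DP q x y + (y \<bullet> x) *\<^sub>R q"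
  unfolding second_fundamental_form_def Let_def pullback_connection_unit_sphere[OF q]
  by (simp add: tangent_extension_eq q P_tangent xy differential_extension levi_civita_extension_tangent DP_inner_self)

lemma mean_curvature_vector_eq:
  assumes q: "q \<in> W" shows "mean_curvature_vector m M unit_sphere q = H q"
proof -
  have "tangent_trace M q (second_fundamental_form M unit_sphere q) = (\<Sum>e\<in>tangent_frame M q. DP q e e + q)"
    unfolding tangent_trace_eq using q
    by (intro sum.cong refl) (simp add: second_fundamental_form_eq tangent_frame_in tangent_frame_norm)
  also have "\<dots> = K q + real m *\<^sub>R q"
    by (simp add: sum.distrib K_trace q card_tangent_frame sum_constant_scaleR)
  finally show ?thesis using m_pos by (simp add: mean_curvature_vector_def H_def scaleR_add_right)
qed

lemma tension_field_eq:
  assumes q: "q \<in> W" shows "tension_field M unit_sphere (\<lambda>x. x) q = real m *\<^sub>R H q"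
proof -
  have id: "differential M (\<lambda>x. x) q v = v" if "q \<in> W" "v \<in> tangent_space M q" for q v
    using differential_eq[OF that differentiable_ident refl] by (simp add: D_ident)
  have "hessian_map M unit_sphere (\<lambda>x. x) q e e = second_fundamental_form M unit_sphere q e e"
    if e: "e \<in> tangent_space M q" for e
  proof -
    have "differential M (\<lambda>x. differential M (\<lambda>x. x) x (tangent_extension M e x)) q e = DP q e e"
      unfolding DP_def by (rule differential_eq[OF q e smooth_differentiable[OF smooth_P q]])
        (simp add: id tangent_extension_eq P_in)
    then show ?thesis
      unfolding hessian_map_def second_fundamental_form_def Let_def pullback_connection_unit_sphere[OF q]
      by (simp add: tangent_extension_eq q P_tangent e differential_extension levi_civita_extension_tangent id zero_tangent)
  qed
  then have "tension_field M unit_sphere (\<lambda>x. x) q = tangent_trace M q (second_fundamental_form M unit_sphere q)"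
    unfolding tension_field_def tangent_trace_eq using tangent_frame_in[OF q] by (intro sum.cong refl) auto
  also have "\<dots> = real m *\<^sub>R mean_curvature_vector m M unit_sphere q"
    using m_pos by (simp add: mean_curvature_vector_def)
  finally show ?thesis by (simp add: mean_curvature_vector_eq[OF q])
qed

lemma shape_operator_eq:
  assumes q: "q \<in> W" "x \<in> tangent_space M q"
  shows "shape_operator M unit_sphere (mean_curvature_vector m M unit_sphere) q x = - P q (D H q x)"
proof -
  have "differential M (mean_curvature_vector m M unit_sphere) q x = D H q x"
    by (rule differential_eq[OF q smooth_differentiable[OF smooth_H q(1)]]) (rule mean_curvature_vector_eq)
  then show ?thesis
    unfolding shape_operator_def pullback_connection_unit_sphere[OF q(1)]
    by (simp add: tangent_extension_eq q P_tangent P_W[symmetric] linear_diff[OF linear_P[OF W_\<Omega>]]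
       linear_cmul[OF linear_P[OF W_\<Omega>]] P_self)
qed

text \<open>Testing against \<open>w\<close> orthogonal to \<open>p\<close> hides the outer
  projection onto the sphere, and \<open>D_H_inner_self\<close> makes the inner one trivial, so the
  rough Laplacian becomes an ambient one.\<close>

lemma bitension_field_eq:
  assumes p: "p \<in> W" and w: "w \<bullet> p = 0"
  shows "bitension_field M unit_sphere (\<lambda>x. x) p \<bullet> w
    = real m * ((\<Sum>e\<in>tangent_frame M p. D (\<lambda>q. D H q (P q e)) p e \<bullet> w) + real m * (H p \<bullet> w))"
proof -
  let ?B = "tangent_frame M p"
  let ?t = "tension_field M unit_sphere (\<lambda>x. x)"
  have dmH: "(\<lambda>q. real m *\<^sub>R H q) differentiable (at q)" if "q \<in> W" for q
    by (rule smooth_differentiable[OF smooth_on_scaleR[OF open_\<Omega> smooth_on_const smooth_H] that])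
  have dt: "differential M ?t q v = real m *\<^sub>R D H q v" if "q \<in> W" "v \<in> tangent_space M q" for q v
    using differential_eq[OF that dmH[OF that(1)] tension_field_eq]
    by (simp add: D_scaleR_const smooth_differentiable[OF smooth_H that(1)])
  have scd: "second_covariant_derivative M unit_sphere (\<lambda>x. x) ?t p e e \<bullet> w
      = real m * (D (\<lambda>q. D H q (P q e)) p e \<bullet> w)" if e: "e \<in> ?B" for e
  proof -
    have eT: "e \<in> tangent_space M p" using tangent_frame_in[OF p e] .
    have smDH: "smooth_on \<Omega> (\<lambda>q. D H q (P q e))" by (rule smooth_on_D[OF open_\<Omega> smooth_H smooth_P])
    have "pullback_connection M unit_sphere (\<lambda>x. x) (tangent_extension M e) ?t q = real m *\<^sub>R D H q (P q e)"
      if q: "q \<in> W" for q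
      unfolding pullback_connection_unit_sphere[OF q] tangent_extension_eq[OF q] dt[OF q P_in[OF q]]
      by (simp add: D_H_inner_self q P_in)
    then have "differential M (pullback_connection M unit_sphere (\<lambda>x. x) (tangent_extension M e) ?t) p e
       = D (\<lambda>q. real m *\<^sub>R D H q (P q e)) p e"
      by (intro differential_eq[OF p eT] smooth_differentiable[OF _ p] smooth_on_scaleR open_\<Omega> smooth_on_const smDH)
    also have "\<dots> = real m *\<^sub>R D (\<lambda>q. D H q (P q e)) p e"
      by (rule D_scaleR_const[OF smooth_differentiable[OF smDH p]])
    finally have "pullback_connection M unit_sphere (\<lambda>x. x) (tangent_extension M e)
        (pullback_connection M unit_sphere (\<lambda>x. x) (tangent_extension M e) ?t) p \<bullet> w
      = real m * (D (\<lambda>q. D H q (P q e)) p e \<bullet> w)"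
      unfolding pullback_connection_unit_sphere[OF p, of "tangent_extension M e" "pullback_connection _ _ _ _ _"]
        tangent_extension_eq[OF p] P_tangent[OF p eT]
      using w by (simp add: inner_diff_left inner_commute[of p w])
    moreover have "pullback_connection M unit_sphere (\<lambda>x. x) (levi_civita M (tangent_extension M e) (tangent_extension M e)) ?t p = 0"
      unfolding pullback_connection_unit_sphere[OF p] levi_civita_extension_tangent[OF p eT eT] dt[OF p zero_tangent[OF p]]
      by (simp add: linear_0[OF linear_D[OF smooth_differentiable[OF smooth_H p]]])
    ultimately show ?thesis unfolding second_covariant_derivative_def Let_def by (simp add: inner_diff_left)
  qed
  \<comment> \<open>With curvature 1, a unit vector \<open>e\<close> and a vector \<open>V\<close>
    orthogonal to it satisfy \<open>R(e,V)e = - V\<close>. The \<open>m\<close> equal terms produce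
    the second factor \<open>m\<close> in front of \<open>H p\<close>.\<close>
  have curv: "curvature_tensor unit_sphere p (differential M (\<lambda>x. x) p e) (?t p) (differential M (\<lambda>x. x) p e)
     = - (real m *\<^sub>R H p)" if e: "e \<in> ?B" for e
  proof -
    have eT: "e \<in> tangent_space M p" using tangent_frame_in[OF p e] .
    have "differential M (\<lambda>x. x) p e = e"
      using differential_eq[OF p eT differentiable_ident refl] by (simp add: D_ident)
    then show ?thesis
      using curvature_tensor_unit_sphere[OF W_sphere[OF p], of e "real m *\<^sub>R H p" e] tangent_sphere[OF p eT]
        H_inner_self[OF p] H_tangent[OF p eT] tangent_frame_norm[OF p e]
      by (simp add: tension_field_eq[OF p] inner_commute)
  qed
  have "tangent_trace M p (\<lambda>x y. curvature_tensor unit_sphere p (differential M (\<lambda>x. x) p x) (?t p) (differential M (\<lambda>x. x) p y))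
     = (\<Sum>e\<in>?B. - (real m *\<^sub>R H p))"
    unfolding tangent_trace_eq by (intro sum.cong refl curv)
  also have "\<dots> = - (real m *\<^sub>R (real m *\<^sub>R H p))"
    by (simp add: sum_negf sum_constant_scaleR card_tangent_frame[OF p])
  finally have tr: "tangent_trace M p (\<lambda>x y. curvature_tensor unit_sphere p (differential M (\<lambda>x. x) p x) (?t p) (differential M (\<lambda>x. x) p y)) \<bullet> w
      = - (real m * (real m * (H p \<bullet> w)))" by simp
  have "- rough_laplacian M unit_sphere (\<lambda>x. x) ?t p \<bullet> w = (\<Sum>e\<in>?B. real m * (D (\<lambda>q. D H q (P q e)) p e \<bullet> w))"
    unfolding rough_laplacian_def tangent_trace_eq by (simp add: inner_sum_left scd)
  then show ?thesis
    unfolding bitension_field_def inner_diff_left tr by (simp add: sum_distrib_left distrib_left)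
qed

end

subsection \<open>Biharmonic pseudo-umbilical submanifolds\<close>

text \<open>The hypotheses on \<open>M\<close> in ambient form: the sign in
  \<open>pseudo_umbilic\<close> is that of the Weingarten formula, and \<open>laplacian_H\<close> is
  the vanishing of the bitension field divided by \<open>m\<close>.\<close>

locale biharmonic_pseudo_umbilical = spherical_retraction +
  fixes \<mu> :: "'a \<Rightarrow> real"
  assumes pseudo_umbilic: "q \<in> W \<Longrightarrow> x \<in> tangent_space M q \<Longrightarrow> P q (D H q x) = - (\<mu> q *\<^sub>R x)"
    and laplacian_H: "p \<in> W \<Longrightarrow> w \<bullet> p = 0 \<Longrightarrow>
      (\<Sum>e\<in>tangent_frame M p. D (\<lambda>q. D H q (P q e)) p e \<bullet> w) = - (real m * (H p \<bullet> w))"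
begin

definition lam :: "'a \<Rightarrow> real" where
  "lam q = H q \<bullet> H q"

lemma smooth_lam: "smooth_on \<Omega> lam"
  unfolding lam_def[abs_def] by (intro smooth_on_inner open_\<Omega> smooth_H)

lemma D_lam: "q \<in> \<Omega> \<Longrightarrow> D lam q v = 2 * (H q \<bullet> D H q v)"
  unfolding lam_def[abs_def] by (simp add: D_inner smooth_onD[OF smooth_H] inner_commute)

text \<open>Differentiate \<open>H q \<bullet> P q y = 0\<close> along \<open>x\<close>.\<close>

lemma H_DP:
  assumes q: "q \<in> W" and xy: "x \<in> tangent_space M q" "y \<in> tangent_space M q"
  shows "H q \<bullet> DP q x y = \<mu> q * (x \<bullet> y)"
proof -
  note dH = smooth_differentiable[OF smooth_H q] and dP = smooth_differentiable[OF smooth_P[of y] q]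
  have "D (\<lambda>q. H q \<bullet> P q y) q x = D (\<lambda>q. 0) q x"
    by (rule D_eq_on_W[OF q xy(1) differentiable_inner[OF dH dP]]) (simp_all add: H_tangent P_in)
  then have "D H q x \<bullet> y + H q \<bullet> DP q x y = 0"
    by (simp add: D_inner dH dP D_const P_tangent q xy DP_def)
  moreover have "D H q x \<bullet> y = - (\<mu> q * (x \<bullet> y))"
    using P_inner[OF q xy(2), of "D H q x"] pseudo_umbilic[OF q xy(1)] by simp
  ultimately show ?thesis by simp
qed

text \<open>Trace \<open>H_DP\<close>: the left side becomes \<open>H q \<bullet> K q\<close>, which
  is \<open>m\<close> times |H|^2 because \<open>H q\<close> is orthogonal to
  \<open>q\<close>.\<close>

lemma mu_eq: assumes q: "q \<in> W" shows "\<mu> q = lam q"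
proof -
  have "(\<Sum>e\<in>tangent_frame M q. H q \<bullet> DP q e e) = (\<Sum>e\<in>tangent_frame M q. \<mu> q)"
    using q by (intro sum.cong refl) (simp add: H_DP tangent_frame_in tangent_frame_norm)
  then have "H q \<bullet> K q = real m * \<mu> q"
    by (simp add: K_trace[OF q] inner_sum_right card_tangent_frame[OF q])
  then have "real m * lam q = real m * \<mu> q"
    by (simp add: K_eq inner_diff_right H_inner_self[OF q] lam_def)
  then show ?thesis using m_pos by simp
qed

lemma P_D_H: "q \<in> W \<Longrightarrow> x \<in> tangent_space M q \<Longrightarrow> P q (D H q x) = - (lam q *\<^sub>R x)"
  using pseudo_umbilic mu_eq by simp

lemma H_DP': "q \<in> W \<Longrightarrow> x \<in> tangent_space M q \<Longrightarrow> y \<in> tangent_space M q \<Longrightarrow> H q \<bullet> DP q x y = lam q * (x \<bullet> y)"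
  using H_DP mu_eq by simp

lemma sum_D_lam:
  assumes p: "p \<in> W" and z: "z \<in> tangent_space M p"
  shows "(\<Sum>e\<in>tangent_frame M p. D lam p e * (e \<bullet> z)) = D lam p z"
  using tangent_frame_expand[OF p z linear_D[OF smooth_differentiable[OF smooth_lam p]]]
  by (simp add: inner_commute mult.commute)

text \<open>The tangential part of the bitension field.\<close>

lemma sum_D_H_DP:
  assumes p: "p \<in> W" and z: "z \<in> tangent_space M p"
  shows "(\<Sum>e\<in>tangent_frame M p. D H p e \<bullet> DP p e z) = - D lam p z"
proof -
  note p\<Omega> = W_\<Omega>[OF p]
  have "D H p e \<bullet> DP p e z + D (\<lambda>q. D H q (P q e)) p e \<bullet> z = - (D lam p e * (e \<bullet> z))"
    if e: "e \<in> tangent_frame M p" for e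
  proof -
    have eT: "e \<in> tangent_space M p" using tangent_frame_in[OF p e] .
    have sm: "smooth_on \<Omega> (\<lambda>q. D H q (P q e))" by (rule smooth_on_D[OF open_\<Omega> smooth_H smooth_P])
    have sm': "smooth_on \<Omega> (\<lambda>q. lam q *\<^sub>R P q e)" by (rule smooth_on_scaleR[OF open_\<Omega> smooth_lam smooth_P])
    \<comment> \<open>Pseudo-umbilicity, differentiated along \<open>e\<close>. Paired with
      \<open>z\<close>, the derivative of the outer \<open>P\<close> contributes the wanted term,
      and the remaining second derivatives sum to the Laplacian.\<close>
    have "D (\<lambda>q. P q (D H q (P q e))) p e = D (\<lambda>q. - (lam q *\<^sub>R P q e)) p e"
      by (rule D_eq_on_W[OF p eT])
        (auto intro!: smooth_differentiable[OF _ p] smooth_P_app sm smooth_on_minus sm' open_\<Omega> simp: P_D_H P_in)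
    also have "\<dots> = - D (\<lambda>q. lam q *\<^sub>R P q e) p e"
      using D_scaleR_const[OF smooth_differentiable[OF sm' p], of "- 1" e] by simp
    also have "\<dots> = - (lam p *\<^sub>R DP p e e + D lam p e *\<^sub>R e)"
      by (simp add: D_scaleR smooth_differentiable[OF _ p] smooth_lam smooth_P DP_def P_tangent[OF p eT])
    finally have "DP p e (D H p e) + P p (D (\<lambda>q. D H q (P q e)) p e) = - (lam p *\<^sub>R DP p e e + D lam p e *\<^sub>R e)"
      by (simp add: D_P_app[OF p\<Omega> sm] P_tangent[OF p eT])
    then have "(DP p e (D H p e) + P p (D (\<lambda>q. D H q (P q e)) p e)) \<bullet> z = - (lam p *\<^sub>R DP p e e + D lam p e *\<^sub>R e) \<bullet> z"
      by simp
    moreover have "DP p e e \<bullet> z = 0" by (rule DP_tangent_inner[OF p eT z])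
    moreover have "DP p e (D H p e) \<bullet> z = D H p e \<bullet> DP p e z" by (rule DP_sym[OF p\<Omega>])
    ultimately show ?thesis
      by (simp add: inner_add_left inner_diff_left P_inner[OF p z])
  qed
  then have "(\<Sum>e\<in>tangent_frame M p. D H p e \<bullet> DP p e z) + (\<Sum>e\<in>tangent_frame M p. D (\<lambda>q. D H q (P q e)) p e \<bullet> z)
     = - (\<Sum>e\<in>tangent_frame M p. D lam p e * (e \<bullet> z))"
    by (simp add: sum.distrib[symmetric] sum_negf[symmetric])
  moreover have "z \<bullet> p = 0" using tangent_sphere[OF p z] .
  ultimately show ?thesis
    using laplacian_H[OF p, of z] sum_D_lam[OF p z] H_tangent[OF p z] by simp
qed

text \<open>Codazzi equation, paired with \<open>H\<close>: \<open>D\<^sub>e (II (e, z))\<close> and \<open>D\<^sub>z (II (e, e))\<close> agree up to tangential terms.\<close>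

lemma codazzi_H:
  assumes p: "p \<in> W" and z: "z \<in> tangent_space M p" and eT: "e \<in> tangent_space M p"
  shows "H p \<bullet> D (\<lambda>q. DP q (P q e) (P q z)) p e = H p \<bullet> D (\<lambda>q. DP q (P q e) e) p z"
proof -
  note p\<Omega> = W_\<Omega>[OF p]
  \<comment> \<open>Symmetry of \<open>DP\<close> is known only on \<open>W\<close> and for tangent
    arguments, hence the projections inside.\<close>
  have "D (\<lambda>q. DP q (P q e) (P q z)) p e = D (\<lambda>q. DP q (P q z) (P q e)) p e"
    by (rule D_eq_on_W[OF p eT])
      (auto intro!: smooth_differentiable[OF _ p] smooth_DP smooth_P DP_commute P_in)
  \<comment> \<open>Freezing the last argument costs \<open>DP p z\<close> of the normal vector
    \<open>DP p e e\<close>; this is tangent and disappears against \<open>H p\<close>.\<close>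
  also have "\<dots> = D (\<lambda>q. DP q (P q z) e) p e + DP p z (DP p e e)"
  proof -
    have "D (\<lambda>q. DP q (P q z) (P q e)) p e = D (\<lambda>q. DP q (P q z) (P p e)) p e + DP p (P p z) (D (\<lambda>q. P q e) p e)"
      by (rule D_linear_family[OF open_\<Omega> p\<Omega> linear_DP smooth_DP[OF smooth_P smooth_on_const] smooth_P])
    then show ?thesis by (simp add: P_tangent[OF p] z eT DP_def)
  qed
  also have "D (\<lambda>q. DP q (P q z) e) p e = D (\<lambda>q. DP q (P q e) e) p z"
    using D_commutator[OF open_\<Omega> p\<Omega> smooth_P[of e] smooth_P[of e] smooth_P[of z]] DP_commute[OF p z eT]
      linear_0[OF linear_DP_dir[OF p\<Omega>, of e]]
    by (simp add: P_tangent p z eT DP_def)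
  finally show ?thesis
    using DP_normal_inner[OF p P_DP_tangent[OF p eT] P_H[OF p]] by (simp add: inner_add_right)
qed

text \<open>The basis of constant vectors that defines \<open>K\<close> may be adapted to the tangent space at \<open>p\<close>;
  its normal members contribute only tangential terms to \<open>D\<^sub>z K\<close>.\<close>

lemma H_D_K:
  assumes p: "p \<in> W" and z: "z \<in> tangent_space M p"
  shows "H p \<bullet> D K p z = (\<Sum>e\<in>tangent_frame M p. H p \<bullet> D (\<lambda>q. DP q (P q e) e) p z)"
proof -
  note p\<Omega> = W_\<Omega>[OF p]
  define b where "b u v = H p \<bullet> D (\<lambda>q. DP q (P q u) v) p z" for u v
  have sm: "smooth_on \<Omega> (\<lambda>q. DP q (P q u) v)" for u v by (intro smooth_DP smooth_P smooth_on_const)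
  note d = smooth_differentiable[OF sm p]
  have lb1: "linear (\<lambda>u. b u v)" for v
  proof (rule linearI)
    show "b (u + u') v = b u v + b u' v" for u u'
    proof -
      have "D (\<lambda>q. DP q (P q (u + u')) v) p z = D (\<lambda>q. DP q (P q u) v + DP q (P q u') v) p z"
        by (rule D_cong_open(1)[OF open_\<Omega> p\<Omega>])
          (simp_all add: linear_add[OF linear_P] linear_add[OF linear_DP_dir] d)
      then show ?thesis by (simp add: b_def D_add d inner_add_right)
    qed
    show "b (c *\<^sub>R u) v = c *\<^sub>R b u v" for c u
    proof -
      have "D (\<lambda>q. DP q (P q (c *\<^sub>R u)) v) p z = D (\<lambda>q. c *\<^sub>R DP q (P q u) v) p z"
        by (rule D_cong_open(1)[OF open_\<Omega> p\<Omega>])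
          (simp_all add: linear_cmul[OF linear_P] linear_cmul[OF linear_DP_dir] d)
      then show ?thesis by (simp add: b_def D_scaleR_const d)
    qed
  qed
  have lb2: "linear (b u)" for u
  proof (rule linearI)
    show "b u (v + v') = b u v + b u v'" for v v'
    proof -
      have "D (\<lambda>q. DP q (P q u) (v + v')) p z = D (\<lambda>q. DP q (P q u) v + DP q (P q u) v') p z"
        by (rule D_cong_open(1)[OF open_\<Omega> p\<Omega>]) (simp_all add: linear_add[OF linear_DP] d)
      then show ?thesis by (simp add: b_def D_add d inner_add_right)
    qed
    show "b u (c *\<^sub>R v) = c *\<^sub>R b u v" for c v
    proof -
      have "D (\<lambda>q. DP q (P q u) (c *\<^sub>R v)) p z = D (\<lambda>q. c *\<^sub>R DP q (P q u) v) p z"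
        by (rule D_cong_open(1)[OF open_\<Omega> p\<Omega>]) (simp_all add: linear_cmul[OF linear_DP] d)
      then show ?thesis by (simp add: b_def D_scaleR_const d)
    qed
  qed
  let ?N = "{v. \<forall>u\<in>tangent_space M p. v \<bullet> u = 0}"
  have sN: "subspace ?N" unfolding subspace_def by (auto simp: inner_add_left)
  obtain C where C: "orthonormal_basis ?N C" using ex_orthonormal_basis[OF sN] by blast
  note U = orthonormal_basis_Un[OF subspace_tangent[OF p] tangent_frame[OF p] C]
  have "b e e = 0" if "e \<in> C" for e
  proof -
    have Pe: "P p e = 0" using that C P_eq_0_iff[OF p] unfolding orthonormal_basis_def by blast
    have "D (\<lambda>q. DP q (P q e) e) p z = D (\<lambda>q. DP q (P p e) e) p z + DP p (D (\<lambda>q. P q e) p z) e"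
    proof (rule D_linear_family[OF open_\<Omega> p\<Omega> linear_DP_dir _ smooth_P])
      show "smooth_on \<Omega> (\<lambda>q. DP q v e)" for v by (rule smooth_DP[OF smooth_on_const smooth_on_const])
    qed
    also have "D (\<lambda>q. DP q (P p e) e) p z = D (\<lambda>q. 0) p z"
      unfolding Pe by (rule D_cong_open(1)[OF open_\<Omega> p\<Omega>]) (simp_all add: linear_0[OF linear_DP_dir])
    finally show ?thesis
      using DP_normal_inner[OF p Pe P_H[OF p]] by (simp add: b_def D_const)
  qed
  moreover have "H p \<bullet> D K p z = (\<Sum>i\<in>Basis. b i i)"
    unfolding K_def[abs_def] b_def by (simp add: D_sum d inner_sum_right)
  moreover have "(\<Sum>i\<in>Basis. b i i) = (\<Sum>e\<in>tangent_frame M p \<union> C. b e e)"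
    by (rule orthonormal_basis_trace[OF orthonormal_basis_Basis U(1) lb1 lb2])
  moreover have "\<dots> = (\<Sum>e\<in>tangent_frame M p. b e e) + (\<Sum>e\<in>C. b e e)"
    by (rule sum.union_disjoint[OF orthonormal_basis_finite[OF tangent_frame[OF p]] orthonormal_basis_finite[OF C] U(2)])
  ultimately show ?thesis by (simp add: b_def)
qed

text \<open>Differentiating \<open>H \<bullet> DP e z = lam * (e \<bullet> z)\<close> along
  \<open>e\<close> and summing over the frame gives three multiples of \<open>D lam p z\<close>:
  minus 1 from the bitension equation, \<open>m / 2\<close> from Codazzi and the trace
  \<open>K\<close>, and 1 on the right.\<close>

lemma D_lam_tangent:
  assumes p: "p \<in> W" and z: "z \<in> tangent_space M p" and m4: "m \<noteq> 4"
  shows "D lam p z = 0"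
proof -
  note p\<Omega> = W_\<Omega>[OF p]
  have codazzi: "D H p e \<bullet> DP p e z + H p \<bullet> D (\<lambda>q. DP q (P q e) e) p z = D lam p e * (e \<bullet> z)"
    if e: "e \<in> tangent_frame M p" for e
  proof -
    have eT: "e \<in> tangent_space M p" using tangent_frame_in[OF p e] .
    note dP = smooth_differentiable[OF smooth_P p]
    have dPP: "(\<lambda>q. P q e \<bullet> P q z) differentiable (at p)" by (intro differentiable_inner dP)
    have smG: "smooth_on \<Omega> (\<lambda>q. DP q (P q e) (P q z))" by (intro smooth_DP smooth_P)
    note dH = smooth_differentiable[OF smooth_H p] and dG = smooth_differentiable[OF smG p]
      and dl = smooth_differentiable[OF smooth_lam p]
    have "D (\<lambda>q. H q \<bullet> DP q (P q e) (P q z)) p e = D (\<lambda>q. lam q *\<^sub>R (P q e \<bullet> P q z)) p e"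
      by (rule D_eq_on_W[OF p eT differentiable_inner[OF dH dG] differentiable_scaleR[OF dl dPP]])
        (simp add: H_DP' P_in)
    then have "D H p e \<bullet> DP p e z + H p \<bullet> D (\<lambda>q. DP q (P q e) (P q z)) p e
       = lam p * (DP p e e \<bullet> z + e \<bullet> DP p e z) + D lam p e * (e \<bullet> z)"
      unfolding D_inner[OF dH dG] D_scaleR[OF dl dPP] D_inner[OF dP dP] DP_def[symmetric]
      by (simp add: P_tangent[OF p] eT z)
    moreover have "DP p e e \<bullet> z = 0" "e \<bullet> DP p e z = 0"
      using DP_tangent_inner[OF p] eT z by (simp_all add: inner_commute)
    ultimately show ?thesis by (simp add: codazzi_H[OF p z eT])
  qed
  have DK: "D K p z = real m *\<^sub>R (D H p z - z)"
    unfolding K_eq[abs_def]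
    by (simp add: D_scaleR_const D_diff D_ident smooth_differentiable[OF smooth_H p] differentiable_ident differentiable_diff)
  have "(\<Sum>e\<in>tangent_frame M p. D H p e \<bullet> DP p e z) + (\<Sum>e\<in>tangent_frame M p. H p \<bullet> D (\<lambda>q. DP q (P q e) e) p z)
      = (\<Sum>e\<in>tangent_frame M p. D lam p e * (e \<bullet> z))"
    unfolding sum.distrib[symmetric] by (intro sum.cong refl codazzi)
  then have "- D lam p z + H p \<bullet> D K p z = D lam p z"
    unfolding sum_D_H_DP[OF p z] sum_D_lam[OF p z] H_D_K[OF p z] .
  \<comment> \<open>\<open>K\<close> is \<open>m\<close> times \<open>H - p\<close>,
    \<open>H p\<close> is orthogonal to \<open>z\<close>, and \<open>H p \<bullet> D H p z\<close>
    is half the derivative of |H|^2.\<close>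
  moreover have "H p \<bullet> D K p z = real m / 2 * D lam p z"
    by (simp add: DK inner_diff_right H_tangent[OF p z] D_lam[OF p\<Omega>])
  ultimately have "(real m - 4) * D lam p z = 0" by (simp add: algebra_simps)
  then show ?thesis using m4 by simp
qed

context
  assumes m4: "m \<noteq> 4"
begin

text \<open>A Bochner formula: as |H|^2 has zero derivative along \<open>W\<close>, so has
  \<open>H \<bullet> D H e\<close>, and differentiating once more turns the Laplacian of
  \<open>H\<close> into the sum of squares.\<close>

lemma sum_norm_D_H:
  assumes p: "p \<in> W"
  shows "(\<Sum>e\<in>tangent_frame M p. D H p e \<bullet> D H p e) = real m * lam p"
proof -
  note p\<Omega> = W_\<Omega>[OF p]
  have "D H p e \<bullet> D H p e + D (\<lambda>q. D H q (P q e)) p e \<bullet> H p = 0" if e: "e \<in> tangent_frame M p" for e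
  proof -
    have eT: "e \<in> tangent_space M p" using tangent_frame_in[OF p e] .
    have sm: "smooth_on \<Omega> (\<lambda>q. D H q (P q e))" by (rule smooth_on_D[OF open_\<Omega> smooth_H smooth_P])
    note dH = smooth_differentiable[OF smooth_H p] and d2 = smooth_differentiable[OF sm p]
    have "D (\<lambda>q. H q \<bullet> D H q (P q e)) p e = D (\<lambda>q. 0) p e"
    proof (rule D_eq_on_W[OF p eT differentiable_inner[OF dH d2]])
      show "H x \<bullet> D H x (P x e) = 0" if x: "x \<in> W" for x
        using D_lam[OF W_\<Omega>[OF x], of "P x e"] D_lam_tangent[OF x P_in[OF x] m4] by simp
    qed simp
    then show ?thesis by (simp add: D_inner dH d2 D_const P_tangent[OF p eT] inner_commute)
  qed
  then have "(\<Sum>e\<in>tangent_frame M p. D H p e \<bullet> D H p e) + (\<Sum>e\<in>tangent_frame M p. D (\<lambda>q. D H q (P q e)) p e \<bullet> H p) = 0"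
    unfolding sum.distrib[symmetric] by (intro sum.neutral ballI)
  then show ?thesis using laplacian_H[OF p, of "H p"] H_inner_self[OF p] by (simp add: lam_def)
qed

text \<open>Pythagoras: \<open>- lam p *\<^sub>R e\<close> is the tangential part of
  \<open>D H p e\<close>, and the vector on the right is its normal part.\<close>

lemma norm_D_H:
  assumes p: "p \<in> W" and eT: "e \<in> tangent_space M p" and e1: "e \<bullet> e = 1"
  shows "D H p e \<bullet> D H p e = (lam p)\<^sup>2 + (D H p e + lam p *\<^sub>R e) \<bullet> (D H p e + lam p *\<^sub>R e)"
proof -
  have "D H p e \<bullet> e = P p (D H p e) \<bullet> e" using P_inner[OF p eT] by simp
  also have "\<dots> = - lam p" by (simp add: P_D_H[OF p eT] e1)
  finally show ?thesis
    by (simp add: inner_add_left inner_add_right inner_commute[of e "D H p e"] e1 power2_eq_square algebra_simps)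
qed

lemma sum_norm_normal_D_H:
  assumes p: "p \<in> W"
  shows "(\<Sum>e\<in>tangent_frame M p. (D H p e + lam p *\<^sub>R e) \<bullet> (D H p e + lam p *\<^sub>R e)) = real m * (lam p * (1 - lam p))"
proof -
  have "real m * lam p = (\<Sum>e\<in>tangent_frame M p. (lam p)\<^sup>2 + (D H p e + lam p *\<^sub>R e) \<bullet> (D H p e + lam p *\<^sub>R e))"
    unfolding sum_norm_D_H[OF p, symmetric]
    by (intro sum.cong refl norm_D_H[OF p]) (simp_all add: tangent_frame_in[OF p] tangent_frame_norm[OF p])
  then show ?thesis
    by (simp add: sum.distrib card_tangent_frame[OF p] algebra_simps power2_eq_square)
qed

lemma lam_le_1: assumes p: "p \<in> W" shows "lam p \<le> 1"
proof (rule ccontr)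
  assume "\<not> lam p \<le> 1"
  then have "real m * (lam p * (1 - lam p)) < 0" using m_pos by (simp add: mult_pos_neg)
  moreover have "0 \<le> real m * (lam p * (1 - lam p))"
    unfolding sum_norm_normal_D_H[OF p, symmetric] by (intro sum_nonneg) simp
  ultimately show False by simp
qed

lemma D_H_eq:
  assumes p: "p \<in> W" and "lam p = 1" and v: "v \<in> tangent_space M p"
  shows "D H p v = - v"
proof -
  have "(\<Sum>e\<in>tangent_frame M p. (D H p e + e) \<bullet> (D H p e + e)) = 0"
    using sum_norm_normal_D_H[OF p] assms(2) by simp
  then have "\<forall>e\<in>tangent_frame M p. (D H p e + e) \<bullet> (D H p e + e) = 0"
    using sum_nonneg_eq_0_iff[OF orthonormal_basis_finite[OF tangent_frame[OF p]], of "\<lambda>e. (D H p e + e) \<bullet> (D H p e + e)"] by simp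
  then have 0: "\<And>e. e \<in> tangent_frame M p \<Longrightarrow> D H p e + e = 0" by simp
  have "linear (\<lambda>v. D H p v + v)"
    using linear_D[OF smooth_differentiable[OF smooth_H p]] by (intro linear_compose_add) (auto simp: linear_id[unfolded id_def])
  from tangent_frame_expand[OF p v this] have "D H p v + v = 0" by (simp add: 0)
  then show ?thesis by (simp add: eq_neg_iff_add_eq_0)
qed

text \<open>\<open>H p - p\<close> is the mean curvature vector in the ambient Euclidean space.\<close>

lemma sum_deviation:
  assumes p: "p \<in> W"
  defines "h \<equiv> H p - p"
  shows "(\<Sum>e\<in>tangent_frame M p. \<Sum>f\<in>tangent_frame M p.
      (DP p e f - (e \<bullet> f) *\<^sub>R h) \<bullet> (DP p e f - (e \<bullet> f) *\<^sub>R h))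
    = real m * (real m - 1) * (lam p + 1) - scalar_curvature M p"
proof -
  let ?B = "tangent_frame M p"
  have hh: "h \<bullet> h = lam p + 1"
    using H_inner_self[OF p] q_q[OF p] by (simp add: h_def lam_def inner_diff_left inner_diff_right inner_commute)
  have K: "K p = real m *\<^sub>R h" by (simp add: K_eq h_def)
  have fin: "finite ?B" by (rule orthonormal_basis_finite[OF tangent_frame[OF p]])
  have "(\<Sum>f\<in>?B. (DP p e f - (e \<bullet> f) *\<^sub>R h) \<bullet> (DP p e f - (e \<bullet> f) *\<^sub>R h))
     = (\<Sum>f\<in>?B. DP p e f \<bullet> DP p e f) - 2 * (DP p e e \<bullet> h) + h \<bullet> h" if e: "e \<in> ?B" for e
  proof -
    have "(DP p e f - (e \<bullet> f) *\<^sub>R h) \<bullet> (DP p e f - (e \<bullet> f) *\<^sub>R h)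
       = DP p e f \<bullet> DP p e f + (if e = f then h \<bullet> h - 2 * (DP p e f \<bullet> h) else 0)" if "f \<in> ?B" for f
      using orthonormal_basis_inner[OF tangent_frame[OF p] e that]
      by (simp add: inner_diff_left inner_diff_right inner_commute)
    then have "(\<Sum>f\<in>?B. (DP p e f - (e \<bullet> f) *\<^sub>R h) \<bullet> (DP p e f - (e \<bullet> f) *\<^sub>R h))
      = (\<Sum>f\<in>?B. DP p e f \<bullet> DP p e f + (if e = f then h \<bullet> h - 2 * (DP p e f \<bullet> h) else 0))"
      by (intro sum.cong refl)
    also have "\<dots> = (\<Sum>f\<in>?B. DP p e f \<bullet> DP p e f) + (\<Sum>f\<in>?B. if e = f then h \<bullet> h - 2 * (DP p e f \<bullet> h) else 0)"
      by (rule sum.distrib)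
    also have "(\<Sum>f\<in>?B. if e = f then h \<bullet> h - 2 * (DP p e f \<bullet> h) else 0) = h \<bullet> h - 2 * (DP p e e \<bullet> h)"
      using fin e by simp
    finally show ?thesis by simp
  qed
  then have "(\<Sum>e\<in>?B. \<Sum>f\<in>?B. (DP p e f - (e \<bullet> f) *\<^sub>R h) \<bullet> (DP p e f - (e \<bullet> f) *\<^sub>R h))
     = (\<Sum>e\<in>?B. (\<Sum>f\<in>?B. DP p e f \<bullet> DP p e f) - 2 * (DP p e e \<bullet> h) + h \<bullet> h)"
    by (intro sum.cong refl)
  also have "\<dots> = (\<Sum>e\<in>?B. \<Sum>f\<in>?B. DP p e f \<bullet> DP p e f) - 2 * (K p \<bullet> h) + real m * (h \<bullet> h)"
    by (simp add: sum.distrib sum_subtractf K_trace[OF p] inner_sum_left sum_distrib_left card_tangent_frame[OF p])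
  also have "\<dots> = real m * (real m - 1) * (lam p + 1) - scalar_curvature M p"
    by (simp add: scalar_curvature_eq[OF p] K hh algebra_simps)
  finally show ?thesis .
qed

lemma scalar_curvature_le:
  assumes p: "p \<in> W"
  shows "scalar_curvature M p \<le> real m * (real m - 1) * (lam p + 1)"
proof -
  have "0 \<le> real m * (real m - 1) * (lam p + 1) - scalar_curvature M p"
    unfolding sum_deviation[OF p, symmetric] by (intro sum_nonneg) simp
  then show ?thesis by simp
qed

lemma scalar_curvature_bound:
  assumes p: "p \<in> W"
  shows "scalar_curvature M p \<le> 2 * real m * (real m - 1)"
proof -
  have "real m * (real m - 1) * (lam p + 1) \<le> real m * (real m - 1) * 2"
    using lam_le_1[OF p] m_pos by (intro mult_left_mono) auto
  then show ?thesis using scalar_curvature_le[OF p] by simp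
qed

lemma equality_case:
  assumes p: "p \<in> W" and "2 \<le> m" and s: "scalar_curvature M p = 2 * real m * (real m - 1)"
  shows "lam p = 1" and "\<lbrakk>x \<in> tangent_space M p; y \<in> tangent_space M p\<rbrakk> \<Longrightarrow> DP p x y = (x \<bullet> y) *\<^sub>R (H p - p)"
proof -
  \<comment> \<open>\<open>2 \<le> m\<close> makes this factor positive and hence cancellable; for
    \<open>m = 1\<close> it is zero, and equality in the bound would carry no information about
    \<open>lam p\<close>.\<close>
  have mm: "0 < real m * (real m - 1)" using assms(2) by simp
  have "real m * (real m - 1) * 2 \<le> real m * (real m - 1) * (lam p + 1)"
    using scalar_curvature_le[OF p] s by simp
  then have "2 \<le> lam p + 1" by (rule mult_left_le_imp_le[OF _ mm])
  then show l: "lam p = 1" using lam_le_1[OF p] by simp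
  let ?B = "tangent_frame M p"
  let ?g = "\<lambda>e f. (DP p e f - (e \<bullet> f) *\<^sub>R (H p - p)) \<bullet> (DP p e f - (e \<bullet> f) *\<^sub>R (H p - p))"
  have fin: "finite ?B" by (rule orthonormal_basis_finite[OF tangent_frame[OF p]])
  have "(\<Sum>e\<in>?B. \<Sum>f\<in>?B. ?g e f) = 0" unfolding sum_deviation[OF p] by (simp add: l s)
  then have B0: "\<forall>e\<in>?B. (\<Sum>f\<in>?B. ?g e f) = 0"
    using sum_nonneg_eq_0_iff[OF fin, of "\<lambda>e. \<Sum>f\<in>?B. ?g e f"] by (simp add: sum_nonneg)
  have "\<forall>e\<in>?B. \<forall>f\<in>?B. ?g e f = 0"
  proof
    fix e assume "e \<in> ?B"
    then show "\<forall>f\<in>?B. ?g e f = 0"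
      using B0 sum_nonneg_eq_0_iff[OF fin, of "?g e"] by simp
  qed
  then have ef: "DP p e f - (e \<bullet> f) *\<^sub>R (H p - p) = 0" if "e \<in> ?B" "f \<in> ?B" for e f
    using that by simp
  assume xy: "x \<in> tangent_space M p" "y \<in> tangent_space M p"
  define b where "b u v = DP p u v - (u \<bullet> v) *\<^sub>R (H p - p)" for u v
  have l1: "linear (\<lambda>u. b u v)" for v
    unfolding b_def by (intro linear_compose_sub linear_DP_dir W_\<Omega> p)
      (auto intro!: linearI simp: inner_add_left scaleR_add_left)
  have l2: "linear (b u)" for u
    unfolding b_def by (intro linear_compose_sub linear_DP W_\<Omega> p)
      (auto intro!: linearI simp: inner_add_right scaleR_add_left)
  have "b e y = 0" if "e \<in> ?B" for e
    using tangent_frame_expand[OF p xy(2) l2, of e] ef[OF that] by (simp add: b_def)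
  then have "b x y = 0" using tangent_frame_expand[OF p xy(1) l1, of y] by simp
  then show "DP p x y = (x \<bullet> y) *\<^sub>R (H p - p)" by (simp add: b_def)
qed

end

end

subsection \<open>Locally constant functions\<close>

text \<open>A piece of \<open>W\<close> near \<open>p\<close> need not be connected, so
  \<open>f\<close> is pulled back by \<open>r\<close> to a ball. There its derivative vanishes, as
  \<open>D r q\<close> takes values in tangent spaces of \<open>M\<close>.\<close>

lemma (in local_retraction) locally_constant:
  assumes f: "smooth_on \<Omega> f" and D0: "\<And>q v. q \<in> W \<Longrightarrow> v \<in> tangent_space M q \<Longrightarrow> D f q v = 0" and p: "p \<in> W"
  obtains V where "openin M V" "p \<in> V" "V \<subseteq> W" "\<And>q. q \<in> V \<Longrightarrow> f q = f p"
proof -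
  obtain e where e: "e > 0" "ball p e \<subseteq> \<Omega>" using W_\<Omega>[OF p] open_\<Omega> open_contains_ball by blast
  have "((\<lambda>q. f (r q)) has_derivative (\<lambda>v. 0)) (at q within ball p e)" if "q \<in> ball p e" for q
  proof -
    have q: "q \<in> \<Omega>" using that e by blast
    have "((f \<circ> r) has_derivative (D f (r q) \<circ> D r q)) (at q)"
      by (rule diff_chain_at[OF smooth_on_has_derivative[OF smooth_r q] smooth_on_has_derivative[OF f W_\<Omega>[OF r_in[OF q]]]])
    moreover have "D r q v \<in> tangent_space M (r q)" for v
      unfolding tangent_space_eq[OF r_in[OF q]] using D_r_comp[OF q, of v] by (metis rangeI)
    then have "D f (r q) \<circ> D r q = (\<lambda>v. 0)" using D0[OF r_in[OF q]] by (simp add: fun_eq_iff)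
    ultimately show ?thesis unfolding o_def by (simp add: has_derivative_at_withinI)
  qed
  then obtain k where k: "\<And>q. q \<in> ball p e \<Longrightarrow> f (r q) = k"
    using has_derivative_zero_constant[OF convex_ball] by metis
  have "openin (subtopology M W) (W \<inter> ball p e)"
    unfolding subtop_W by (simp add: openin_open_Int)
  then have "openin M (W \<inter> ball p e)" using openin_trans_full openin_W by blast
  moreover have "f q = f p" if "q \<in> W \<inter> ball p e" for q
    using k[of q] k[of p] that e p by (simp add: r_W)
  moreover have "p \<in> W \<inter> ball p e" using e p by simp
  ultimately show thesis using that[of "W \<inter> ball p e"] by blast
qed

lemma connected_space_locally_constant:
  assumes "connected_space X" and loc: "\<And>p. p \<in> topspace X \<Longrightarrow> \<exists>V. openin X V \<and> p \<in> V \<and> (\<forall>q\<in>V. f q = f p)"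
    and pq: "p \<in> topspace X" "q \<in> topspace X"
  shows "f p = f q"
proof -
  let ?S = "{x \<in> topspace X. f x = f p}"
  have "openin X ?S"
  proof (subst openin_subopen, intro ballI)
    fix x assume x: "x \<in> ?S"
    then obtain V where V: "openin X V" "x \<in> V" "\<forall>q\<in>V. f q = f x" using loc by blast
    have "f y = f p" if "y \<in> V" for y using bspec[OF V(3) that] x by simp
    then show "\<exists>T. openin X T \<and> x \<in> T \<and> T \<subseteq> ?S"
      using V(1,2) openin_subset[OF V(1)] by blast
  qed
  moreover have "openin X (topspace X - ?S)"
  proof (subst openin_subopen, intro ballI)
    fix x assume x: "x \<in> topspace X - ?S"
    then obtain V where V: "openin X V" "x \<in> V" "\<forall>q\<in>V. f q = f x" using loc by blast
    have "f y \<noteq> f p" if "y \<in> V" for y using bspec[OF V(3) that] x by simp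
    then show "\<exists>T. openin X T \<and> x \<in> T \<and> T \<subseteq> topspace X - ?S"
      using V(1,2) openin_subset[OF V(1)] by blast
  qed
  ultimately have "?S = {} \<or> ?S = topspace X"
    using assms(1) unfolding connected_space_clopen_in by (auto simp: closedin_def)
  moreover have "p \<in> ?S" using pq(1) by simp
  ultimately have "q \<in> ?S" using pq(2) by blast
  then show ?thesis by simp
qed

text \<open>The manifold topology might be finer than the subspace topology; neighbourhoods that are
  open for both, and on which both agree, exclude this.\<close>

lemma topology_eq_top_of_set:
  assumes "\<And>p. p \<in> topspace M \<Longrightarrow> \<exists>W. p \<in> W \<and> openin M W \<and> openin (top_of_set S) W \<and> subtopology M W = top_of_set W"
  shows "openin (top_of_set S) (topspace M)" "M = top_of_set (topspace M)"
proof -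
  show op: "openin (top_of_set S) (topspace M)"
  proof (subst openin_subopen, intro ballI)
    fix x assume "x \<in> topspace M"
    then obtain W where "x \<in> W" "openin M W" "openin (top_of_set S) W" using assms by blast
    then show "\<exists>T. openin (top_of_set S) T \<and> x \<in> T \<and> T \<subseteq> topspace M"
      using openin_subset[of M W] by blast
  qed
  then have sub: "topspace M \<subseteq> S" using openin_imp_subset by blast
  show "M = top_of_set (topspace M)"
    unfolding topology_eq
  proof (intro allI iffI)
    fix X assume X: "openin M X"
    show "openin (top_of_set (topspace M)) X"
    proof (subst openin_subopen, intro ballI)
      fix x assume x: "x \<in> X"
      then obtain W where W: "x \<in> W" "openin M W" "openin (top_of_set S) W" "subtopology M W = top_of_set W"
        using assms openin_subset[OF X] by blast
      have "openin (top_of_set W) (X \<inter> W)" using openin_subtopology_Int[OF X, of W] unfolding W(4) .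
      moreover have "openin (top_of_set (topspace M)) W"
        by (rule openin_subset_trans[OF W(3) openin_subset[OF W(2)] sub])
      ultimately have "openin (top_of_set (topspace M)) (X \<inter> W)" by (rule openin_trans)
      then show "\<exists>T. openin (top_of_set (topspace M)) T \<and> x \<in> T \<and> T \<subseteq> X" using x W by blast
    qed
  next
    fix X assume X: "openin (top_of_set (topspace M)) X"
    show "openin M X"
    proof (subst openin_subopen, intro ballI)
      fix x assume x: "x \<in> X"
      then obtain W where W: "x \<in> W" "openin M W" "openin (top_of_set S) W" "subtopology M W = top_of_set W"
        using assms openin_imp_subset[OF X] by blast
      obtain T where T: "open T" "X = topspace M \<inter> T" using X by (auto simp: openin_open)
      have "X \<inter> W = W \<inter> T" using T openin_subset[OF W(2)] by blast
      then have "openin (subtopology M W) (X \<inter> W)" unfolding W(4) using T by (simp add: openin_open_Int)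
      then have "openin M (X \<inter> W)" using openin_trans_full W(2) by blast
      then show "\<exists>T. openin M T \<and> x \<in> T \<and> T \<subseteq> X" using x W by blast
    qed
  qed
qed

subsection \<open>The case of equality\<close>

text \<open>A dimension count identifies the tangent spaces with those of the small sphere, so
  \<open>P\<close> and \<open>DP\<close> are explicit. The traced Gauss equation then reads 2 m^2 -
  2 m.\<close>

lemma (in local_retraction) scalar_curvature_subsphere:
  assumes A: "affine A" "aff_dim A = int m + 1" "c \<in> A" and WA: "W \<subseteq> sphere c (1 / sqrt 2) \<inter> A" and q: "q \<in> W"
  shows "scalar_curvature M q = 2 * real m * (real m - 1)"
proof -
  define L where "L = (\<lambda>x. x - c) ` A"
  define u where "u = q - c"
  have sL: "subspace L" unfolding L_def by (rule affine_diffs_subspace_subtract[OF A(1,3)])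
  have dimL: "dim L = m + 1"
    using aff_dim_dim_affine_diffs[OF A(1,3)] A(2) by (simp add: L_def)
  define \<pi> where "\<pi> = orth_proj L"
  have lin\<pi>: "linear \<pi>" unfolding \<pi>_def by (rule linear_orth_proj[OF sL])
  have bl: "bounded_linear \<pi>" using lin\<pi> linear_conv_bounded_linear by blast
  have xL: "x - c \<in> L" if "x \<in> W" for x using that WA unfolding L_def by force
  have xx: "(x - c) \<bullet> (x - c) = 1/2" if "x \<in> W" for x
  proof -
    have "norm (x - c) = 1 / sqrt 2" using that WA by (auto simp: dist_norm norm_minus_commute)
    then have "(x - c) \<bullet> (x - c) = (1 / sqrt 2)\<^sup>2" by (simp add: power2_norm_eq_inner[symmetric])
    then show ?thesis by (simp add: power_divide)
  qed
  define Lx where "Lx x = {v \<in> L. v \<bullet> (x - c) = 0}" for x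
  have sLx: "subspace (Lx x)" for x
    using sL unfolding Lx_def subspace_def by (auto simp: inner_add_left)
  have T: "tangent_space M x = Lx x" if x: "x \<in> W" for x
  proof (rule subspace_dim_equal[OF subspace_tangent[OF x] sLx])
    show "tangent_space M x \<subseteq> Lx x"
    proof
      fix v assume v: "v \<in> tangent_space M x"
      have d1: "(\<lambda>y. (y - c) \<bullet> (y - c)) differentiable (at x)"
        by (intro differentiable_inner differentiable_diff differentiable_ident differentiable_const)
      have "D (\<lambda>y. (y - c) \<bullet> (y - c)) x v = D (\<lambda>y. 1/2) x v"
        by (rule D_eq_on_W[OF x v d1 differentiable_const]) (rule xx)
      moreover have "D (\<lambda>y. (y - c) \<bullet> (y - c)) x v = 2 * (v \<bullet> (x - c))"
        by (rule D_eq) (auto intro!: derivative_eq_intros simp: inner_commute)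
      ultimately have "v \<bullet> (x - c) = 0" by (simp add: D_const)
      have h: "((\<lambda>y. (y - c) - \<pi> (y - c)) has_derivative (\<lambda>v. v - \<pi> v)) (at x)"
        by (auto intro!: derivative_eq_intros bounded_linear.has_derivative[OF bl])
      have "D (\<lambda>y. (y - c) - \<pi> (y - c)) x v = D (\<lambda>y. 0) x v"
        by (rule D_eq_on_W[OF x v _ differentiable_const])
          (use h differentiable_def xL orth_proj_ident[OF sL] in \<open>auto simp: \<pi>_def\<close>)
      then have "v = \<pi> v" using D_eq[OF h, of v] by (simp add: D_const)
      then have "v \<in> L" using orth_proj_in[OF sL, of v] unfolding \<pi>_def by simp
      then show "v \<in> Lx x" using \<open>v \<bullet> (x - c) = 0\<close> by (simp add: Lx_def)
    qed
    \<comment> \<open>The radial vector \<open>x - c\<close> lies in \<open>L\<close> but not in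
      \<open>Lx x\<close>, so the dimension drops by at least one, which is all the comparison
      needs.\<close>
    have "Lx x \<subset> L"
    proof
      have "x - c \<notin> Lx x" using xx[OF x] unfolding Lx_def by auto
      then show "Lx x \<noteq> L" using xL[OF x] by blast
    qed (auto simp: Lx_def)
    then have "dim (Lx x) < dim L"
      by (intro dim_psubset) (simp add: span_eq_iff[THEN iffD2, OF sLx] span_eq_iff[THEN iffD2, OF sL])
    then show "dim (Lx x) \<le> dim (tangent_space M x)" using dimL dim_tangent[OF x] by simp
  qed
  \<comment> \<open>The factor 2 is the inverse of the squared radius, normalising
    \<open>x - c\<close>.\<close>
  have P: "P x w = \<pi> w - (2 * (w \<bullet> (x - c))) *\<^sub>R (x - c)" if x: "x \<in> W" for x w
    unfolding P_W[OF x] T[OF x]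
  proof (rule orth_proj_eqI[OF sLx])
    have "\<pi> w \<in> L" unfolding \<pi>_def by (rule orth_proj_in[OF sL])
    moreover have "\<pi> w \<bullet> (x - c) = w \<bullet> (x - c)" unfolding \<pi>_def by (rule orth_proj_inner[OF sL xL[OF x]])
    ultimately show "\<pi> w - (2 * (w \<bullet> (x - c))) *\<^sub>R (x - c) \<in> Lx x"
      using xL[OF x] xx[OF x] sL by (simp add: Lx_def subspace_diff subspace_mul inner_diff_left[of "\<pi> w"])
    show "(w - (\<pi> w - (2 * (w \<bullet> (x - c))) *\<^sub>R (x - c))) \<bullet> z = 0" if z: "z \<in> Lx x" for z
    proof -
      have "(x - c) \<bullet> z = 0" "z \<in> L" using z by (simp_all add: Lx_def inner_commute)
      then show ?thesis using orth_proj_inner[OF sL, of z w]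
        by (simp add: \<pi>_def[symmetric] inner_diff_left[of w] inner_diff_left[of "\<pi> w"])
    qed
  qed
  have dP: "DP q x w = - (2 * (w \<bullet> x)) *\<^sub>R u" if x: "x \<in> tangent_space M q" and w: "w \<in> tangent_space M q" for x w
  proof -
    have "((\<lambda>y. \<pi> w - (2 * (w \<bullet> (y - c))) *\<^sub>R (y - c)) has_derivative
      (\<lambda>v. - ((2 * (w \<bullet> (q - c))) *\<^sub>R v + (2 * (w \<bullet> v)) *\<^sub>R (q - c)))) (at q)"
      by (auto intro!: derivative_eq_intros)
    moreover from this have "DP q x w = D (\<lambda>y. \<pi> w - (2 * (w \<bullet> (y - c))) *\<^sub>R (y - c)) q x"
      unfolding DP_def
      by (intro D_eq_on_W[OF q x smooth_differentiable[OF smooth_P q] _ P]) (auto simp: differentiable_def)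
    moreover have "w \<bullet> (q - c) = 0" using w unfolding T[OF q] Lx_def by simp
    ultimately show ?thesis by (simp add: D_eq u_def)
  qed
  let ?B = "tangent_frame M q"
  have uu: "u \<bullet> u = 1/2" using xx[OF q] by (simp add: u_def)
  have "K q = (\<Sum>e\<in>?B. (-2) *\<^sub>R u)" unfolding K_trace[OF q]
    by (intro sum.cong refl) (simp add: dP tangent_frame_in[OF q] tangent_frame_norm[OF q])
  then have K: "K q = (- 2 * real m) *\<^sub>R u" by (simp add: sum_constant_scaleR card_tangent_frame[OF q])
  have fin: "finite ?B" by (rule orthonormal_basis_finite[OF tangent_frame[OF q]])
  have "(\<Sum>e\<in>?B. \<Sum>f\<in>?B. DP q e f \<bullet> DP q e f) = (\<Sum>e\<in>?B. \<Sum>f\<in>?B. if e = f then 2 else 0)"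
  proof (intro sum.cong refl)
    fix e f assume ef: "e \<in> ?B" "f \<in> ?B"
    then have "f \<bullet> e = (if e = f then 1 else 0)" using orthonormal_basis_inner[OF tangent_frame[OF q] ef(2,1)] by auto
    then show "DP q e f \<bullet> DP q e f = (if e = f then 2 else 0)"
      using ef by (simp add: dP tangent_frame_in[OF q] uu)
  qed
  also have "\<dots> = 2 * real m" using fin card_tangent_frame[OF q] by simp
  finally show ?thesis
    unfolding scalar_curvature_eq[OF q] K by (simp add: uu algebra_simps)
qed

locale extremal = biharmonic_pseudo_umbilical +
  assumes m4: "m \<noteq> 4" and m2: "2 \<le> m"
    and extremal: "q \<in> W \<Longrightarrow> scalar_curvature M q = 2 * real m * (real m - 1)"
begin

lemma lam_1: assumes "q \<in> W" shows "lam q = 1"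
  by (rule equality_case(1)[OF m4 assms m2 extremal[OF assms]])

lemma H_H: "q \<in> W \<Longrightarrow> H q \<bullet> H q = 1"
  using lam_1 by (simp add: lam_def)

lemma D_H: "q \<in> W \<Longrightarrow> v \<in> tangent_space M q \<Longrightarrow> D H q v = - v"
  by (rule D_H_eq[OF m4 _ lam_1])

lemma D_center: "q \<in> W \<Longrightarrow> v \<in> tangent_space M q \<Longrightarrow> D (\<lambda>q. q + H q) q v = 0"
  using smooth_differentiable[OF smooth_H, of q] by (simp add: D_add D_ident D_H differentiable_ident)

text \<open>With \<open>h = H q - q\<close> of squared length 2, the map is the orthogonal
  projection onto the span of the tangent space and \<open>h\<close>. Umbilicity turns tangent
  vectors into multiples of \<open>h\<close>, and \<open>D H q x = - x\<close> turns
  \<open>h\<close> into a tangent vector; the two contributions cancel.\<close>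

lemma D_normal_bundle:
  assumes q: "q \<in> W" and x: "x \<in> tangent_space M q"
  shows "D (\<lambda>q. P q v + ((v \<bullet> (H q - q)) / 2) *\<^sub>R (H q - q)) q x = 0"
proof -
  note q\<Omega> = W_\<Omega>[OF q]
  define h where "h = H q - q"
  have dh: "((\<lambda>q. H q - q) has_derivative (\<lambda>x. D H q x - x)) (at q)"
    by (intro has_derivative_diff smooth_on_has_derivative[OF smooth_H q\<Omega>] has_derivative_ident)
  have dQ: "((\<lambda>q. P q v + ((v \<bullet> (H q - q)) / 2) *\<^sub>R (H q - q)) has_derivative
     (\<lambda>x. DP q x v + (((v \<bullet> h) / 2) *\<^sub>R (D H q x - x) + ((v \<bullet> (D H q x - x)) / 2) *\<^sub>R h))) (at q)"
    unfolding DP_def h_def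
    by (intro has_derivative_add smooth_on_has_derivative[OF smooth_P q\<Omega>] has_derivative_scaleR dh
         bounded_linear.has_derivative[OF bounded_linear_divide] has_derivative_inner_right)
  have eq: "D (\<lambda>q. P q v + ((v \<bullet> (H q - q)) / 2) *\<^sub>R (H q - q)) q x
    = DP q x v - (v \<bullet> h) *\<^sub>R x - (v \<bullet> x) *\<^sub>R h"
  proof -
    have "- x - x = (-2) *\<^sub>R x" by (simp add: scaleR_2)
    then show ?thesis
      unfolding D_eq[OF dQ] D_H[OF q x] by simp
  qed
  have II: "DP q x y = (x \<bullet> y) *\<^sub>R h" if "y \<in> tangent_space M q" for y
    using equality_case(2)[OF m4 q m2 extremal[OF q] x that] by (simp add: h_def)
  have hT: "h \<bullet> y = 0" if "y \<in> tangent_space M q" for y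
    using H_tangent[OF q that] tangent_sphere[OF q that]
    by (simp add: h_def inner_diff_left inner_commute[of q y])
  define y where "y = P q v"
  define \<nu> where "\<nu> = v - P q v"
  have yT: "y \<in> tangent_space M q" unfolding y_def by (rule P_in[OF q])
  have P\<nu>: "P q \<nu> = 0" unfolding \<nu>_def by (simp add: linear_diff[OF linear_P[OF q\<Omega>]] P_idem[OF q\<Omega>])
  have \<nu>T: "\<nu> \<bullet> w = 0" if "w \<in> tangent_space M q" for w using P\<nu> that unfolding P_eq_0_iff[OF q] by blast
  \<comment> \<open>Umbilicity describes \<open>DP\<close> on tangent vectors only. Adjointness
    transfers it to the normal vector \<open>\<nu>\<close>: the defect \<open>d\<close> is tangent
    and orthogonal to itself.\<close>
  define d where "d = DP q x \<nu> - (\<nu> \<bullet> h) *\<^sub>R x"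
  have "DP q x \<nu> \<in> tangent_space M q" using P_DP_normal[OF q P\<nu>, of x] P_in[OF q] by metis
  then have dT: "d \<in> tangent_space M q"
    unfolding d_def using subspace_tangent[OF q] x by (simp add: subspace_diff subspace_mul)
  have "d \<bullet> d = DP q x \<nu> \<bullet> d - (\<nu> \<bullet> h) * (x \<bullet> d)" unfolding d_def by (simp add: inner_diff_left)
  also have "DP q x \<nu> \<bullet> d = (x \<bullet> d) * (\<nu> \<bullet> h)" using DP_sym[OF q\<Omega>, of x \<nu> d] II[OF dT] by simp
  finally have "d = 0" by simp
  then have "DP q x \<nu> = (\<nu> \<bullet> h) *\<^sub>R x" by (simp add: d_def)
  moreover have "v = y + \<nu>" by (simp add: y_def \<nu>_def)
  moreover have "v \<bullet> h = \<nu> \<bullet> h" "v \<bullet> x = x \<bullet> y"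
    using hT[OF yT] \<nu>T[OF x] \<open>v = y + \<nu>\<close> by (simp_all add: inner_add_left inner_commute[of y])
  ultimately show ?thesis
    unfolding eq using II[OF yT] by (simp add: linear_add[OF linear_DP[OF q\<Omega>]])
qed

end

context extremal
begin

text \<open>Stated with \<open>mean_curvature_vector\<close> instead of the \<open>H\<close> of a
  chart, so that the conclusions of different charts concern one function on
  \<open>M\<close>.\<close>

lemma center_locally_constant:
  assumes p: "p \<in> W"
  shows "\<exists>V. openin M V \<and> p \<in> V \<and>
    (\<forall>q\<in>V. q + mean_curvature_vector m M unit_sphere q = p + mean_curvature_vector m M unit_sphere p)"
proof -
  have "smooth_on \<Omega> (\<lambda>q. q + H q)" by (intro smooth_on_add smooth_on_ident smooth_H open_\<Omega>)
  from locally_constant[OF this D_center p] obtain V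
    where V: "openin M V" "p \<in> V" "V \<subseteq> W" "\<And>q. q \<in> V \<Longrightarrow> q + H q = p + H p" by blast
  have "q + mean_curvature_vector m M unit_sphere q = p + mean_curvature_vector m M unit_sphere p" if "q \<in> V" for q
    using V(4)[OF that] mean_curvature_vector_eq[OF subsetD[OF V(3) that]] mean_curvature_vector_eq[OF p] by metis
  then show ?thesis using V(1,2) by blast
qed

lemma normal_bundle_locally_constant:
  assumes p: "p \<in> W"
  defines "Q \<equiv> \<lambda>q v. orth_proj (tangent_space M q) v
    + ((v \<bullet> (mean_curvature_vector m M unit_sphere q - q)) / 2) *\<^sub>R (mean_curvature_vector m M unit_sphere q - q)"
  shows "\<exists>V. openin M V \<and> p \<in> V \<and> (\<forall>q\<in>V. Q q v = Q p v)"
proof -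
  let ?f = "\<lambda>q. P q v + ((v \<bullet> (H q - q)) / 2) *\<^sub>R (H q - q)"
  have "smooth_on \<Omega> (\<lambda>q. P q v + ((1/2) *\<^sub>R (v \<bullet> (H q - q))) *\<^sub>R (H q - q))"
    by (intro smooth_on_add smooth_on_diff smooth_on_ident smooth_on_scaleR smooth_on_inner smooth_on_const smooth_H smooth_P open_\<Omega>)
  then have "smooth_on \<Omega> ?f" by simp
  from locally_constant[OF this D_normal_bundle p] obtain V
    where V: "openin M V" "p \<in> V" "V \<subseteq> W" "\<And>q. q \<in> V \<Longrightarrow> ?f q = ?f p" by blast
  have Qf: "Q q v = ?f q" if "q \<in> W" for q
    unfolding Q_def mean_curvature_vector_eq[OF that] P_W[OF that] ..
  have "Q q v = Q p v" if "q \<in> V" for q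
    using V(4)[OF that] Qf[OF subsetD[OF V(3) that]] Qf[OF p] by metis
  then show ?thesis using V(1,2) by blast
qed

end

text \<open>Invariance of domain, applied to \<open>l\<close> composed with a parametrisation of \<open>M\<close>.\<close>

lemma immersed_submanifold_open_in:
  fixes l :: "'a::euclidean_space \<Rightarrow> 'a"
  assumes M: "immersed_submanifold m M" and p: "p \<in> topspace M" and T: "subspace T" "dim T = m"
    and l: "continuous_on UNIV l" "\<And>x. l x \<in> T" and N: "open N" "p \<in> N"
    and S: "topspace M \<subseteq> S" and inj: "inj_on l (S \<inter> N)"
  shows "\<exists>W. p \<in> W \<and> openin M W \<and> openin (top_of_set S) W \<and> subtopology M W = top_of_set W"
proof -
  obtain W0 U and F :: "'a \<Rightarrow> 'a" and G S0 where
    pW: "p \<in> W0" and W0: "openin M W0" "subtopology M W0 = top_of_set W0" and U: "open U" and FU: "open (F ` U)"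
    and F: "smooth_on U F" and G: "smooth_on (F ` U) G" and "\<forall>x\<in>U. G (F x) = x"
    and S0: "subspace S0" "dim S0 = m" and Weq: "W0 = {x \<in> U. F x \<in> S0}"
    using bspec[OF conjunct2[OF M[unfolded immersed_submanifold_def]] p]
    by (elim exE conjE) (rule that; assumption)
  then have GF: "G (F x) = x" if "x \<in> U" for x using that by blast
  define W where "W = W0 \<inter> N"
  define B where "B = S0 \<inter> (F ` U \<inter> G -` N)"
  have W0M: "W0 \<subseteq> topspace M" using W0(1) by (rule openin_subset)
  have GB: "G ` B = W"
  proof
    show "G ` B \<subseteq> W" unfolding B_def W_def Weq using GF by auto
    show "W \<subseteq> G ` B"
    proof
      fix y assume "y \<in> W"
      then have "y \<in> U" "F y \<in> B" unfolding B_def W_def Weq using GF by auto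
      then show "y \<in> G ` B" using GF by (metis image_eqI)
    qed
  qed
  have opB: "openin (top_of_set S0) B"
    unfolding B_def by (rule openin_open_Int) (rule continuous_open_preimage[OF smooth_on_imp_continuous[OF G] FU N(1)])
  have FG: "F (G x) = x" if "x \<in> B" for x using that GF unfolding B_def by auto
  have WSN: "W \<subseteq> S \<inter> N" using W0M S unfolding W_def by blast
  have cont: "continuous_on B (\<lambda>x. l (G x))"
  proof (rule continuous_on_compose2[OF l(1)])
    show "continuous_on B G"
      by (rule continuous_on_subset[OF smooth_on_imp_continuous[OF G]]) (auto simp: B_def)
  qed simp
  have injB: "inj_on (\<lambda>x. l (G x)) B"
  proof (rule inj_onI)
    fix x y assume xy: "x \<in> B" "y \<in> B" "l (G x) = l (G y)"
    then have "G x \<in> S \<inter> N" "G y \<in> S \<inter> N" using GB WSN by blast+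
    then have "G x = G y" using inj xy(3) by (auto dest: inj_onD)
    then show "x = y" using FG xy by metis
  qed
  have "openin (top_of_set T) ((\<lambda>x. l (G x)) ` B)"
    by (rule invariance_of_domain_subspaces[OF opB S0(1) T(1) _ cont _ injB]) (use S0 T l in auto)
  moreover have "(\<lambda>x. l (G x)) ` B = l ` W" unfolding GB[symmetric] by (simp add: image_image)
  ultimately obtain Z where Z: "open Z" "l ` W = T \<inter> Z" by (auto simp: openin_open)
  \<comment> \<open>A point of \<open>S \<inter> N\<close> whose image lies in \<open>Z\<close>
    shares that image with a point of \<open>W\<close>; injectivity identifies the two.\<close>
  have "W = S \<inter> (N \<inter> l -` Z)"
  proof
    show "W \<subseteq> S \<inter> (N \<inter> l -` Z)" using WSN Z(2) by blast
    show "S \<inter> (N \<inter> l -` Z) \<subseteq> W"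
    proof
      fix y assume y: "y \<in> S \<inter> (N \<inter> l -` Z)"
      then have "l y \<in> l ` W" using Z(2) l(2) by blast
      then obtain w where w: "w \<in> W" "l y = l w" by blast
      then have "y = w" using inj_onD[OF inj w(2)] y WSN by blast
      then show "y \<in> W" using w by simp
    qed
  qed
  moreover have "open (N \<inter> l -` Z)" using N(1) open_vimage[OF Z(1) l(1)] by blast
  ultimately have opS: "openin (top_of_set S) W" by (metis openin_open_Int)
  have "openin (subtopology M W0) W" unfolding W0(2) W_def using N(1) by (rule openin_open_Int)
  then have opM: "openin M W" using openin_trans_full W0(1) by blast
  have "subtopology M W = subtopology (subtopology M W0) W"
    by (simp add: subtopology_subtopology W_def Int_assoc[symmetric])
  then have "subtopology M W = top_of_set W"
    unfolding W0(2) by (simp add: subtopology_subtopology W_def Int_assoc[symmetric])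
  then show ?thesis using opS opM pW N(2) unfolding W_def by blast
qed

section \<open>From charts to the whole submanifold\<close>

context
  fixes M :: "'a::euclidean_space topology" and m :: nat
  assumes M: "immersed_submanifold m M" and m: "0 < m" and sphere: "topspace M \<subseteq> sphere 0 1"
    and biharmonic: "biharmonic_submanifold M unit_sphere" and umbilical: "pseudo_umbilical m M unit_sphere"
begin

lemma ex_biharmonic_chart:
  assumes p: "p \<in> topspace M"
  obtains W \<Omega> r \<mu> where "biharmonic_pseudo_umbilical M W \<Omega> r m \<mu>" "p \<in> W"
proof -
  obtain W \<Omega> r where lr: "local_retraction M W \<Omega> r m" and pW: "p \<in> W"
    using immersed_submanifold_local_retraction[OF M p] by blast
  interpret local_retraction M W \<Omega> r m by (rule lr)
  interpret spherical_retraction M W \<Omega> r m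
    by unfold_locales (use W_subset sphere m in auto)
  obtain \<mu> where \<mu>: "\<forall>p\<in>topspace M. \<forall>x\<in>tangent_space M p.
      shape_operator M unit_sphere (mean_curvature_vector m M unit_sphere) p x = \<mu> p *\<^sub>R x"
    using umbilical unfolding pseudo_umbilical_def by blast
  have "biharmonic_pseudo_umbilical M W \<Omega> r m \<mu>"
  proof
    show "P q (D H q x) = - (\<mu> q *\<^sub>R x)" if "q \<in> W" "x \<in> tangent_space M q" for q x
      using \<mu> W_subset that shape_operator_eq[OF that] by (metis add.inverse_inverse subsetD)
    show "(\<Sum>e\<in>tangent_frame M q. D (\<lambda>q. D H q (P q e)) q e \<bullet> w) = - (real m * (H q \<bullet> w))"
      if "q \<in> W" "w \<bullet> q = 0" for q w
    proof -
      have "bitension_field M unit_sphere (\<lambda>x. x) q = 0"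
        using biharmonic W_subset that(1) unfolding biharmonic_submanifold_def biharmonic_map_def by blast
      then show ?thesis using bitension_field_eq[OF that] m by (simp add: add_eq_0_iff)
    qed
  qed
  then show thesis using that pW by blast
qed

lemma ex_extremal_chart:
  assumes m4: "m \<noteq> 4" "2 \<le> m" and s: "\<And>q. q \<in> topspace M \<Longrightarrow> scalar_curvature M q = 2 * real m * (real m - 1)"
    and p: "p \<in> topspace M"
  obtains W \<Omega> r \<mu> where "extremal M W \<Omega> r m \<mu>" "p \<in> W"
proof -
  obtain W \<Omega> r \<mu> where b: "biharmonic_pseudo_umbilical M W \<Omega> r m \<mu>" and pW: "p \<in> W"
    using ex_biharmonic_chart[OF p] by blast
  interpret biharmonic_pseudo_umbilical M W \<Omega> r m \<mu> by (rule b)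
  have "extremal M W \<Omega> r m \<mu>"
    by unfold_locales (use m4 s W_subset in auto)
  then show thesis using that pW by blast
qed

text \<open>Connectedness gives one centre \<open>c\<close> and one direction space \<open>L\<close>
  for all points. As \<open>c\<close> is orthogonal to \<open>L\<close> with squared length 1/2, the
  unit sphere meets \<open>c + L\<close> in the sphere of radius \<open>1 / sqrt 2\<close> about
  \<open>c\<close>.\<close>

lemma extremal_open_in_subsphere:
  assumes m4: "m \<noteq> 4" "2 \<le> m" and s: "\<And>q. q \<in> topspace M \<Longrightarrow> scalar_curvature M q = 2 * real m * (real m - 1)"
    and conn: "connected_space M" and ne: "topspace M \<noteq> {}"
  obtains S where "subsphere m (1 / sqrt 2) S" "openin (top_of_set S) (topspace M)" "M = top_of_set (topspace M)"
proof -
  define H where "H = mean_curvature_vector m M unit_sphere"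
  define h where "h q = H q - q" for q
  define T where "T q = tangent_space M q" for q
  define Q where "Q q v = orth_proj (T q) v + ((v \<bullet> h q) / 2) *\<^sub>R h q" for q v
  note chart = ex_extremal_chart[OF m4 s]
  have facts: "subspace (T q) \<and> dim (T q) = m \<and> H q \<bullet> H q = 1 \<and> H q \<bullet> q = 0 \<and> q \<bullet> q = 1 \<and>
      (\<forall>v\<in>T q. H q \<bullet> v = 0 \<and> v \<bullet> q = 0)" if q: "q \<in> topspace M" for q
  proof -
    obtain W \<Omega> r \<mu> where e: "extremal M W \<Omega> r m \<mu>" and qW: "q \<in> W" using chart[OF _ q] by blast
    interpret E: extremal M W \<Omega> r m \<mu> by (rule e)
    show ?thesis
      unfolding H_def T_def E.mean_curvature_vector_eq[OF qW]
      using E.subspace_tangent[OF qW] E.dim_tangent[OF qW] E.H_H[OF qW] E.H_inner_self[OF qW] E.q_q[OF qW]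
        E.H_tangent[OF qW] E.tangent_sphere[OF qW] by blast
  qed
  have sT: "subspace (T q)" and dT: "dim (T q) = m" and HH: "H q \<bullet> H q = 1" and Hq: "H q \<bullet> q = 0"
    and qq: "q \<bullet> q = 1" if "q \<in> topspace M" for q
    using facts[OF that] by blast+
  have hh: "h q \<bullet> h q = 2" if "q \<in> topspace M" for q
    using HH[OF that] Hq[OF that] qq[OF that] by (simp add: h_def inner_diff_left inner_diff_right inner_commute)
  have hT: "v \<bullet> h q = 0" if "q \<in> topspace M" "v \<in> T q" for q v
    using facts[OF that(1)] that(2) by (simp add: h_def inner_diff_right inner_commute[of v "H q"])
  have center: "p + H p = q + H q" if pq: "p \<in> topspace M" "q \<in> topspace M" for p q
  proof (rule connected_space_locally_constant[OF conn _ pq])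
    fix x assume x: "x \<in> topspace M"
    obtain W \<Omega> r \<mu> where e: "extremal M W \<Omega> r m \<mu>" and xW: "x \<in> W" using chart[OF _ x] by blast
    show "\<exists>V. openin M V \<and> x \<in> V \<and> (\<forall>q\<in>V. q + H q = x + H x)"
      unfolding H_def by (rule extremal.center_locally_constant[OF e xW])
  qed
  have normal: "Q p v = Q q v" if pq: "p \<in> topspace M" "q \<in> topspace M" for p q v
  proof (rule connected_space_locally_constant[OF conn _ pq, where f = "\<lambda>q. Q q v"])
    fix x assume x: "x \<in> topspace M"
    obtain W \<Omega> r \<mu> where e: "extremal M W \<Omega> r m \<mu>" and xW: "x \<in> W" using chart[OF _ x] by blast
    show "\<exists>V. openin M V \<and> x \<in> V \<and> (\<forall>q\<in>V. Q q v = Q x v)"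
      unfolding Q_def h_def T_def H_def by (rule extremal.normal_bundle_locally_constant[OF e xW])
  qed
  obtain p0 where p0: "p0 \<in> topspace M" using ne by blast
  define c where "c = (1/2) *\<^sub>R (p0 + H p0)"
  define L where "L = range (Q p0)"
  have linQ: "linear (Q q)" if "q \<in> topspace M" for q
  proof -
    have "linear (\<lambda>v. ((v \<bullet> h q) / 2) *\<^sub>R h q)"
      by (rule linearI) (simp_all add: inner_add_left add_divide_distrib scaleR_add_left)
    then show ?thesis
      unfolding Q_def using linear_orth_proj[OF sT[OF that]] by (intro linear_compose_add)
  qed
  have L: "L = range (Q q)" if "q \<in> topspace M" for q
    unfolding L_def using normal[OF p0 that] by (simp add: fun_eq_iff image_def)
  have sL: "subspace L" unfolding L_def by (rule linear_subspace_image[OF linQ[OF p0] subspace_UNIV])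
  have Qh: "Q q (h q) = h q" if "q \<in> topspace M" for q
  proof -
    have "orth_proj (T q) (h q) = 0"
      unfolding orth_proj_eq_0_iff[OF sT[OF that]] using hT[OF that] by (simp add: inner_commute)
    then show ?thesis by (simp add: Q_def hh[OF that])
  qed
  have QT: "Q q v = v" if "q \<in> topspace M" "v \<in> T q" for q v
    using orth_proj_ident[OF sT[OF that(1)] that(2)] hT[OF that] by (simp add: Q_def)
  have hL: "h q \<in> L" if "q \<in> topspace M" for q using L[OF that] Qh[OF that] by (metis rangeI)
  have dimL: "dim L = m + 1"
  proof -
    have "L = span (insert (h p0) (T p0))"
    proof
      show "L \<subseteq> span (insert (h p0) (T p0))"
      proof
        fix w assume "w \<in> L"
        then obtain v where "w = orth_proj (T p0) v + ((v \<bullet> h p0) / 2) *\<^sub>R h p0" unfolding L_def Q_def by blast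
        then show "w \<in> span (insert (h p0) (T p0))"
          using orth_proj_in[OF sT[OF p0], of v] by (simp add: span_add span_base span_mul)
      qed
      have "insert (h p0) (T p0) \<subseteq> L" using hL[OF p0] QT[OF p0] unfolding L_def by (metis insert_subset rangeI subsetI)
      then show "span (insert (h p0) (T p0)) \<subseteq> L" using sL by (rule span_minimal)
    qed
    moreover have "h p0 \<notin> span (T p0)" using hT[OF p0, of "h p0"] hh[OF p0] sT[OF p0] by (auto simp: span_eq_iff[THEN iffD2])
    ultimately show ?thesis by (simp add: dim_insert dT[OF p0])
  qed
  have cc: "c \<bullet> c = 1/2"
    using HH[OF p0] Hq[OF p0] qq[OF p0] by (simp add: c_def inner_add_left inner_add_right inner_commute)
  have cL: "c \<bullet> w = 0" if "w \<in> L" for w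
  proof -
    obtain v where w: "w = orth_proj (T p0) v + ((v \<bullet> h p0) / 2) *\<^sub>R h p0" using \<open>w \<in> L\<close> unfolding L_def Q_def by blast
    have "(p0 + H p0) \<bullet> h p0 = 0"
      using HH[OF p0] Hq[OF p0] qq[OF p0]
      by (simp add: h_def inner_add_left inner_diff_right inner_commute[of p0 "H p0"])
    moreover have "(p0 + H p0) \<bullet> orth_proj (T p0) v = 0"
    proof -
      have "H p0 \<bullet> orth_proj (T p0) v = 0" "orth_proj (T p0) v \<bullet> p0 = 0"
        using facts[OF p0] orth_proj_in[OF sT[OF p0], of v] by blast+
      then show ?thesis by (simp add: inner_add_left inner_commute[of p0 "orth_proj (T p0) v"])
    qed
    ultimately show ?thesis by (simp add: c_def w inner_add_right)
  qed
  define A where "A = (+) c ` L"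
  define S where "S = sphere 0 1 \<inter> A"
  have inA: "y \<in> A \<longleftrightarrow> y - c \<in> L" for y
    unfolding A_def by (auto simp: image_iff algebra_simps) (metis add.commute diff_add_cancel)
  have norms: "y \<bullet> y = 1/2 + (y - c) \<bullet> (y - c)" if "y \<in> A" for y
  proof -
    have "y \<bullet> y = (c + (y - c)) \<bullet> (c + (y - c))" by simp
    also have "\<dots> = c \<bullet> c + 2 * (c \<bullet> (y - c)) + (y - c) \<bullet> (y - c)"
      by (simp only: inner_add_left inner_add_right inner_commute[of "y - c" c])
    finally show ?thesis using cL that by (simp add: cc inA)
  qed
  have sphere_eq: "S = sphere c (1 / sqrt 2) \<inter> A"
  proof -
    have "y \<in> sphere 0 1 \<longleftrightarrow> y \<in> sphere c (1 / sqrt 2)" if "y \<in> A" for y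
    proof -
      have "y \<in> sphere c (1 / sqrt 2) \<longleftrightarrow> norm (y - c) = 1 / sqrt 2" by (simp add: dist_norm norm_minus_commute)
      also have "\<dots> \<longleftrightarrow> (norm (y - c))\<^sup>2 = (1 / sqrt 2)\<^sup>2" by (simp add: power2_eq_iff_nonneg)
      also have "\<dots> \<longleftrightarrow> (y - c) \<bullet> (y - c) = 1/2" by (simp add: power2_norm_eq_inner power_divide)
      also have "\<dots> \<longleftrightarrow> y \<bullet> y = 1" using norms[OF that] by auto
      finally show ?thesis by (simp add: norm_eq_1)
    qed
    then show ?thesis unfolding S_def by blast
  qed
  have "affine L" "aff_dim L = int m + 1"
    using subspace_imp_affine[OF sL] aff_dim_subspace[OF sL] dimL by simp_all
  then have "affine A" "aff_dim A = int m + 1"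
    unfolding A_def by (simp_all add: affine_translation[symmetric] aff_dim_translation_eq)
  moreover have "c \<in> A" unfolding inA using sL by (simp add: subspace_0)
  ultimately have sub: "subsphere m (1 / sqrt 2) S"
    unfolding subsphere_def using sphere_eq S_def by blast
  have qc: "q - c = (- 1/2) *\<^sub>R h q" if "q \<in> topspace M" for q
  proof -
    have "2 *\<^sub>R (q - c) = 2 *\<^sub>R q - (q + H q)" using center[OF p0 that] by (simp add: c_def scaleR_diff_right)
    also have "\<dots> = - h q" by (simp add: h_def scaleR_2)
    finally have "(1/2) *\<^sub>R (2 *\<^sub>R (q - c)) = (1/2) *\<^sub>R (- h q)" by simp
    then show ?thesis by simp
  qed
  have MS: "topspace M \<subseteq> S"
  proof
    fix q assume q: "q \<in> topspace M"
    have "q \<in> A" unfolding inA qc[OF q] using hL[OF q] sL subspace_mul by blast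
    then show "q \<in> S" using sphere q unfolding S_def by blast
  qed
  have "\<exists>W. p \<in> W \<and> openin M W \<and> openin (top_of_set S) W \<and> subtopology M W = top_of_set W"
    if p: "p \<in> topspace M" for p
  proof (rule immersed_submanifold_open_in[OF M p sT[OF p] dT[OF p] _ _ _ _ MS])
    \<comment> \<open>The half-space selects the open hemisphere of \<open>S\<close> around
      \<open>p\<close>, since \<open>p - c\<close> is \<open>- h p / 2\<close>; orthogonal
      projection onto the tangent space is injective on it.\<close>
    let ?N = "{y. (y - c) \<bullet> h p < 0}"
    let ?l = "\<lambda>y. orth_proj (T p) (y - c)"
    have "bounded_linear (orth_proj (T p))"
      using linear_orth_proj[OF sT[OF p]] linear_conv_bounded_linear by blast
    then show "continuous_on UNIV ?l"
      by (rule bounded_linear.continuous_on) (intro continuous_intros)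
    show "?l y \<in> T p" for y by (rule orth_proj_in[OF sT[OF p]])
    show "open ?N" by (intro open_Collect_less continuous_intros)
    show "p \<in> ?N" using hh[OF p] by (simp add: qc[OF p])
    show "inj_on ?l (S \<inter> ?N)"
    proof (rule inj_onI)
      fix x y assume x: "x \<in> S \<inter> ?N" and y: "y \<in> S \<inter> ?N" and xy: "?l x = ?l y"
      \<comment> \<open>\<open>Q p\<close> is a projection onto \<open>L\<close> and thus fixes
        \<open>z - c\<close>; its formula becomes an orthogonal decomposition.\<close>
      have dec: "z - c = ?l z + (((z - c) \<bullet> h p) / 2) *\<^sub>R h p" "(z - c) \<bullet> (z - c) = 1/2" if "z \<in> S" for z
      proof -
        have zA: "z \<in> A" "z \<bullet> z = 1" using that unfolding S_def by (auto simp: norm_eq_1)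
        then obtain v where v: "z - c = Q p v" using L[OF p] unfolding inA by blast
        have "Q p (Q p v) = Q p (orth_proj (T p) v) + Q p (((v \<bullet> h p) / 2) *\<^sub>R h p)"
          using linear_add[OF linQ[OF p]] by (simp add: Q_def)
        also have "\<dots> = Q p v"
          by (simp add: QT[OF p orth_proj_in[OF sT[OF p]]] linear_cmul[OF linQ[OF p]] Qh[OF p]) (simp add: Q_def)
        finally have "Q p (z - c) = z - c" using v by simp
        then show "z - c = ?l z + (((z - c) \<bullet> h p) / 2) *\<^sub>R h p" by (simp add: Q_def)
        show "(z - c) \<bullet> (z - c) = 1/2" using norms[OF zA(1)] zA(2) by simp
      qed
      \<comment> \<open>The tangential projection determines the height along \<open>h p\<close> up
        to sign, and \<open>?N\<close> fixes the sign.\<close>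
      have pyth: "1/2 = ?l z \<bullet> ?l z + ((z - c) \<bullet> h p)\<^sup>2 / 2" if z: "z \<in> S" for z
      proof -
        define a where "a = ?l z"
        define t where "t = (z - c) \<bullet> h p"
        have "a \<bullet> h p = 0" unfolding a_def by (rule hT[OF p orth_proj_in[OF sT[OF p]]])
        then have "(a + (t / 2) *\<^sub>R h p) \<bullet> (a + (t / 2) *\<^sub>R h p) = a \<bullet> a + t\<^sup>2 / 2"
          by (simp add: inner_add_left inner_add_right inner_commute[of "h p" a] hh[OF p] power2_eq_square)
        then show ?thesis using dec[OF z] unfolding a_def t_def by metis
      qed
      have "((x - c) \<bullet> h p)\<^sup>2 = ((y - c) \<bullet> h p)\<^sup>2"
        using pyth[of x] pyth[of y] x y xy by auto
      then have "(x - c) \<bullet> h p = (y - c) \<bullet> h p" using x y by (auto simp: power2_eq_iff)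
      then have "x - c = y - c" using dec(1)[of x] dec(1)[of y] x y xy by (metis IntD1)
      then show "x = y" by simp
    qed
  qed
  from topology_eq_top_of_set[OF this] show thesis using that[OF sub] by blast
qed

end

text \<open>The equality statement starts at \<open>m = 2\<close>: every curve has scalar curvature
  0, which equals the bound for \<open>m = 1\<close>, and great circles are biharmonic and
  pseudo-umbilical without having radius \<open>1 / sqrt 2\<close>. Connectedness keeps all of
  \<open>M\<close> in a single small sphere.\<close>

theorem proposition5p2:
  fixes M :: "'a::euclidean_space topology" and m n :: nat
  assumes "DIM('a) = n + 1"
    and "1 \<le> m" and "m \<noteq> 4"
    and "immersed_submanifold m M" and "connected_space M" and "topspace M \<noteq> {}"
    and "topspace M \<subseteq> sphere 0 1"
    and "biharmonic_submanifold M (top_of_set (sphere 0 1))"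
    and "pseudo_umbilical m M (top_of_set (sphere 0 1))"
  shows "(\<forall>p\<in>topspace M. scalar_curvature M p \<le> 2 * real m * (real m - 1)) \<and>
    (2 \<le> m \<longrightarrow>
      ((\<forall>p\<in>topspace M. scalar_curvature M p = 2 * real m * (real m - 1)) \<longleftrightarrow>
       (\<exists>S V. subsphere m (1 / sqrt 2) S \<and> openin (top_of_set S) V \<and> M = top_of_set V)))"
proof (intro conjI impI ballI iffI)
  have m: "0 < m" using assms(2) by simp
  note hyps = assms(4) m assms(7-9)
  show "scalar_curvature M p \<le> 2 * real m * (real m - 1)" if p: "p \<in> topspace M" for p
  proof -
    obtain W \<Omega> r \<mu> where b: "biharmonic_pseudo_umbilical M W \<Omega> r m \<mu>" and pW: "p \<in> W"
      using ex_biharmonic_chart[OF hyps p] by blast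
    show ?thesis by (rule biharmonic_pseudo_umbilical.scalar_curvature_bound[OF b assms(3) pW])
  qed
  show "\<exists>S V. subsphere m (1 / sqrt 2) S \<and> openin (top_of_set S) V \<and> M = top_of_set V"
    if m2: "2 \<le> m" and s: "\<forall>p\<in>topspace M. scalar_curvature M p = 2 * real m * (real m - 1)"
    using extremal_open_in_subsphere[OF hyps assms(3) m2 bspec[OF s] assms(5,6)] by blast
  show "scalar_curvature M p = 2 * real m * (real m - 1)"
    if SV: "\<exists>S V. subsphere m (1 / sqrt 2) S \<and> openin (top_of_set S) V \<and> M = top_of_set V"
      and p: "p \<in> topspace M" for p
  proof -
    obtain S V where S: "subsphere m (1 / sqrt 2) S" and V: "openin (top_of_set S) V" "M = top_of_set V" using SV by blast
    obtain A c where A: "affine A" "aff_dim A = int m + 1" "c \<in> A" "S = sphere c (1 / sqrt 2) \<inter> A"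
      using S unfolding subsphere_def by blast
    obtain W \<Omega> r where lr: "local_retraction M W \<Omega> r m" and pW: "p \<in> W"
      using immersed_submanifold_local_retraction[OF assms(4) p] by blast
    interpret local_retraction M W \<Omega> r m by (rule lr)
    have "W \<subseteq> S" using W_subset V openin_imp_subset[OF V(1)] by simp
    then show ?thesis using scalar_curvature_subsphere[OF A(1-3) _ pW] A(4) by simp
  qed
qed

end
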